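(* Let $\mathbb{F}$ be a field of characteristic $0$, let $\ell_1,\ell_2,\ell_3,\ell_4\ge 0$ be integers with $\ell=\ell_1+\ell_2+\ell_3+\ell_4>0$, let $\Gamma$ be an additive subgroup of $\mathbb{F}^\ell$ as in the context (elements have first $\ell_1$ coordinates zero, and $\Gamma$ is nondegenerate in $\mathbb{F}^{\ell_2+\ell_3+\ell_4}$), and let $\mathcal{W}=\mathcal{W}(\ell_1,\ell_2,\ell_3,\ell_4,\Gamma)$ be the Lie algebra of generalized differential operators. Then: (1) If $\ell_1+\ell_2\neq 0$ or $\ell\ge 2$, then $H^2(\mathcal{W},\mathbb{F})=0$. (2) If $\ell=\ell_4=1$ (so $\Gamma\subseteq\mathbb{F}$; write $\partial=\partial_1$), then $H^2(\mathcal{W},\mathbb{F})=\mathbb{F}\,\overline{\phi}_0$, where $\overline{\phi}_0$ is the cohomology class of $\phi_0$ defined by $$\phi_0\bigl(x^\alpha\partial^\mu,\;x^\beta\partial^\nu\bigr)=\delta_{\alpha+\beta,0}\,(-1)^\mu\,\mu!\,\nu!\,\binom{\alpha+\mu}{\mu+\nu+1}$$ for all $\alpha,\beta\in\Gamma$ and $\mu,\nu\in\mathbb{Z}_+$. (3) Suppose $\ell=\ell_3=1$ (so $\Gamma\subseteq\mathbb{F}$, $\vec J=\mathbb{Z}$; write $\partial=\partial_1$). Then for every $\gamma\in\Gamma$ there exists a cohomology class $\overline{\phi}_\gamma$, namely the class of the 2-cocycle $\phi_\gamma$ defined by $$\phi_\gamma\bigl(x^{\alpha,i}\partial^\mu,\;x^{\beta,j}\partial^\nu\bigr)=\delta_{\alpha+\beta,\gamma}\,(-1)^\mu\,\mu!\,\nu!\sum_{s=0}^{\mu+\nu+1}\binom{i}{s}\,\frac{\alpha^{\mu+\nu+1-s}}{(\mu+\nu+1-s)!}\cdot\frac{\gamma^{s-i-j-1}}{(s-i-j-1)!}$$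 for all $(\alpha,i,\mu),(\beta,j,\nu)\in\Gamma\times\mathbb{Z}\times\mathbb{Z}_+$. Furthermore, $$H^2(\mathcal{W},\mathbb{F})=\prod_{\gamma\in\Gamma}\mathbb{F}\,\overline{\phi}_\gamma$$ is the direct product of all $\mathbb{F}\,\overline{\phi}_\gamma$, $\gamma\in\Gamma$; here the element of the product with components $b_\gamma\overline{\phi}_\gamma$ ($b_\gamma\in\mathbb{F}$) is the class of the 2-cocycle $\sum_{\gamma\in\Gamma}b_\gamma\phi_\gamma$ (the possibly infinite sum makes sense because on each pair of basis elements at most one $\phi_\gamma$ is nonzero).
   Context: $\mathbb{F}$ is a field of characteristic $0$; $\mathbb{Z}_+$ is the set of nonnegative integers. **2-cocycles.** For a Lie algebra $L$ over $\mathbb{F}$, a 2-cocycle is an $\mathbb{F}$-bilinear map $\psi:L\times L\to\mathbb{F}$ with $\psi(v_1,v_2)=-\psi(v_2,v_1)$ and $\psi([v_1,v_2],v_3)+\psi([v_2,v_3],v_1)+\psi([v_3,v_1],v_2)=0$. For a linear $f:L\to\mathbb{F}$, $\psi_f(v_1,v_2)=f([v_1,v_2])$ is a 2-cocycle, called a 2-coboundary. $C^2(L,\mathbb{F})$ and $B^2(L,\mathbb{F})$ are the spaces of 2-cocycles and 2-coboundaries, and $H^2(L,\mathbb{F})=C^2(L,\mathbb{F})/B^2(L,\mathbb{F})$. **The Lie algebra $\mathcal{W}(\ell_1,\ell_2,\ell_3,\ell_4,\Gamma)$.** Let $\ell_1,\dots,\ell_4\ge0$ be integers with $\ell=\sum_i\ell_i>0$.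 Let $\Gamma$ be an additive subgroup of $\mathbb{F}^\ell$ such that every $\alpha\in\Gamma$ has the form $\alpha=(0,\dots,0,\alpha_{\ell_1+1},\dots,\alpha_\ell)$ and such that $\Gamma$, viewed as a subgroup of $\mathbb{F}^{\ell_2+\ell_3+\ell_4}$, is nondegenerate, i.e. contains an $\mathbb{F}$-basis of $\mathbb{F}^{\ell_2+\ell_3+\ell_4}$. Let $\vec J=\mathbb{Z}_+^{\ell_1+\ell_2}\times\mathbb{Z}^{\ell_3}\times\{0\}^{\ell_4}\subset\mathbb{Z}^\ell$, and let $1_{[p]}\in\mathbb{Z}^\ell$ be the vector with $1$ in position $p$ and $0$ elsewhere. Let $\mathcal{A}$ be the commutative semigroup algebra with basis $\{x^{\alpha,\vec i}\mid\alpha\in\Gamma,\ \vec i\in\vec J\}$ and product $x^{\alpha,\vec i}x^{\beta,\vec j}=x^{\alpha+\beta,\vec i+\vec j}$; write $x^\alpha=x^{\alpha,\vec 0}$ and $1=x^{0,\vec 0}$. Define commuting derivations $\partial_1,\dots,\partial_\ell$ of $\mathcal{A}$ by $$\partial_p(x^{\alpha,\vec i})=\alpha_p\,x^{\alpha,\vec i}+i_p\,x^{\alpha,\vec i-1_{[p]}},$$ where the second term is $0$ if $i_p=0$ (thus $\alpha_p=0$ for $p\le\ell_1$ and $i_p=0$ for $p>\ell_1+\ell_2+\ell_3$). Let $\mathbb{F}[\mathcal{D}]$ be the polynomial algebra with basis $\partial^\mu=\prod_p\partial_p^{\mu_p}$, $\mu\in\mathbb{Z}_+^\ell$. Then $\mathcal{W}=\mathcal{A}\otimes\mathbb{F}[\mathcal{D}]$,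 with basis $\{x^{\alpha,\vec i}\partial^\mu\mid\alpha\in\Gamma,\ \vec i\in\vec J,\ \mu\in\mathbb{Z}_+^\ell\}$, is an associative algebra under $$u\partial^\mu\odot v\partial^\nu=u\sum_{\lambda\in\mathbb{Z}_+^\ell}\binom{\mu}{\lambda}\partial^\lambda(v)\,\partial^{\mu+\nu-\lambda},\qquad \binom{\mu}{\lambda}=\prod_{p=1}^\ell\binom{\mu_p}{\lambda_p},\quad \partial^\lambda(v)=\partial_1^{\lambda_1}\cdots\partial_\ell^{\lambda_\ell}(v),$$ for $u,v\in\mathcal{A}$, and $\mathcal{W}$ is regarded as a Lie algebra under the commutator $[a,b]=a\odot b-b\odot a$. **Conventions.** For $a\in\mathbb{F}$ and $m\in\mathbb{Z}_+$, $[a]_m=a(a-1)\cdots(a-m+1)$ and $\binom{a}{m}=[a]_m/m!$ (with $[a]_0=1$). Also $a^0=1$ for all $a\in\mathbb{F}$, including $a=0$, and $\frac{\gamma^k}{k!}$ is interpreted as $0$ whenever $k\le -1$; in particular for $\gamma=0$ one has $\frac{\gamma^{s-i-j-1}}{(s-i-j-1)!}=\delta_{i+j,s-1}$.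
   Formalization: In part (2) the formula for φ_0 is stated on the pairs x^α[∂]_μ, x^β[∂]_ν, with [∂]_μ = ∂(∂−1)…(∂−μ+1), instead of x^α∂^μ, x^β∂^ν; on the latter it does not define a 2-cocycle. *)

theory Defs
  imports
    Complex_Main
    "HOL-Library.FuncSet"
    "HOL-Library.Poly_Mapping"
    "HOL-Library.Function_Algebras"
    "HOL-Library.Product_Plus"
    "HOL-Library.Set_Algebras"
begin

section \<open>Second cohomology of a Lie algebra with trivial coefficients\<close>

text \<open>
  A Lie algebra over \<open>'a\<close> is given by a carrier inside an additive group \<open>'w\<close>, with the
  addition of \<open>'w\<close>, a scalar multiplication and a bracket.
\<close>

record ('a, 'w) lie_algebra =
  lie_carrier :: "'w set"
  lie_scale :: "'a \<Rightarrow> 'w \<Rightarrow> 'w"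
  lie_bracket :: "'w \<Rightarrow> 'w \<Rightarrow> 'w"

definition linear_on :: "('a::field, 'w::ab_group_add) lie_algebra \<Rightarrow> ('w \<Rightarrow> 'a) \<Rightarrow> bool" where
  "linear_on L f \<longleftrightarrow>
     (\<forall>u\<in>lie_carrier L. \<forall>v\<in>lie_carrier L. f (u + v) = f u + f v) \<and>
     (\<forall>c. \<forall>u\<in>lie_carrier L. f (lie_scale L c u) = c * f u)"

text \<open>
  A map \<open>L \<times> L \<rightarrow> 'a\<close> is represented by the total function that extends it by \<open>0\<close> outside
  \<open>L \<times> L\<close>, so that equal maps are equal functions.
\<close>

definition cocycles2 :: "('a::field, 'w::ab_group_add) lie_algebra \<Rightarrow> ('w \<Rightarrow> 'w \<Rightarrow> 'a) set" where
  "cocycles2 L = {\<psi>.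
     (\<forall>u v. u \<notin> lie_carrier L \<or> v \<notin> lie_carrier L \<longrightarrow> \<psi> u v = 0) \<and>
     (\<forall>u\<in>lie_carrier L. linear_on L (\<lambda>v. \<psi> u v)) \<and>
     (\<forall>v\<in>lie_carrier L. linear_on L (\<lambda>u. \<psi> u v)) \<and>
     (\<forall>u\<in>lie_carrier L. \<forall>v\<in>lie_carrier L. \<psi> u v = - \<psi> v u) \<and>
     (\<forall>u\<in>lie_carrier L. \<forall>v\<in>lie_carrier L. \<forall>w\<in>lie_carrier L.
        \<psi> (lie_bracket L u v) w + \<psi> (lie_bracket L v w) u + \<psi> (lie_bracket L w u) v = 0)}"

definition coboundary2 ::
    "('a::field, 'w::ab_group_add) lie_algebra \<Rightarrow> ('w \<Rightarrow> 'a) \<Rightarrow> 'w \<Rightarrow> 'w \<Rightarrow> 'a" where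
  "coboundary2 L f = (\<lambda>u v.
     if u \<in> lie_carrier L \<and> v \<in> lie_carrier L then f (lie_bracket L u v) else 0)"

definition coboundaries2 ::
    "('a::field, 'w::ab_group_add) lie_algebra \<Rightarrow> ('w \<Rightarrow> 'w \<Rightarrow> 'a) set" where
  "coboundaries2 L = coboundary2 L ` {f. linear_on L f}"

text \<open>
  The quotient space \<open>H\<^sup>2\<close> consists of the cosets of \<open>coboundaries2 L\<close> in \<open>cocycles2 L\<close>. The
  sum of two cosets is their elementwise sum \<open>X + Y\<close>; the zero is \<open>coh_class L 0\<close>.
\<close>

definition coh_class ::
    "('a::field, 'w::ab_group_add) lie_algebra \<Rightarrow> ('w \<Rightarrow> 'w \<Rightarrow> 'a) \<Rightarrow> ('w \<Rightarrow> 'w \<Rightarrow> 'a) set" where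
  "coh_class L \<psi> = \<psi> +o coboundaries2 L"

definition H2 :: "('a::field, 'w::ab_group_add) lie_algebra \<Rightarrow> ('w \<Rightarrow> 'w \<Rightarrow> 'a) set set" where
  "H2 L = coh_class L ` cocycles2 L"

text \<open>Adding \<open>coboundaries2 L\<close> makes the result a full coset also when \<open>c = 0\<close>.\<close>

definition H2_scale ::
    "('a::field, 'w::ab_group_add) lie_algebra \<Rightarrow> 'a \<Rightarrow>
      ('w \<Rightarrow> 'w \<Rightarrow> 'a) set \<Rightarrow> ('w \<Rightarrow> 'w \<Rightarrow> 'a) set" where
  "H2_scale L c X = (\<lambda>\<psi> u v. c * \<psi> u v) ` X + coboundaries2 L"

definition H2_line ::
    "('a::field, 'w::ab_group_add) lie_algebra \<Rightarrow>
      ('w \<Rightarrow> 'w \<Rightarrow> 'a) set \<Rightarrow> ('w \<Rightarrow> 'w \<Rightarrow> 'a) set set" where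
  "H2_line L X = range (\<lambda>c. H2_scale L c X)"


section \<open>The Lie algebra of generalized differential operators\<close>

text \<open>
  Vectors of length \<open>l\<close> are functions on \<open>nat\<close> that vanish outside the positions
  \<open>{1..l}\<close>; thus \<open>0(p := c)\<close> has the entry \<open>c\<close> in position \<open>p\<close> and \<open>0\<close> elsewhere.
  The commutative algebra \<open>\<A>\<close> consists of the elements of the type \<open>'a gen_fun\<close> whose keys
  lie in \<open>\<Gamma> \<times> J\<close>; \<open>x\<^bsup>\<alpha>,i\<^esup>\<close> is \<open>Poly_Mapping.single (\<alpha>, i) 1\<close>, and the product
  of \<open>\<A>\<close> is the convolution \<open>(*)\<close> of \<open>HOL-Library.Poly_Mapping\<close>.
  An element of \<open>'a gen_op\<close> maps \<open>\<mu>\<close> to the coefficient in \<open>\<A>\<close> of \<open>\<partial>\<^bsup>\<mu>\<^esup>\<close>; its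
  associative product is \<open>op_mult\<close> below, not the convolution of the type.
\<close>

type_synonym 'a gen_fun = "((nat \<Rightarrow> 'a) \<times> (nat \<Rightarrow> int)) \<Rightarrow>\<^sub>0 'a"
type_synonym 'a gen_op = "(nat \<Rightarrow> nat) \<Rightarrow>\<^sub>0 'a gen_fun"

definition nondegenerate_subgroup :: "nat \<Rightarrow> nat \<Rightarrow> (nat \<Rightarrow> 'a::field) set \<Rightarrow> bool" where
  "nondegenerate_subgroup l1 l \<Gamma> \<longleftrightarrow>
     (let V = {v. \<forall>p. p \<notin> {l1 + 1..l} \<longrightarrow> v p = 0}; scale = (\<lambda>c v p. c * v p) in
       \<Gamma> \<subseteq> V \<and> 0 \<in> \<Gamma> \<and> (\<forall>\<alpha>\<in>\<Gamma>. \<forall>\<beta>\<in>\<Gamma>. \<alpha> + \<beta> \<in> \<Gamma>) \<and> (\<forall>\<alpha>\<in>\<Gamma>. - \<alpha> \<in> \<Gamma>) \<and>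
       (\<exists>B\<subseteq>\<Gamma>. \<not> module.dependent scale B \<and> module.span scale B = V))"

definition J_set :: "nat \<Rightarrow> nat \<Rightarrow> nat \<Rightarrow> nat \<Rightarrow> (nat \<Rightarrow> int) set" where
  "J_set l1 l2 l3 l4 = {i. (\<forall>p. p \<notin> {1..l1 + l2 + l3 + l4} \<longrightarrow> i p = 0) \<and>
     (\<forall>p\<in>{1..l1 + l2}. 0 \<le> i p) \<and>
     (\<forall>p\<in>{l1 + l2 + l3 + 1..l1 + l2 + l3 + l4}. i p = 0)}"

definition partial :: "nat \<Rightarrow> 'a::field gen_fun \<Rightarrow> 'a gen_fun" where
  "partial p u = (\<Sum>(\<alpha>, i)\<in>Poly_Mapping.keys u.
     Poly_Mapping.single (\<alpha>, i) (Poly_Mapping.lookup u (\<alpha>, i) * \<alpha> p) +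
     Poly_Mapping.single (\<alpha>, i - 0(p := 1)) (Poly_Mapping.lookup u (\<alpha>, i) * of_int (i p)))"

text \<open>\<open>partial_pow l \<lambda>\<close> is \<open>\<partial>\<^sub>1\<^bsup>\<lambda>\<^sub>1\<^esup> \<dots> \<partial>\<^sub>l\<^bsup>\<lambda>\<^sub>l\<^esup>\<close>.\<close>

primrec partial_pow :: "nat \<Rightarrow> (nat \<Rightarrow> nat) \<Rightarrow> 'a::field gen_fun \<Rightarrow> 'a gen_fun" where
  "partial_pow 0 lam = id"
| "partial_pow (Suc n) lam = partial_pow n lam \<circ> (partial (Suc n) ^^ lam (Suc n))"

text \<open>
  In the sum over \<open>\<lambda>\<close> only the finitely many \<open>\<lambda> \<le> \<mu>\<close> (pointwise order) are kept: for
  all others the binomial coefficient is \<open>0\<close>.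
\<close>

definition op_mult :: "nat \<Rightarrow> 'a::field gen_op \<Rightarrow> 'a gen_op \<Rightarrow> 'a gen_op" where
  "op_mult l a b =
     (\<Sum>\<mu>\<in>Poly_Mapping.keys a. \<Sum>\<nu>\<in>Poly_Mapping.keys b. \<Sum>lam\<in>{lam. lam \<le> \<mu>}.
        Poly_Mapping.single (\<mu> + \<nu> - lam)
          (Poly_Mapping.lookup a \<mu> *
            (of_nat (\<Prod>p\<in>{1..l}. \<mu> p choose lam p) *
             partial_pow l lam (Poly_Mapping.lookup b \<nu>))))"

definition op_scale :: "'a::field \<Rightarrow> 'a gen_op \<Rightarrow> 'a gen_op" where
  "op_scale c = Poly_Mapping.map (\<lambda>u. Poly_Mapping.map (\<lambda>d. c * d) u)"

definition op_carrier ::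
    "nat \<Rightarrow> nat \<Rightarrow> nat \<Rightarrow> nat \<Rightarrow> (nat \<Rightarrow> 'a::field) set \<Rightarrow> 'a gen_op set" where
  "op_carrier l1 l2 l3 l4 \<Gamma> = {a. \<forall>\<mu>\<in>Poly_Mapping.keys a.
     (\<forall>p. p \<notin> {1..l1 + l2 + l3 + l4} \<longrightarrow> \<mu> p = 0) \<and>
     Poly_Mapping.keys (Poly_Mapping.lookup a \<mu>) \<subseteq> \<Gamma> \<times> J_set l1 l2 l3 l4}"

definition W_algebra ::
    "nat \<Rightarrow> nat \<Rightarrow> nat \<Rightarrow> nat \<Rightarrow> (nat \<Rightarrow> 'a::field) set \<Rightarrow> ('a, 'a gen_op) lie_algebra" where
  "W_algebra l1 l2 l3 l4 \<Gamma> =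
     \<lparr>lie_carrier = op_carrier l1 l2 l3 l4 \<Gamma>,
      lie_scale = op_scale,
      lie_bracket = (\<lambda>a b. op_mult (l1 + l2 + l3 + l4) a b - op_mult (l1 + l2 + l3 + l4) b a)\<rparr>"

text \<open>The basis element \<open>x\<^bsup>\<alpha>,i\<^esup> \<partial>\<^bsup>\<mu>\<^esup>\<close>.\<close>

definition xd :: "(nat \<Rightarrow> 'a) \<Rightarrow> (nat \<Rightarrow> int) \<Rightarrow> (nat \<Rightarrow> nat) \<Rightarrow> 'a::field gen_op" where
  "xd \<alpha> i \<mu> = Poly_Mapping.single \<mu> (Poly_Mapping.single (\<alpha>, i) 1)"

text \<open>
  For \<open>l = 1\<close>: the falling power
  \<open>[\<partial>]\<^sub>m = \<partial> \<odot> (\<partial> - 1) \<odot> \<dots> \<odot> (\<partial> - m + 1)\<close> of \<open>\<partial> = \<partial>\<^sub>1\<close>.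
\<close>

primrec falling_d :: "nat \<Rightarrow> 'a::field gen_op" where
  "falling_d 0 = xd 0 0 0"
| "falling_d (Suc m) =
     op_mult 1 (falling_d m) (xd 0 0 (0(1 := 1)) - op_scale (of_nat m) (xd 0 0 0))"

text \<open>
  The element \<open>x\<^bsup>\<alpha>\<^esup> [\<partial>]\<^sub>m\<close> for \<open>l = 1\<close>. If \<open>\<partial> = t d/dt\<close> and \<open>x\<^bsup>\<alpha>\<^esup> = t\<^bsup>\<alpha>\<^esup>\<close>, it is
  \<open>t\<^bsup>\<alpha>+m\<^esup> (d/dt)\<^bsup>m\<^esup>\<close>. On these elements, and not on the \<open>x\<^bsup>\<alpha>\<^esup> \<partial>\<^bsup>m\<^esup>\<close>, the formula
  \<open>\<delta>\<^bsub>\<alpha>+\<beta>,0\<^esub> (-1)\<^bsup>\<mu>\<^esup> \<mu>! \<nu>! binom(\<alpha>+\<mu>, \<mu>+\<nu>+1)\<close> is the Kac--Peterson cocycle: if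
  \<open>\<psi>\<close> is bilinear and has these values on the pairs \<open>(x\<^bsup>\<alpha>\<^esup> \<partial>\<^bsup>\<mu>\<^esup>, x\<^bsup>\<beta>\<^esup> \<partial>\<^bsup>\<nu>\<^esup>)\<close>, then the
  cyclic sum for \<open>x\<^bsup>\<alpha>\<^esup>\<close>, \<open>x\<^bsup>2\<alpha>\<^esup>\<close>, \<open>x\<^bsup>-3\<alpha>\<^esup> \<partial>\<^bsup>3\<^esup>\<close> is \<open>3 \<alpha>\<^bsup>3\<^esup> \<noteq> 0\<close>.
\<close>

definition x_falling_d :: "(nat \<Rightarrow> 'a) \<Rightarrow> nat \<Rightarrow> 'a::field gen_op" where
  "x_falling_d \<alpha> m = op_mult 1 (xd \<alpha> 0 0) (falling_d m)"

text \<open>\<open>c\<^bsup>k\<^esup> / k!\<close> for an integer \<open>k\<close>, read as \<open>0\<close> for \<open>k < 0\<close>.\<close>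

definition divided_power :: "'a::field_char_0 \<Rightarrow> int \<Rightarrow> 'a" where
  "divided_power c k = (if k < 0 then 0 else c ^ nat k / fact (nat k))"

end

theory Submission
  imports Defs "HOL-Computational_Algebra.Polynomial"
begin

text \<open>
  In an associative algebra let \<open>dx - xd = 1\<close> with \<open>ad x\<close> locally nilpotent; then \<open>ad x\<close> is
  surjective. For a 2-cocycle \<open>\<psi>\<close> of the commutator Lie algebra, the trilinear form
  \<open>\<psi>(ab,c) + \<psi>(bc,a) + \<psi>(ca,b)\<close> is symmetric and invariant, and by surjectivity of \<open>ad x\<close> it is
  \<open>0\<close>. If \<open>\<psi>(x, -)\<close> vanishes on the centralizer \<open>K\<close> of \<open>x\<close>, then
  \<open>f([x,u]) = \<psi>(x,u)\<close> is well defined, and the radical of \<open>\<psi> - \<psi>\<^sub>f\<close> contains \<open>x\<close>, \<open>K\<close>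
  and \<open>d\<close> and is closed under products, hence is the whole algebra. So the class of \<open>\<psi>\<close> is
  determined by \<open>\<psi>(x, -)\<close> on \<open>K\<close>.

  If \<open>l \<ge> 2\<close>, a second such pair \<open>(y, e)\<close> with \<open>y\<close>, \<open>e\<close> in \<open>K\<close> makes \<open>K = [y, K]\<close>, whence
  \<open>\<psi>(x, K) = 0\<close>. If \<open>l = 1\<close>, then \<open>K\<close> is the function algebra and \<open>\<psi>(x, -)\<close> kills
  \<open>[d, K]\<close>. This is all of \<open>K\<close> when \<open>l1 + l2 = 1\<close>; when \<open>l4 = 1\<close> and \<open>x = x\<^bsup>\<alpha>\<^esup>\<close>, the
  quotient is spanned by \<open>x\<^bsup>-\<alpha>\<^esup>\<close>, and when \<open>l3 = 1\<close> and \<open>d = \<partial>\<close>, it has the basis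
  \<open>x\<^bsup>\<gamma>,-1\<^esup>\<close>, \<open>\<gamma> \<in> \<Gamma>\<close>. The functionals on the quotient are realized by explicit cyclic
  cocycles: for \<open>l3 = 1\<close> by composing an algebra-valued pairing with a residue, for \<open>l4 = 1\<close>
  by indefinite summation of the symbols \<open>f(\<partial>)\<close>.
\<close>

section \<open>Lie cocycles on associative algebras with a Weyl pair\<close>

text \<open>Bracketing with a function lowers the order of an operator. So x is always taken among
  the functions and d of order one: a coordinate with its derivation, or, where no coordinate
  exists, x^\<alpha> with a derivation that is a multiple of x^(-\<alpha>). Vanishing of the
  trilinear form makes \<psi> cyclic: \<psi>(ab, -) is determined by \<psi>(-, a) and \<psi>(-, b).
  This is why generators control a Lie cocycle. The two explicit constructions differ because the
  Laurent case has a coordinate t, and cyclicity follows by passing [-, t] through the cyclic sum.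
  In the exponential case every operator is a sum of terms x^\<alpha> p(\<partial>), products are
  translations of polynomials, and the cocycle sums f(j) g(j + \<alpha>) over j from -\<alpha> to
  -1, extended to all \<alpha> by antidifferences. Characteristic 0 enters in antiderivatives, in
  dividing by 2, 3 and 4 when the trilinear form is shown to vanish, and in the uniqueness of
  antidifferences up to constants.\<close>

locale assoc_alg =
  fixes C :: "'w::ab_group_add set"
    and mul :: "'w \<Rightarrow> 'w \<Rightarrow> 'w" (infixl "\<bullet>" 70)
    and scl :: "'a::field_char_0 \<Rightarrow> 'w \<Rightarrow> 'w"
    and e :: 'w
  assumes add_C [simp]: "a \<in> C \<Longrightarrow> b \<in> C \<Longrightarrow> a + b \<in> C"
    and scl_C [simp]: "a \<in> C \<Longrightarrow> scl r a \<in> C"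
    and mul_C [simp]: "a \<in> C \<Longrightarrow> b \<in> C \<Longrightarrow> a \<bullet> b \<in> C"
    and e_C [simp]: "e \<in> C"
    and mul_add_left: "\<lbrakk>a \<in> C; b \<in> C; c \<in> C\<rbrakk> \<Longrightarrow>
      (a + b) \<bullet> c = a \<bullet> c + b \<bullet> c"
    and mul_add_right: "\<lbrakk>a \<in> C; b \<in> C; c \<in> C\<rbrakk> \<Longrightarrow>
      a \<bullet> (b + c) = a \<bullet> b + a \<bullet> c"
    and mul_scl_left: "a \<in> C \<Longrightarrow> b \<in> C \<Longrightarrow> scl r a \<bullet> b = scl r (a \<bullet> b)"
    and mul_scl_right: "a \<in> C \<Longrightarrow> b \<in> C \<Longrightarrow> a \<bullet> scl r b = scl r (a \<bullet> b)"
    and mul_assoc: "\<lbrakk>a \<in> C; b \<in> C; c \<in> C\<rbrakk> \<Longrightarrow>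
      a \<bullet> b \<bullet> c = a \<bullet> (b \<bullet> c)"
    and e_left [simp]: "a \<in> C \<Longrightarrow> e \<bullet> a = a"
    and e_right [simp]: "a \<in> C \<Longrightarrow> a \<bullet> e = a"
    and scl_add: "scl r (a + b) = scl r a + scl r b"
    and scl_add_left: "scl (r + s) a = scl r a + scl s a"
    and scl_scl: "scl r (scl s a) = scl (r * s) a"
    and scl_one [simp]: "scl 1 a = a"
begin

definition br :: "'w \<Rightarrow> 'w \<Rightarrow> 'w" where
  "br a b = a \<bullet> b - b \<bullet> a"

definition L :: "('a, 'w) lie_algebra" where
  "L = \<lparr>lie_carrier = C, lie_scale = scl, lie_bracket = br\<rparr>"

lemma L_simps [simp]: "lie_carrier L = C" "lie_scale L = scl" "lie_bracket L = br"
  by (simp_all add: L_def)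

lemma scl_zero [simp]: "scl 0 a = 0"
  using scl_add_left[of 0 0 a] by simp

lemma scl_zero_right [simp]: "scl r 0 = 0"
  using scl_add[of r 0 0] by simp

lemma scl_minus_left: "scl (- r) a = - scl r a"
  using scl_add_left[of r "- r" a] by (simp add: eq_neg_iff_add_eq_0 add.commute)

lemma scl_minus_right: "scl r (- a) = - scl r a"
  using scl_add[of r a "- a"] by (simp add: eq_neg_iff_add_eq_0 add.commute)

lemma scl_diff: "scl r (a - b) = scl r a - scl r b"
  using scl_add[of r a "- b"] by (simp add: scl_minus_right)

lemma minus_C [simp]: "a \<in> C \<Longrightarrow> - a \<in> C"
  using scl_C[of a "- 1"] by (simp add: scl_minus_left)

lemma zero_C [simp]: "0 \<in> C"
  using scl_C[OF e_C, of 0] by simp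

lemma diff_C [simp]: "a \<in> C \<Longrightarrow> b \<in> C \<Longrightarrow> a - b \<in> C"
  using add_C[of a "- b"] by simp

lemma mul_zero_left [simp]: "a \<in> C \<Longrightarrow> 0 \<bullet> a = 0"
  using mul_add_left[of 0 0 a] by simp

lemma mul_zero_right [simp]: "a \<in> C \<Longrightarrow> a \<bullet> 0 = 0"
  using mul_add_right[of a 0 0] by simp

lemma mul_minus_left: "a \<in> C \<Longrightarrow> b \<in> C \<Longrightarrow> - a \<bullet> b = - (a \<bullet> b)"
  using mul_add_left[of a "- a" b] by (simp add: eq_neg_iff_add_eq_0 add.commute)

lemma mul_minus_right: "a \<in> C \<Longrightarrow> b \<in> C \<Longrightarrow> a \<bullet> (- b) = - (a \<bullet> b)"
  using mul_add_right[of a b "- b"] by (simp add: eq_neg_iff_add_eq_0 add.commute)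

lemma mul_diff_left: "\<lbrakk>a \<in> C; b \<in> C; c \<in> C\<rbrakk> \<Longrightarrow>
      (a - b) \<bullet> c = a \<bullet> c - b \<bullet> c"
  using mul_add_left[of a "- b" c] by (simp add: mul_minus_left)

lemma mul_diff_right: "\<lbrakk>a \<in> C; b \<in> C; c \<in> C\<rbrakk> \<Longrightarrow>
      a \<bullet> (b - c) = a \<bullet> b - a \<bullet> c"
  using mul_add_right[of a b "- c"] by (simp add: mul_minus_right)

lemma br_C [simp]: "a \<in> C \<Longrightarrow> b \<in> C \<Longrightarrow> br a b \<in> C"
  by (simp add: br_def)

lemma br_antisym: "br a b = - br b a"
  by (simp add: br_def)

lemma br_add_left: "\<lbrakk>a \<in> C; b \<in> C; c \<in> C\<rbrakk> \<Longrightarrow>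
      br (a + b) c = br a c + br b c"
  by (simp add: br_def mul_add_left mul_add_right)

lemma br_diff_left: "\<lbrakk>a \<in> C; b \<in> C; c \<in> C\<rbrakk> \<Longrightarrow>
      br (a - b) c = br a c - br b c"
  by (simp add: br_def mul_diff_left mul_diff_right)

lemma br_add_right: "\<lbrakk>a \<in> C; b \<in> C; c \<in> C\<rbrakk> \<Longrightarrow>
      br a (b + c) = br a b + br a c"
  by (simp add: br_def mul_add_left mul_add_right)

lemma br_scl_left: "a \<in> C \<Longrightarrow> b \<in> C \<Longrightarrow> br (scl r a) b = scl r (br a b)"
  by (simp add: br_def mul_scl_left mul_scl_right scl_diff)

lemma br_zero [simp]: "a \<in> C \<Longrightarrow> br 0 a = 0" "a \<in> C \<Longrightarrow> br a 0 = 0"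
  by (simp_all add: br_def)

lemma br_mul_left:
  assumes "a \<in> C" "b \<in> C" "x \<in> C"
  shows "br (a \<bullet> b) x = br a x \<bullet> b + a \<bullet> br b x"
  using assms by (simp add: br_def mul_diff_left mul_diff_right mul_assoc)

lemma br_jacobi:
  assumes "a \<in> C" "b \<in> C" "c \<in> C"
  shows "br (br a b) c + br (br b c) a + br (br c a) b = 0"
  using assms by (simp add: br_def mul_diff_left mul_diff_right mul_assoc)

text \<open>The bracket is taken from the right, the negative of the usual adjoint map:
  \<open>br d x = e\<close> then makes \<open>ad x\<close> send d^n to n d^(n-1) without a
  sign.\<close>

abbreviation ad :: "'w \<Rightarrow> 'w \<Rightarrow> 'w" where "ad x \<equiv> \<lambda>v. br v x"
abbreviation mul_r :: "'w \<Rightarrow> 'w \<Rightarrow> 'w" where "mul_r d \<equiv> \<lambda>v. v \<bullet> d"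

definition ad_nilpotent :: "'w \<Rightarrow> bool" where
  "ad_nilpotent x \<longleftrightarrow> x \<in> C \<and> (\<forall>u\<in>C. \<exists>n. (ad x ^^ n) u = 0)"

text \<open>A pair generating a Weyl algebra; \<open>ad x\<close> then acts like differentiation by \<open>d\<close>.\<close>

definition weyl_pair :: "'w \<Rightarrow> 'w \<Rightarrow> bool" where
  "weyl_pair x d \<longleftrightarrow> ad_nilpotent x \<and> d \<in> C \<and> br d x = e"

lemma weyl_pairD:
  assumes "weyl_pair x d"
  shows "x \<in> C" "d \<in> C" "br d x = e"
  using assms by (auto simp: weyl_pair_def ad_nilpotent_def)

lemma funpow_br_C [simp]: "x \<in> C \<Longrightarrow> u \<in> C \<Longrightarrow> (ad x ^^ n) u \<in> C"
  by (induction n) auto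

lemma funpow_mul_C [simp]: "d \<in> C \<Longrightarrow> u \<in> C \<Longrightarrow> (mul_r d ^^ n) u \<in> C"
  by (induction n) auto

text \<open>Leibniz rule for the derivation [-, x] on u d^(j+1): since [d, x] = \<open>e\<close>,
  each of the j + 1 factors d contributes u d^j once.\<close>

lemma br_funpow_mul:
  assumes "x \<in> C" "d \<in> C" "br d x = e" "u \<in> C"
  shows "br ((mul_r d ^^ Suc j) u) x =
    (mul_r d ^^ Suc j) (br u x) + scl (of_nat (Suc j)) ((mul_r d ^^ j) u)"
proof (induction j)
  case 0
  then show ?case using assms by (simp add: br_mul_left)
next
  case (Suc j)
  have "br ((mul_r d ^^ Suc (Suc j)) u) x =
      br ((mul_r d ^^ Suc j) u) x \<bullet> d + (mul_r d ^^ Suc j) u \<bullet> e"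
    using assms br_mul_left[of "(mul_r d ^^ Suc j) u" d x] by simp
  also have "\<dots> = ((mul_r d ^^ Suc j) (br u x) +
      scl (of_nat (Suc j)) ((mul_r d ^^ j) u)) \<bullet> d + (mul_r d ^^ Suc j) u"
    using assms Suc.IH by simp
  also have "\<dots> = (mul_r d ^^ Suc (Suc j)) (br u x) +
      (scl (of_nat (Suc j)) ((mul_r d ^^ Suc j) u) + scl 1 ((mul_r d ^^ Suc j) u))"
    using assms by (simp add: mul_add_left mul_scl_left)
  also have "\<dots> = (mul_r d ^^ Suc (Suc j)) (br u x) +
      scl (of_nat (Suc (Suc j))) ((mul_r d ^^ Suc j) u)"
    by (simp only: scl_add_left[symmetric] of_nat_Suc[of "Suc j"] add.commute)
  finally show ?case .
qed

text \<open>Integration by parts: subtract from w d^(j+1) an antiderivative of [w, x] d^(j+1) and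
  divide by j + 1. The nilpotency index of [w, x] is smaller, hence the induction on n with j
  arbitrary. Only the iterates of w have to lie in S, because \<open>weyl_pair_generate\<close> uses
  an S not known to be stable under \<open>ad x\<close>.\<close>

lemma ad_antiderivative:
  assumes pair: "x \<in> C" "d \<in> C" "br d x = e"
    and S: "S \<subseteq> C" "\<And>a b. a \<in> S \<Longrightarrow> b \<in> S \<Longrightarrow> a + b \<in> S" "\<And>r a. a \<in> S \<Longrightarrow> scl r a \<in> S"
      "\<And>a. a \<in> S \<Longrightarrow> a \<bullet> d \<in> S"
    and w: "\<And>k. (ad x ^^ k) w \<in> S" "(ad x ^^ n) w = 0"
  shows "\<exists>v\<in>S. br v x = (mul_r d ^^ j) w"
  using w
proof (induction n arbitrary: w j)
  case 0
  then have "w = 0" "0 \<in> S" using 0(1)[of 0] by auto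
  have "(mul_r d ^^ j) 0 = 0"
    by (induction j) (use pair in auto)
  moreover have "br 0 x = 0" using pair by simp
  ultimately show ?case using \<open>w = 0\<close> \<open>0 \<in> S\<close> by (metis (no_types))
next
  case (Suc n)
  have wS: "w \<in> S" using Suc.prems(1)[of 0] by simp
  have "(ad x ^^ k) (br w x) \<in> S" for k
    using Suc.prems(1)[of "Suc k"] by (simp only: funpow_Suc_right comp_def)
  moreover have "(ad x ^^ n) (br w x) = 0"
    using Suc.prems(2) by (simp only: funpow_Suc_right comp_def)
  ultimately obtain v' where v': "v' \<in> S" "br v' x = (mul_r d ^^ Suc j) (br w x)"
    using Suc.IH by blast
  have pS: "(mul_r d ^^ i) w \<in> S" for i
    by (induction i) (use wS S in auto)
  define r where "r = inverse (of_nat (Suc j) :: 'a)"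
  have r: "r * of_nat (Suc j) = 1" unfolding r_def by (rule left_inverse) (simp only: of_nat_eq_0_iff)
  define v where "v = scl r ((mul_r d ^^ Suc j) w + scl (- 1) v')"
  have "v \<in> S" unfolding v_def using S pS v' by blast
  have v'C: "v' \<in> C" and wC: "w \<in> C" using v' S wS by auto
  have "br v x = scl r (br ((mul_r d ^^ Suc j) w) x + scl (- 1) (br v' x))"
    unfolding v_def using v'C wC pair by (simp add: br_scl_left br_add_left scl_add del: funpow.simps)
  also have "\<dots> = scl r (scl (of_nat (Suc j)) ((mul_r d ^^ j) w))"
    by (simp only: br_funpow_mul[OF pair wC] v'(2)) (simp add: scl_minus_left)
  also have "\<dots> = (mul_r d ^^ j) w"
    by (simp only: scl_scl r scl_one)
  finally show ?case using \<open>v \<in> S\<close> by blast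
qed

lemma ad_surj:
  assumes "ad_nilpotent x" "d \<in> C" "br d x = e"
    and S: "S \<subseteq> C" "\<And>a b. a \<in> S \<Longrightarrow> b \<in> S \<Longrightarrow> a + b \<in> S" "\<And>r a. a \<in> S \<Longrightarrow> scl r a \<in> S"
      "\<And>a. a \<in> S \<Longrightarrow> a \<bullet> d \<in> S" "\<And>a. a \<in> S \<Longrightarrow> br a x \<in> S"
    and "u \<in> S"
  shows "\<exists>v\<in>S. br v x = u"
proof -
  have x: "x \<in> C" using assms(1) by (simp add: ad_nilpotent_def)
  obtain n where "(ad x ^^ n) u = 0"
    using assms(1) \<open>u \<in> S\<close> S(1) unfolding ad_nilpotent_def by blast
  moreover have "(ad x ^^ k) u \<in> S" for k
    by (induction k) (use S \<open>u \<in> S\<close> in auto)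
  ultimately have "\<exists>v\<in>S. br v x = (mul_r d ^^ 0) u"
    using S assms x by (intro ad_antiderivative) auto
  then show ?thesis by simp
qed

lemma weyl_pair_surj:
  assumes "weyl_pair x d" "u \<in> C"
  shows "\<exists>v\<in>C. br v x = u"
  using assms by (intro ad_surj[of x d]) (auto simp: weyl_pair_def ad_nilpotent_def)

text \<open>Induction on the nilpotency index of u: the iterates of [u, x] have smaller index and
  lie in S, so [u, x] has an antiderivative v inside S. The difference u - v commutes with x and
  lies in S by hypothesis.\<close>

lemma weyl_pair_generate:
  assumes wp: "weyl_pair x d"
    and S: "S \<subseteq> C" "\<And>a b. a \<in> S \<Longrightarrow> b \<in> S \<Longrightarrow> a + b \<in> S" "\<And>r a. a \<in> S \<Longrightarrow> scl r a \<in> S"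
      "\<And>a. a \<in> S \<Longrightarrow> a \<bullet> d \<in> S" "\<And>a. a \<in> C \<Longrightarrow> br a x = 0 \<Longrightarrow> a \<in> S"
  shows "S = C"
proof -
  note x = weyl_pairD[OF wp]
  have main: "(ad x ^^ n) u = 0 \<Longrightarrow> u \<in> C \<Longrightarrow> u \<in> S" for n u
  proof (induction n arbitrary: u)
    case 0
    then show ?case using S(5) x by auto
  next
    case (Suc n)
    have z: "(ad x ^^ n) 0 = 0" for n
      by (induction n) (use x in auto)
    have nil: "(ad x ^^ n) (br u x) = 0"
      using Suc.prems(1) by (simp only: funpow_Suc_right comp_def)
    have "(ad x ^^ n) ((ad x ^^ k) (br u x)) = 0" for k
    proof -
      have "(ad x ^^ n) ((ad x ^^ k) (br u x)) =
          (ad x ^^ k) ((ad x ^^ n) (br u x))"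
        by (metis add.commute comp_apply funpow_add)
      then show ?thesis using nil z by simp
    qed
    then have "(ad x ^^ k) (br u x) \<in> S" for k
      using Suc.IH Suc.prems(2) x by simp
    then have "\<exists>v\<in>S. br v x = (mul_r d ^^ 0) (br u x)"
      using nil S x by (intro ad_antiderivative) auto
    then obtain v where v: "v \<in> S" "br v x = br u x" by auto
    then have "u - v \<in> S"
      using S Suc.prems x by (intro S(5)) (auto simp: br_diff_left)
    then show ?case using S(2)[OF \<open>u - v \<in> S\<close> v(1)] by simp
  qed
  have "u \<in> S" if "u \<in> C" for u
    using main that wp unfolding weyl_pair_def ad_nilpotent_def by blast
  then show ?thesis using S(1) by blast
qed

end

section \<open>The trilinear defect of a Lie cocycle and the coboundary criterion\<close>

locale alg_cocycle = assoc_alg C mul scl e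
  for C :: "'w::ab_group_add set" and mul (infixl "\<bullet>" 70) and scl :: "'a::field_char_0 \<Rightarrow> 'w \<Rightarrow> 'w" and e +
  fixes \<psi> :: "'w \<Rightarrow> 'w \<Rightarrow> 'a"
  assumes cocycle: "\<psi> \<in> cocycles2 L"
begin

lemma psi_add_left: "\<lbrakk>a \<in> C; b \<in> C; c \<in> C\<rbrakk> \<Longrightarrow>
      \<psi> (a + b) c = \<psi> a c + \<psi> b c"
  and psi_add_right: "\<lbrakk>a \<in> C; b \<in> C; c \<in> C\<rbrakk> \<Longrightarrow>
      \<psi> a (b + c) = \<psi> a b + \<psi> a c"
  and psi_scl_left: "a \<in> C \<Longrightarrow> b \<in> C \<Longrightarrow> \<psi> (scl r a) b = r * \<psi> a b"
  and psi_scl_right: "a \<in> C \<Longrightarrow> b \<in> C \<Longrightarrow> \<psi> a (scl r b) = r * \<psi> a b"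
  and psi_antisym: "a \<in> C \<Longrightarrow> b \<in> C \<Longrightarrow> \<psi> a b = - \<psi> b a"
  and psi_jacobi: "\<lbrakk>a \<in> C; b \<in> C; c \<in> C\<rbrakk> \<Longrightarrow>
      \<psi> (br a b) c + \<psi> (br b c) a + \<psi> (br c a) b = 0"
  and psi_outside: "a \<notin> C \<or> b \<notin> C \<Longrightarrow> \<psi> a b = 0"
  using cocycle unfolding cocycles2_def linear_on_def L_simps mem_Collect_eq by blast+

lemma psi_zero [simp]: "a \<in> C \<Longrightarrow> \<psi> 0 a = 0" "a \<in> C \<Longrightarrow> \<psi> a 0 = 0"
  using psi_scl_left[of 0 a 0] psi_scl_right[of a 0 0] by auto

lemma psi_minus_left: "a \<in> C \<Longrightarrow> b \<in> C \<Longrightarrow> \<psi> (- a) b = - \<psi> a b"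
  and psi_minus_right: "a \<in> C \<Longrightarrow> b \<in> C \<Longrightarrow> \<psi> a (- b) = - \<psi> a b"
  using psi_scl_left[of a b "- 1"] psi_scl_right[of a b "- 1"] by (auto simp: scl_minus_left)

lemma psi_diff_left: "\<lbrakk>a \<in> C; b \<in> C; c \<in> C\<rbrakk> \<Longrightarrow>
      \<psi> (a - b) c = \<psi> a c - \<psi> b c"
  using psi_add_left[of a "- b" c] by (simp add: psi_minus_left)

lemma psi_diff_right: "\<lbrakk>a \<in> C; b \<in> C; c \<in> C\<rbrakk> \<Longrightarrow>
      \<psi> a (b - c) = \<psi> a b - \<psi> a c"
  using psi_add_right[of a b "- c"] by (simp add: psi_minus_right)

text \<open>The defect of \<open>\<psi>\<close> from being a cyclic cocycle of the associative algebra.\<close>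

definition defect :: "'w \<Rightarrow> 'w \<Rightarrow> 'w \<Rightarrow> 'a" where
  "defect a b c = \<psi> (a \<bullet> b) c + \<psi> (b \<bullet> c) a + \<psi> (c \<bullet> a) b"

lemma defect_rotate: "defect a b c = defect b c a"
  by (simp add: defect_def)

text \<open>The Jacobi identity for \<psi> says that the cyclic sum for (a, b, c) minus the one for
  (b, a, c) is 0. With \<open>defect_rotate\<close> the form is symmetric under all
  permutations.\<close>

lemma defect_swap:
  assumes "a \<in> C" "b \<in> C" "c \<in> C"
  shows "defect a b c = defect b a c"
proof -
  have "\<psi> (a \<bullet> b - b \<bullet> a) c + \<psi> (b \<bullet> c - c \<bullet> b) a + \<psi> (c \<bullet> a - a \<bullet> c) b = 0"
    using psi_jacobi[OF assms] by (simp add: br_def)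
  then have "(\<psi> (a \<bullet> b) c - \<psi> (b \<bullet> a) c) + (\<psi> (b \<bullet> c) a - \<psi> (c \<bullet> b) a) +
      (\<psi> (c \<bullet> a) b - \<psi> (a \<bullet> c) b) = 0"
    using assms by (simp add: psi_diff_left)
  then show ?thesis unfolding defect_def by algebra
qed

lemma defect_diff:
  assumes "a \<in> C" "b \<in> C" "c \<in> C" "d \<in> C"
  shows "defect (a - b) c d = defect a c d - defect b c d"
  using assms
  by (simp add: defect_def psi_diff_left psi_diff_right mul_diff_left mul_diff_right)

lemma defect_minus:
  assumes "a \<in> C" "c \<in> C" "d \<in> C"
  shows "defect (- a) c d = - defect a c d"
  using assms
  by (simp add: defect_def psi_minus_left psi_minus_right mul_minus_left mul_minus_right)

lemma defect_swap_right:
  assumes "u \<in> C" "v \<in> C" "w \<in> C"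
  shows "defect u v w = defect u w v"
  using assms defect_swap[of v w u] by (simp add: defect_rotate[of u])

lemma defect_br_antisym:
  assumes "u \<in> C" "v \<in> C" "w \<in> C" "z \<in> C"
  shows "defect (br u v) w z = - defect (br v u) w z"
  using defect_minus[of "br v u" w z] assms br_antisym[of u v] by simp

text \<open>After reassociating, each side is the cyclic sum of \<psi>(abc, d); the terms \<psi>(ab,
  cd) + \<psi>(cd, ab) and \<psi>(bc, da) + \<psi>(da, bc) drop out by antisymmetry.\<close>

lemma defect_hochschild:
  assumes "a \<in> C" "b \<in> C" "c \<in> C" "d \<in> C"
  shows "defect (a \<bullet> b) c d + defect (c \<bullet> d) a b =
    defect (b \<bullet> c) d a + defect (d \<bullet> a) b c"
proof -
  have "\<psi> (c \<bullet> d) (a \<bullet> b) = - \<psi> (a \<bullet> b) (c \<bullet> d)" "\<psi> (d \<bullet> a) (b \<bullet> c) = - \<psi> (b \<bullet> c) (d \<bullet> a)"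
    using assms by (auto intro: psi_antisym)
  then show ?thesis
    using assms by (simp add: defect_def mul_assoc)
qed

text \<open>The identity for (a, b, c, d) minus the one for (d, c, b, a): symmetry of the form turns
  the differences of products into brackets.\<close>

lemma defect_four_term:
  assumes "a \<in> C" "b \<in> C" "c \<in> C" "d \<in> C"
  shows "defect (br a b) c d + defect (br c d) a b =
    defect (br b c) a d + defect (br d a) b c"
proof -
  have 1: "defect (a \<bullet> b) c d + defect (c \<bullet> d) a b =
      defect (b \<bullet> c) a d + defect (d \<bullet> a) b c"
    using defect_hochschild[OF assms] assms
      defect_rotate[of "b \<bullet> c" d a] defect_swap[of d a "b \<bullet> c"]
      defect_rotate[of "b \<bullet> c" a d] by simp
  have 2: "defect (d \<bullet> c) a b + defect (b \<bullet> a) c d =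
      defect (c \<bullet> b) a d + defect (a \<bullet> d) b c"
    using defect_hochschild[of d c b a] assms
      defect_swap_right[of "d \<bullet> c" b a] defect_swap_right[of "b \<bullet> a" d c] defect_swap_right[of "a \<bullet> d" c b] by simp
  show ?thesis
    unfolding br_def using assms 1 2 by (simp add: defect_diff) algebra
qed

text \<open>Let S u v w z be the form at (v, w, z) acted on by [u, -]. Two four-term relations show
  that exchanging u with z does not change S, so by symmetry it does not matter which of the four
  elements acts. The four sums add up to 0, as each bracket meets its negative, whence 4 S =
  0.\<close>

lemma defect_invariant:
  assumes C: "a \<in> C" "b \<in> C" "c \<in> C" "d \<in> C"
  shows "defect (br d a) b c + defect (br d b) a c + defect (br d c) a b = 0"
proof -
  define S where "S = (\<lambda>u v w z. defect (br u v) w z +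
      defect (br u w) v z + defect (br u z) v w)"
  have S_eq: "S u v w z = S z v w u" if uvwz: "u \<in> C" "v \<in> C" "w \<in> C" "z \<in> C" for u v w z
  proof -
    \<comment> \<open>The term with [v, w] enters the two relations with opposite signs; adding them
      eliminates it.\<close>
    have "defect (br v w) z u - defect (br u z) v w =
        - defect (br z w) v u + defect (br u v) w z"
      using defect_four_term[of v w z u] defect_br_antisym[of z u v w] defect_br_antisym[of w z v u] uvwz by simp
    moreover have "- defect (br v w) z u - defect (br u z) v w =
        - defect (br z v) w u + defect (br u w) v z"
      using defect_four_term[of w v z u] defect_br_antisym[of w v z u] defect_br_antisym[of z u w v] defect_br_antisym[of v z w u]
        defect_swap_right[of "br u z" w v] uvwz by simp
    moreover have "X1 + X2 + X3 = Y1 + Y2 - X3"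
      if "P - X3 = - Y2 + X1" "- P - X3 = - Y1 + X2" for P X1 X2 X3 Y1 Y2 :: 'a
      using that by algebra
    ultimately have "defect (br u v) w z + defect (br u w) v z + defect (br u z) v w =
        defect (br z v) w u + defect (br z w) v u - defect (br u z) v w"
      by blast
    then show ?thesis unfolding S_def using defect_br_antisym[of z u v w] uvwz by simp
  qed
  have S_sym: "S u v w z = S u w v z" "S u v w z = S u v z w"
    if "u \<in> C" "v \<in> C" "w \<in> C" "z \<in> C" for u v w z
    using that defect_swap_right[of "br u z" v w] defect_swap_right[of "br u v" w z] unfolding S_def by (simp_all add: add_ac)
  have e1: "S d a b c = S c a b d" using S_eq C by blast
  have e2: "S d a b c = S b a c d" using S_eq[of d a c b] S_sym(2)[of d a b c] C by metis
  have e3: "S d a b c = S a b c d"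
    using S_eq[of d b c a] S_sym C by metis
  have "S d a b c + S c a b d + S b a c d + S a b c d = 0"
    unfolding S_def
    using defect_br_antisym[of c a b d] defect_br_antisym[of b a c d] defect_br_antisym[of d a b c] defect_br_antisym[of c b a d] defect_br_antisym[of d b a c] defect_br_antisym[of d c a b]
      defect_swap_right C by (simp add: algebra_simps)
  then have "4 * S d a b c = 0"
    using e1 e2 e3 by (simp add: algebra_simps)
  then have "S d a b c = 0" by simp
  then show ?thesis by (simp add: S_def)
qed

text \<open>Choose v with [v, x] equal to the first argument and use invariance under v at (x, x,
  x), then (x, x, w), then (x, b, c): the wanted value appears 3, 2 and 1 times, and the other terms
  contain enough arguments x to vanish by the preceding case.\<close>

lemma defect_eq_0:
  assumes x: "x \<in> C" and surj: "\<And>u. u \<in> C \<Longrightarrow> \<exists>v\<in>C. br v x = u"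
    and C: "a \<in> C" "b \<in> C" "c \<in> C"
  shows "defect a b c = 0"
proof -
  have 1: "defect u x x = 0" if u: "u \<in> C" for u
  proof -
    obtain v where v: "v \<in> C" "br v x = u" using surj u by blast
    have "defect (br v x) x x + defect (br v x) x x + defect (br v x) x x = 0"
      using defect_invariant[of x x x v] v x by simp
    then have "3 * defect (br v x) x x = 0" by (simp add: algebra_simps)
    then show ?thesis using v by simp
  qed
  have 2: "defect u x w = 0" if u: "u \<in> C" and w: "w \<in> C" for u w
  proof -
    obtain v where v: "v \<in> C" "br v x = u" using surj u by blast
    have "defect (br v x) x w + defect (br v x) x w + defect (br v w) x x = 0"
      using defect_invariant[of x x w v] v x w by simp
    then have "2 * defect (br v x) x w = 0" using 1 v w by (simp add: algebra_simps)
    then show ?thesis using v by simp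
  qed
  obtain v where v: "v \<in> C" "br v x = a" using surj C by blast
  have "defect (br v x) b c + defect (br v b) x c + defect (br v c) x b = 0"
    using defect_invariant[of x b c v] v x C by simp
  then show ?thesis using 2 v C by simp
qed

lemma psi_cyclic:
  assumes "weyl_pair x d" "a \<in> C" "b \<in> C" "c \<in> C"
  shows "\<psi> (a \<bullet> b) c + \<psi> (b \<bullet> c) a + \<psi> (c \<bullet> a) b = 0"
  using defect_eq_0[of x a b c] weyl_pair_surj[OF assms(1)] assms
  by (simp add: defect_def weyl_pair_def ad_nilpotent_def)

lemma psi_unit:
  assumes "weyl_pair x d" "a \<in> C"
  shows "\<psi> e a = 0"
  using psi_cyclic[OF assms(1), of e e a] psi_antisym[of a e] assms(2) by simp

text \<open>Jacobi identity for d, k, x: here [k, x] = 0, and [x, d] = -\<open>e\<close> pairs to 0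
  with everything. This restricts the functional \<psi>(x, -) on the centralizer, the only datum
  that \<open>coboundary_criterion\<close> asks about.\<close>

lemma psi_bracket_pair:
  assumes wp: "weyl_pair x d" and k: "k \<in> C" "br k x = 0"
  shows "\<psi> x (br d k) = 0"
proof -
  note x = weyl_pairD[OF wp]
  have "\<psi> (br d k) x + \<psi> (br k x) d + \<psi> (br x d) k = 0"
    using psi_jacobi[of d k x] x k by simp
  moreover have "\<psi> (br x d) k = 0"
    using psi_unit[OF wp k(1)] x k br_antisym[of x d] by (simp add: psi_minus_left)
  ultimately show ?thesis using psi_antisym[of x "br d k"] x k by simp
qed

lemma psi_centralizer_two_pairs:
  assumes x: "x \<in> C" and wp: "weyl_pair y d" and comm: "br y x = 0" "br d x = 0"
    and k: "k \<in> C" "br k x = 0"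
  shows "\<psi> x k = 0"
proof -
  have y: "y \<in> C" "d \<in> C" "br d y = e" "ad_nilpotent y"
    using wp by (auto simp: weyl_pair_def ad_nilpotent_def)
  define S where "S = {u \<in> C. br u x = 0}"
  have "\<exists>v\<in>S. br v y = k"
  proof (rule ad_surj[of y d])
    show "a \<bullet> d \<in> S" if "a \<in> S" for a
      using that y comm x by (auto simp: S_def br_mul_left)
    show "br a y \<in> S" if "a \<in> S" for a
      using that y comm x br_jacobi[of a y x] br_antisym[of x a]
      by (auto simp: S_def)
  qed (use y x k in \<open>auto simp: S_def br_add_left br_scl_left\<close>)
  then obtain v where v: "v \<in> C" "br v x = 0" "br v y = k" by (auto simp: S_def)
  have "\<psi> (br v y) x + \<psi> (br y x) v + \<psi> (br x v) y = 0"
    using psi_jacobi[of v y x] v y x by simp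
  then have "\<psi> k x = 0"
    using v comm y x br_antisym[of x v] by simp
  then show ?thesis using psi_antisym[of x k] x k by simp
qed

theorem coboundary_criterion:
  assumes wp: "weyl_pair x d"
    and K: "\<And>k. k \<in> C \<Longrightarrow> br k x = 0 \<Longrightarrow> \<psi> x k = 0"
  shows "\<psi> \<in> coboundaries2 L"
proof -
  note x = weyl_pairD[OF wp]
  \<comment> \<open>The sign convention is f([u, x]) = \<psi>(u, x). The choice of u is harmless:
    two choices differ by an element of the centralizer, where \<psi>(x, -) vanishes.\<close>
  define f where "f w = \<psi> (SOME u. u \<in> C \<and> br u x = w) x" for w
  have f: "f (br u x) = \<psi> u x" if "u \<in> C" for u
  proof -
    define v where "v = (SOME v. v \<in> C \<and> br v x = br u x)"
    have v: "v \<in> C \<and> br v x = br u x"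
      unfolding v_def by (rule someI[of _ u]) (use that in auto)
    then have "\<psi> x (v - u) = 0"
      using that x by (intro K) (auto simp: br_diff_left)
    then show ?thesis
      using v that x psi_antisym[of x v] psi_antisym[of x u]
      by (simp add: f_def v_def[symmetric] psi_diff_right)
  qed
  have lin: "linear_on L f"
    unfolding linear_on_def
  proof (intro conjI ballI allI)
    fix u v assume "u \<in> lie_carrier L" "v \<in> lie_carrier L"
    then obtain u' v' where "u' \<in> C" "v' \<in> C" "br u' x = u" "br v' x = v"
      using weyl_pair_surj[OF wp] by (metis L_simps(1))
    then show "f (u + v) = f u + f v"
      using f[of "u' + v'"] f[of u'] f[of v'] x by (simp add: br_add_left psi_add_left)
  next
    fix c u assume "u \<in> lie_carrier L"
    then obtain u' where "u' \<in> C" "br u' x = u"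
      using weyl_pair_surj[OF wp] by (metis L_simps(1))
    then show "f (lie_scale L c u) = c * f u"
      using f[of "scl c u'"] f[of u'] x by (simp add: br_scl_left psi_scl_left)
  qed
  then have f_add: "f (u + v) = f u + f v" if "u \<in> C" "v \<in> C" for u v
    using that by (auto simp: linear_on_def)
  have f_scl: "f (scl c u) = c * f u" if "u \<in> C" for u c
    using that lin by (auto simp: linear_on_def)
  have f0: "f 0 = 0" using f_scl[of 0 0] by simp
  have f_diff: "f (u - v) = f u - f v" if "u \<in> C" "v \<in> C" for u v
    using that f_add[of u "scl (- 1) v"] f_scl[of v "- 1"] by (simp add: scl_minus_left)
  define R where "R = {u \<in> C. \<forall>v\<in>C. \<psi> u v = f (br u v)}"
  have R_D: "\<psi> v u = f (br v u)" if "u \<in> R" "v \<in> C" for u v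
  proof -
    have uv: "u \<in> C" "\<psi> u v = f (br u v)" using that by (auto simp: R_def)
    have "f (br v u) = - f (br u v)"
      using f_scl[of "br u v" "- 1"] br_antisym[of v u] uv that by (simp add: scl_minus_left)
    then show ?thesis using psi_antisym[of v u] uv that by simp
  qed
  \<comment> \<open>Both \<psi> and the coboundary of f are cyclic, so their values at (ab, v)
    follow from those at (bv, a) and (va, b), where they agree.\<close>
  have R_mul: "a \<bullet> b \<in> R" if "a \<in> R" "b \<in> R" for a b
  proof -
    have ab: "a \<in> C" "b \<in> C" using that by (auto simp: R_def)
    have "\<psi> (a \<bullet> b) v = f (br (a \<bullet> b) v)" if "v \<in> C" for v
    proof -
      have "\<psi> (a \<bullet> b) v = - \<psi> (b \<bullet> v) a - \<psi> (v \<bullet> a) b"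
        using psi_cyclic[OF wp ab that] by (simp add: algebra_simps eq_neg_iff_add_eq_0)
      also have "\<dots> = - f (br (b \<bullet> v) a) - f (br (v \<bullet> a) b)"
        using R_D[OF \<open>a \<in> R\<close>, of "b \<bullet> v"] R_D[OF \<open>b \<in> R\<close>, of "v \<bullet> a"] ab that by simp
      also have "\<dots> = f (br (a \<bullet> b) v)"
        using ab that by (simp add: br_def f_diff mul_assoc)
      finally show ?thesis .
    qed
    then show ?thesis using ab by (auto simp: R_def)
  qed
  \<comment> \<open>Jacobi identity for v, x, k: the two cocycles agree on pairs containing x, so
    agreement at ([v, x], k) reduces to agreement at ([x, k], v).\<close>
  have bracket_x: "\<psi> (br v x) k = f (br (br v x) k)"
    if "v \<in> C" "k \<in> C" "\<psi> (br x k) v = f (br (br x k) v)" for v k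
  proof -
    have "\<psi> (br v x) k = - \<psi> (br x k) v - \<psi> (br k v) x"
      using psi_jacobi[of v x k] that x by (simp add: algebra_simps eq_neg_iff_add_eq_0)
    also have "\<dots> = - f (br (br x k) v) - f (br (br k v) x)"
      using that x f[of "br k v"] by simp
    also have "\<dots> = f (- br (br x k) v - br (br k v) x)"
      using that x f_diff[of "- br (br x k) v" "br (br k v) x"] f_scl[of "br (br x k) v" "- 1"]
      by (simp add: scl_minus_left)
    also have "- br (br x k) v - br (br k v) x = br (br v x) k"
      using br_jacobi[of v x k] that x by (metis add_diff_cancel_right' add.inverse_unique diff_minus_eq_add minus_diff_eq uminus_add_conv_diff)
    finally show ?thesis .
  qed
  \<comment> \<open>Every w is some [v, x], so membership of k in the radical follows from a
    property of [x, k] alone; this bracket is 0 for k in the centralizer and -\<open>e\<close> for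
    d.\<close>
  have RI: "k \<in> R" if "k \<in> C" "\<And>v. v \<in> C \<Longrightarrow> \<psi> (br x k) v = f (br (br x k) v)" for k
  proof -
    have "\<psi> k w = f (br k w)" if w: "w \<in> C" for w
    proof -
      obtain v where v: "v \<in> C" "br v x = w" using weyl_pair_surj[OF wp w] by blast
      have "\<psi> w k = f (br w k)"
        using bracket_x[of v k] v \<open>k \<in> C\<close> \<open>\<And>v. v \<in> C \<Longrightarrow> \<psi> (br x k) v = f (br (br x k) v)\<close> by simp
      moreover have "f (br k w) = - f (br w k)"
        using f_scl[of "br w k" "- 1"] br_antisym[of k w] \<open>k \<in> C\<close> that by (simp add: scl_minus_left)
      ultimately show ?thesis using psi_antisym[of k w] \<open>k \<in> C\<close> that by simp
    qed
    then show ?thesis using that by (auto simp: R_def)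
  qed
  have R_K: "k \<in> R" if "k \<in> C" "br k x = 0" for k
    using that f0 x br_antisym[of x k] by (intro RI) simp_all
  have R_d: "d \<in> R"
  proof (rule RI)
    fix v assume v: "v \<in> C"
    have "br x d = - e" using br_antisym[of x d] x by simp
    then show "\<psi> (br x d) v = f (br (br x d) v)"
      using psi_unit[OF wp v] v f0 x by (simp add: psi_minus_left br_def mul_minus_left mul_minus_right)
  qed (use x in simp)
  have "R = C"
  proof (rule weyl_pair_generate[OF wp])
    show "a + b \<in> R" if "a \<in> R" "b \<in> R" for a b
      using that by (auto simp: R_def psi_add_left br_add_left f_add)
    show "scl r a \<in> R" if "a \<in> R" for r a
      using that by (auto simp: R_def psi_scl_left br_scl_left f_scl)
  qed (use R_mul R_d R_K in \<open>auto simp: R_def\<close>)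
  then have "\<psi> = coboundary2 L f"
    by (auto simp: R_def coboundary2_def psi_outside fun_eq_iff)
  then show ?thesis using lin by (auto simp: coboundaries2_def)
qed

end

section \<open>Generalized differential operators as an associative algebra\<close>

lemmas fun_ext_simps = fun_eq_iff plus_fun_apply zero_fun_apply

abbreviation lookup where "lookup \<equiv> Poly_Mapping.lookup"
abbreviation single where "single \<equiv> Poly_Mapping.single"
abbreviation keys where "keys \<equiv> Poly_Mapping.keys"

lemma sum_single: "(\<Sum>k\<in>keys a. single k (lookup a k)) = a"
  by (rule poly_mapping_eqI)
    (auto simp: lookup_sum lookup_single when_def in_keys_iff sum.delta' if_distrib cong: if_cong)

lemma additive_sum:
  fixes f :: "'b::ab_group_add \<Rightarrow> 'c::ab_group_add"
  assumes "\<And>a b. f (a + b) = f a + f b"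
  shows "f (sum g A) = (\<Sum>x\<in>A. f (g x))"
proof -
  have "f 0 = 0" using assms[of 0 0] by simp
  then show ?thesis by (induction A rule: infinite_finite_induct) (auto simp: assms)
qed

lemma additive_diff:
  fixes f :: "'b::ab_group_add \<Rightarrow> 'c::ab_group_add"
  assumes "\<And>a b. f (a + b) = f a + f b"
  shows "f (a - b) = f a - f b"
  using assms[of "a - b" b] by (simp add: eq_diff_eq)

lemma additive_ext:
  fixes f g :: "('k \<Rightarrow>\<^sub>0 'b::ab_group_add) \<Rightarrow> 'c::ab_group_add"
  assumes "\<And>a b. f (a + b) = f a + f b" "\<And>a b. g (a + b) = g a + g b"
    and "\<And>k c. k \<in> keys a \<Longrightarrow> f (single k c) = g (single k c)"
  shows "f a = g a"
proof -
  have "f (\<Sum>k\<in>keys a. single k (lookup a k)) = g (\<Sum>k\<in>keys a. single k (lookup a k))"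
    by (simp only: additive_sum[of f, OF assms(1)] additive_sum[of g, OF assms(2)])
      (rule sum.cong, auto simp: assms(3))
  then show ?thesis by (simp only: sum_single)
qed

section \<open>The commuting derivations of the function algebra\<close>

lemma partial_add: "partial p (u + v) = partial p u + partial p v"
proof -
  define h where "h k r = single k (r * fst k p) + single (fst k, snd k - 0(p := 1)) (r * of_int (snd k p))"
    for k :: "(nat \<Rightarrow> 'a) \<times> (nat \<Rightarrow> int)" and r
  have "partial p w = (\<Sum>k\<in>keys w. h k (lookup w k))" for w
    by (auto simp: partial_def h_def split_def)
  moreover have "(\<Sum>k\<in>keys (u + v). h k (lookup (u + v) k)) =
      (\<Sum>k\<in>keys u. h k (lookup u k)) + (\<Sum>k\<in>keys v. h k (lookup v k))"
    by (rule setsum_keys_plus_distrib) (auto simp: h_def single_add algebra_simps)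
  ultimately show ?thesis by simp
qed

lemma partial_single:
  "partial p (single (\<alpha>, i) r) =
    single (\<alpha>, i) (r * \<alpha> p) + single (\<alpha>, i - 0(p := 1)) (r * of_int (i p))"
  by (cases "r = 0") (auto simp: partial_def)

lemma partial_zero [simp]: "partial p 0 = 0"
  by (simp add: partial_def)

lemma partial_const [simp]: "partial p (single 0 r) = 0"
  using partial_single[of p 0 0 r] by (simp add: zero_prod_def[symmetric])

lemma partial_one [simp]: "partial p 1 = 0"
  using partial_const[of p 1] by simp

lemma partial_mult: "partial p (u * v) = partial p u * v + u * partial p v"
proof (rule additive_ext[where a = u])
  fix k r assume "k \<in> keys u"
  show "partial p (single k r * v) = partial p (single k r) * v + single k r * partial p v"
  proof (rule additive_ext[where a = v])
    fix k' r' assume "k' \<in> keys v"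
    obtain \<alpha> i \<beta> j where k: "k = (\<alpha>, i)" "k' = (\<beta>, j)" by (cases k, cases k')
    have "i - 0(p := 1) + j = i + j - 0(p := 1)" "i + (j - 0(p := 1)) = i + j - 0(p := 1)"
      by (auto simp: fun_ext_simps)
    then show "partial p (single k r * single k' r') =
        partial p (single k r) * single k' r' + single k r * partial p (single k' r')"
      by (simp add: k mult_single partial_single algebra_simps single_add)
  qed (simp_all add: partial_add algebra_simps)
qed (simp_all add: partial_add algebra_simps)

lemma partial_commute: "partial p (partial q u) = partial q (partial p u)"
proof (cases "p = q")
  case False
  show ?thesis
  proof (rule additive_ext[where a = u])
    fix k r assume "k \<in> keys u"
    obtain \<alpha> i where k: "k = (\<alpha>, i)" by (cases k)
    have "i - 0(q := 1) - 0(p := 1) = i - 0(p := 1) - 0(q := 1)"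
      by (auto simp: fun_ext_simps)
    then show "partial p (partial q (single k r)) = partial q (partial p (single k r))"
      using False by (simp add: k partial_single partial_add algebra_simps single_add)
  qed (simp_all add: partial_add)
qed simp

lemma partial_pow_add: "partial_pow n lam (u + v) = partial_pow n lam u + partial_pow n lam v"
proof -
  have "(partial p ^^ m) (u + v) = (partial p ^^ m) u + (partial p ^^ m) v"
    for p m and u v :: "'a::field gen_fun"
    by (induction m) (auto simp: partial_add)
  then show ?thesis by (induction n arbitrary: u v) auto
qed

section \<open>Left multiplication by derivations and the Leibniz rule\<close>

lemma lookup_map_zero: "f 0 = 0 \<Longrightarrow> lookup (Poly_Mapping.map f a) k = f (lookup a k)"
  by transfer (auto simp: when_def)

lemma lookup_mult_single_zero: "lookup (single 0 u * b) k = u * lookup b k"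
  by (simp add: mult_map_scale_conv_mult[symmetric] lookup_map_zero)

text \<open>Left multiplication by \<open>\<partial>\<^sub>p\<close>.\<close>

definition d_left :: "nat \<Rightarrow> 'a::field gen_op \<Rightarrow> 'a gen_op" where
  "d_left p b = Poly_Mapping.map (partial p) b + single (0(p := 1)) 1 * b"

lemma d_left_add: "d_left p (a + b) = d_left p a + d_left p b"
proof -
  have "Poly_Mapping.map (partial p) (a + b) = Poly_Mapping.map (partial p) a + Poly_Mapping.map (partial p) b"
    by (rule poly_mapping_eqI) (simp add: lookup_map_zero lookup_add partial_add)
  then show ?thesis by (simp add: d_left_def algebra_simps)
qed

lemma d_left_single: "d_left p (single k u) = single k (partial p u) + single (k + 0(p := 1)) u"
proof -
  have "Poly_Mapping.map (partial p) (single k u) = single k (partial p u)"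
    by (rule poly_mapping_eqI) (auto simp: lookup_map_zero lookup_single when_def)
  then show ?thesis by (simp add: d_left_def mult_single add.commute)
qed

lemma d_left_commute: "d_left p (d_left q b) = d_left q (d_left p b)"
  by (rule additive_ext[where a = b])
    (auto simp: d_left_add d_left_single partial_commute[of p q] algebra_simps)

text \<open>The commutation relation of \<partial>_p with a function u; together with
  \<open>d_left_commute\<close> it carries the associativity of the product.\<close>

lemma d_left_single_zero_mult:
  "d_left p (single 0 u * b) = single 0 (partial p u) * b + single 0 u * d_left p b"
  by (rule additive_ext[where a = b])
    (auto simp: d_left_add d_left_single mult_single partial_mult algebra_simps single_add)

text \<open>As rewrite rules these two turn the keys \<open>0\<close> and \<open>f + g\<close> into abstractions.\<close>

declare plus_fun_apply [simp del] zero_fun_apply [simp del]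

primrec d_left_pow :: "nat \<Rightarrow> (nat \<Rightarrow> nat) \<Rightarrow> 'a::field gen_op \<Rightarrow> 'a gen_op" where
  "d_left_pow 0 \<mu> = id"
| "d_left_pow (Suc n) \<mu> = d_left_pow n \<mu> \<circ> (d_left (Suc n) ^^ \<mu> (Suc n))"

lemma funpow_d_left_add: "(d_left p ^^ m) (a + b) = (d_left p ^^ m) a + (d_left p ^^ m) b"
  by (induction m) (auto simp: d_left_add)

lemma d_left_pow_add: "d_left_pow n \<mu> (a + b) = d_left_pow n \<mu> a + d_left_pow n \<mu> b"
  by (induction n arbitrary: a b) (auto simp: funpow_d_left_add)

lemma funpow_d_left_commute: "(d_left p ^^ m) (d_left q b) = d_left q ((d_left p ^^ m) b)"
  by (induction m) (auto simp: d_left_commute[of p q])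

lemma d_left_pow_commute: "d_left_pow n \<mu> (d_left q b) = d_left q (d_left_pow n \<mu> b)"
  by (induction n arbitrary: b) (auto simp: funpow_d_left_commute)

lemma d_left_pow_cong:
  "(\<And>p. p \<in> {1..n} \<Longrightarrow> \<mu> p = \<mu>' p) \<Longrightarrow> d_left_pow n \<mu> = d_left_pow n \<mu>'"
  by (induction n) auto

lemma partial_pow_cong:
  "(\<And>p. p \<in> {1..n} \<Longrightarrow> \<mu> p = \<mu>' p) \<Longrightarrow> partial_pow n \<mu> = partial_pow n \<mu>'"
  by (induction n) auto

lemma partial_pow_zero [simp]: "partial_pow n 0 u = u"
  by (induction n) (auto simp: zero_fun_apply)

lemma d_left_pow_zero [simp]: "d_left_pow n 0 u = u"
  by (induction n) (auto simp: zero_fun_apply)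

lemma d_left_pow_Suc:
  fixes b :: "'a::field gen_op"
  shows "p \<in> {1..n} \<Longrightarrow> d_left_pow n (\<mu> + 0(p := 1)) b = d_left p (d_left_pow n \<mu> b)"
proof (induction n arbitrary: b)
  case (Suc n)
  show ?case
  proof (cases "p = Suc n")
    case True
    have "d_left_pow n (\<mu> + 0(p := 1)) = (d_left_pow n \<mu> :: 'a gen_op \<Rightarrow> _)"
      by (rule d_left_pow_cong) (auto simp: True plus_fun_apply zero_fun_apply)
    moreover have "(\<mu> + 0(p := 1)) (Suc n) = Suc (\<mu> (Suc n))"
      by (simp add: True plus_fun_apply zero_fun_apply)
    ultimately have "d_left_pow (Suc n) (\<mu> + 0(p := 1)) b =
        d_left_pow n \<mu> ((d_left (Suc n) ^^ Suc (\<mu> (Suc n))) b)"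
      by (simp only: d_left_pow.simps comp_def)
    also have "\<dots> = d_left p (d_left_pow (Suc n) \<mu> b)"
      by (simp add: True d_left_pow_commute)
    finally show ?thesis .
  next
    case False
    then show ?thesis using Suc by (simp add: plus_fun_apply zero_fun_apply)
  qed
qed simp

text \<open>Leibniz rule in one direction. In the induction step, differentiating v gives the terms
  of index k + 1 and raising the power of \<partial>_q those of index k; Pascal's rule joins
  them.\<close>

lemma funpow_d_left_single:
  fixes v :: "'a::field gen_fun"
  shows "(d_left q ^^ m) (single \<nu> v) =
    (\<Sum>k\<le>m. single (\<nu> + 0(q := m - k)) (of_nat (m choose k) * (partial q ^^ k) v))"
proof (induction m)
  case 0
  have "\<nu> + 0(q := 0) = \<nu>" by (auto simp: fun_ext_simps)
  then show ?case by simp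
next
  case (Suc m)
  have of_nat_partial: "partial q (of_nat n * u) = of_nat n * partial q u" for n and u :: "'a gen_fun"
    by (simp add: partial_mult single_of_nat[symmetric] del: single_of_nat)
  have key: "\<nu> + 0(q := m - k) + 0(q := 1) = \<nu> + 0(q := Suc m - k)" if "k \<le> m" for k
    using that by (auto simp: fun_ext_simps)
  define G where "G k c = single (\<nu> + 0(q := Suc m - k)) (of_nat c * (partial q ^^ k) v)" for k c
  have "(d_left q ^^ Suc m) (single \<nu> v) =
      (\<Sum>k\<le>m. d_left q (single (\<nu> + 0(q := m - k)) (of_nat (m choose k) * (partial q ^^ k) v)))"
    by (simp only: funpow.simps comp_def Suc.IH additive_sum[of "d_left q", OF d_left_add])
  also have "\<dots> = (\<Sum>k\<le>m. G (Suc k) (m choose k) + G k (m choose k))"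
    by (rule sum.cong) (auto simp: d_left_single of_nat_partial key[unfolded One_nat_def] G_def)
  also have "\<dots> = (\<Sum>k\<le>m. G (Suc k) (m choose k)) + (\<Sum>k\<le>Suc m. G k (m choose k))"
    by (simp add: sum.distrib) (simp add: G_def binomial_eq_0)
  also have "(\<Sum>k\<le>Suc m. G k (m choose k)) = G 0 1 + (\<Sum>k\<le>m. G (Suc k) (m choose Suc k))"
    by (subst sum.atMost_Suc_shift) simp
  also have "(\<Sum>k\<le>m. G (Suc k) (m choose k)) + (G 0 1 + (\<Sum>k\<le>m. G (Suc k) (m choose Suc k))) =
      G 0 1 + (\<Sum>k\<le>m. G (Suc k) (Suc m choose Suc k))"
    by (simp add: sum.distrib[symmetric] G_def single_add algebra_simps)
  also have "\<dots> = (\<Sum>k\<le>Suc m. G k (Suc m choose k))"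
    by (simp add: sum.atMost_Suc_shift del: sum.atMost_Suc binomial_Suc_Suc)
  finally show ?case by (simp only: G_def)
qed

text \<open>Identifies the sum in \<open>op_mult\<close> with iterated left multiplication: the
  one-direction rule is applied in the last direction, and a multi-index below \<mu> splits into its
  entry there and the rest.\<close>

lemma d_left_pow_single:
  fixes v :: "'a::field gen_fun"
  assumes "\<And>p. p \<notin> {1..n} \<Longrightarrow> \<mu> p = 0"
  shows "d_left_pow n \<mu> (single \<nu> v) = (\<Sum>lam | lam \<le> \<mu>. single (\<mu> + \<nu> - lam)
    (of_nat (\<Prod>p\<in>{1..n}. \<mu> p choose lam p) * partial_pow n lam v))"
  using assms
proof (induction n arbitrary: \<mu> \<nu> v)
  case 0
  then have "\<mu> = 0" by (auto simp: fun_ext_simps)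
  moreover have "{lam. lam \<le> (0 :: nat \<Rightarrow> nat)} = {0}"
    by (auto simp: le_fun_def fun_ext_simps)
  moreover have "0 + \<nu> - 0 = \<nu>" by (auto simp: fun_ext_simps)
  ultimately show ?case
    by (simp only: d_left_pow.simps partial_pow.simps id_apply sum.insert finite.emptyI sum.empty) simp
next
  case (Suc n)
  define q m \<mu>' where "q = Suc n" and "m = \<mu> q" and "\<mu>' = \<mu>(q := 0)"
  have \<mu>': "\<mu>' p = 0" if "p \<notin> {1..n}" for p
    using that Suc.prems[of p] by (auto simp: \<mu>'_def q_def)
  have "d_left_pow (Suc n) \<mu> (single \<nu> v) =
      (\<Sum>k\<le>m. d_left_pow n \<mu> (single (\<nu> + 0(q := m - k)) (of_nat (m choose k) * (partial q ^^ k) v)))"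
    by (simp add: funpow_d_left_single additive_sum[of "d_left_pow n \<mu>", OF d_left_pow_add] q_def m_def)
  also have "d_left_pow n \<mu> = (d_left_pow n \<mu>' :: 'a gen_op \<Rightarrow> _)"
    by (rule d_left_pow_cong) (auto simp: \<mu>'_def q_def)
  also have "(\<Sum>k\<le>m. d_left_pow n \<mu>' (single (\<nu> + 0(q := m - k)) (of_nat (m choose k) * (partial q ^^ k) v))) =
      (\<Sum>k\<le>m. \<Sum>lam | lam \<le> \<mu>'. single (\<mu>' + (\<nu> + 0(q := m - k)) - lam)
        (of_nat (\<Prod>p\<in>{1..n}. \<mu>' p choose lam p) * partial_pow n lam (of_nat (m choose k) * (partial q ^^ k) v)))"
    using Suc.IH[of \<mu>'] \<mu>' by (simp only: simp_thms cong: sum.cong)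
  also have "\<dots> = (\<Sum>(k, lam)\<in>{..m} \<times> {lam. lam \<le> \<mu>'}. single (\<mu>' + (\<nu> + 0(q := m - k)) - lam)
        (of_nat (\<Prod>p\<in>{1..n}. \<mu>' p choose lam p) * partial_pow n lam (of_nat (m choose k) * (partial q ^^ k) v)))"
    by (rule sum.cartesian_product)
  also have "\<dots> = (\<Sum>lam | lam \<le> \<mu>. single (\<mu> + \<nu> - lam)
    (of_nat (\<Prod>p\<in>{1..Suc n}. \<mu> p choose lam p) * partial_pow (Suc n) lam v))"
  proof (rule sum.reindex_bij_witness[where j = "\<lambda>(k, lam). lam(q := k)" and i = "\<lambda>lam. (lam q, lam(q := 0))"],
      goal_cases)
    case (1 a)
    then show ?case by (cases a) (auto simp: le_fun_def \<mu>'_def fun_ext_simps; metis le_zero_eq)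
  next
    case (2 a)
    then show ?case by (cases a) (auto simp: le_fun_def \<mu>'_def m_def split: if_splits)
  next
    case (3 a)
    then show ?case by (auto simp: fun_ext_simps)
  next
    case (4 a)
    then show ?case by (auto simp: le_fun_def \<mu>'_def m_def)
  next
    case (5 a)
    obtain k lam where a: "a = (k, lam)" by (cases a)
    have lam: "k \<le> m" "lam \<le> \<mu>'" "lam q = 0"
      using 5 a by (auto simp: le_fun_def \<mu>'_def split: if_splits)
    have "\<mu> + \<nu> - lam(q := k) = \<mu>' + (\<nu> + 0(q := m - k)) - lam"
      using lam by (auto simp: fun_ext_simps \<mu>'_def m_def)
    moreover have "(\<Prod>p\<in>{1..Suc n}. \<mu> p choose (lam(q := k)) p) =
        (\<Prod>p\<in>{1..n}. \<mu>' p choose lam p) * (m choose k)"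
      by (simp add: q_def \<mu>'_def m_def)
    moreover have "partial_pow n (lam(q := k)) = (partial_pow n lam :: 'a gen_fun \<Rightarrow> _)"
      by (rule partial_pow_cong) (auto simp: q_def)
    moreover have "partial_pow n lam (of_nat c * u) = of_nat c * partial_pow n lam u" for c and u :: "'a gen_fun"
      by (induction c) (auto simp: partial_pow_add algebra_simps
          additive_diff[of "partial_pow n lam", OF partial_pow_add, of 0 0, simplified])
    ultimately show ?case by (simp add: a q_def mult.assoc)
  qed
  finally show ?case .
qed

lemma finite_le_fun: "(\<And>p. p \<notin> {1..n} \<Longrightarrow> \<mu> p = 0) \<Longrightarrow> finite {lam :: nat \<Rightarrow> nat. lam \<le> \<mu>}"
proof (rule finite_subset)
  assume \<mu>: "\<And>p. p \<notin> {1..n} \<Longrightarrow> \<mu> p = 0"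
  show "{lam. lam \<le> \<mu>} \<subseteq> (\<lambda>f p. if p \<in> {1..n} then f p else 0) ` (\<Pi>\<^sub>E p\<in>{1..n}. {..\<mu> p})"
  proof
    fix lam assume "lam \<in> {lam. lam \<le> \<mu>}"
    then have le: "lam p \<le> \<mu> p" for p by (auto simp: le_fun_def)
    have "lam = (\<lambda>p. if p \<in> {1..n} then restrict lam {1..n} p else 0)"
      using le \<mu> by (auto simp: fun_ext_simps) (metis le_zero_eq atLeastAtMost_iff)+
    moreover have "restrict lam {1..n} \<in> (\<Pi>\<^sub>E p\<in>{1..n}. {..\<mu> p})" using le by auto
    ultimately show "lam \<in> (\<lambda>f p. if p \<in> {1..n} then f p else 0) ` (\<Pi>\<^sub>E p\<in>{1..n}. {..\<mu> p})"
      by (rule image_eqI)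
  qed
qed (intro finite_imageI finite_PiE, auto)

text \<open>The action of \<open>a\<close> by left multiplication; it is associative because the operators
  \<open>d_left p\<close> and the multiplications by functions satisfy the relations of the algebra.\<close>

definition op_act :: "nat \<Rightarrow> 'a::field gen_op \<Rightarrow> 'a gen_op \<Rightarrow> 'a gen_op" where
  "op_act l a b = (\<Sum>\<mu>\<in>keys a. single 0 (lookup a \<mu>) * d_left_pow l \<mu> b)"

lemma op_act_add_left: "op_act l (a + a') b = op_act l a b + op_act l a' b"
  unfolding op_act_def
  by (rule setsum_keys_plus_distrib) (auto simp: single_add algebra_simps)

lemma op_act_add_right: "op_act l a (b + b') = op_act l a b + op_act l a b'"
  by (simp add: op_act_def d_left_pow_add algebra_simps sum.distrib)

lemma op_act_single: "op_act l (single \<mu> u) b = single 0 u * d_left_pow l \<mu> b"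
  by (cases "u = 0") (auto simp: op_act_def)

lemma op_act_mult: "op_act l (single 0 u * a) b = single 0 u * op_act l a b"
  by (rule additive_ext[where a = a])
    (auto simp: op_act_add_left op_act_single mult_single distrib_left simp flip: mult.assoc)

lemma op_act_d_left: "p \<in> {1..l} \<Longrightarrow> op_act l (d_left p a) b = d_left p (op_act l a b)"
  by (rule additive_ext[where a = a])
    (auto simp: op_act_add_left op_act_single d_left_add d_left_single d_left_single_zero_mult
      d_left_pow_Suc[unfolded One_nat_def])

lemma op_act_d_left_pow: "n \<le> l \<Longrightarrow> op_act l (d_left_pow n \<mu> a) b = d_left_pow n \<mu> (op_act l a b)"
proof (induction n arbitrary: a)
  case (Suc n)
  have "op_act l ((d_left (Suc n) ^^ m) a) b = (d_left (Suc n) ^^ m) (op_act l a b)" for m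
    by (induction m) (use Suc.prems in \<open>auto simp: op_act_d_left\<close>)
  then show ?case using Suc by simp
qed simp

lemma op_act_assoc: "op_act l (op_act l a b) c = op_act l a (op_act l b c)"
  by (rule additive_ext[where a = a])
    (auto simp: op_act_add_left op_act_single op_act_mult op_act_d_left_pow)

text \<open>As \<partial>_p(1) = 0, left multiplications applied to 1 only accumulate the exponent
  \<mu>, cut off to the positions 1..l; the support condition says that nothing is cut off.\<close>

lemma op_act_one_right:
  fixes a :: "'a::field gen_op"
  assumes "\<And>\<mu> p. \<mu> \<in> keys a \<Longrightarrow> p \<notin> {1..l} \<Longrightarrow> \<mu> p = 0"
  shows "op_act l a 1 = a"
proof (rule additive_ext[where a = a])
  fix \<mu> and u :: "'a gen_fun" assume "\<mu> \<in> keys a"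
  have "d_left_pow n \<mu> (single \<nu> (1 :: 'a gen_fun)) = single (\<nu> + (\<lambda>p. if p \<in> {1..n} then \<mu> p else 0)) 1"
    for n and \<nu> :: "nat \<Rightarrow> nat"
  proof (induction n arbitrary: \<nu>)
    case 0
    have "\<nu> + (\<lambda>p. 0) = \<nu>" by (auto simp: fun_ext_simps)
    then show ?case by simp
  next
    case (Suc n)
    have 1: "(d_left q ^^ m) (single \<nu> 1) = single (\<nu> + 0(q := m)) 1" for m q and \<nu> :: "nat \<Rightarrow> nat"
    proof (induction m)
      case 0
      have "\<nu> + 0(q := 0) = \<nu>" by (auto simp: fun_ext_simps)
      then show ?case by simp
    next
      case (Suc m)
      have eq: "\<nu> + 0(q := m) + 0(q := 1) = \<nu> + 0(q := Suc m)" by (auto simp: fun_ext_simps)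
      show ?case
        by (simp only: funpow.simps comp_def Suc.IH d_left_single partial_one single_zero add_0 eq)
    qed
    have "\<nu> + 0(Suc n := \<mu> (Suc n)) + (\<lambda>p. if p \<in> {1..n} then \<mu> p else 0) =
        \<nu> + (\<lambda>p. if p \<in> {1..Suc n} then \<mu> p else 0)"
      by (auto simp: fun_ext_simps)
    then show ?case by (simp only: d_left_pow.simps comp_def 1 Suc.IH)
  qed
  from this[of l 0] have "d_left_pow l \<mu> (1 :: 'a gen_op) = single (\<lambda>p. if p \<in> {1..l} then \<mu> p else 0) 1"
    by simp
  moreover have "(\<lambda>p. if p \<in> {1..l} then \<mu> p else 0) = \<mu>"
    using assms[OF \<open>\<mu> \<in> keys a\<close>] by (auto simp: fun_ext_simps)
  ultimately show "op_act l (single \<mu> u) 1 = single \<mu> u"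
    by (simp add: op_act_single mult_single)
qed (auto simp: op_act_add_left)

lemma op_mult_eq_op_act:
  assumes "\<And>\<mu> p. \<mu> \<in> keys a \<Longrightarrow> p \<notin> {1..l} \<Longrightarrow> \<mu> p = 0"
  shows "op_mult l a b = op_act l a b"
proof -
  have "op_mult l a b = (\<Sum>\<mu>\<in>keys a. \<Sum>\<nu>\<in>keys b.
      single 0 (lookup a \<mu>) * d_left_pow l \<mu> (single \<nu> (lookup b \<nu>)))"
    unfolding op_mult_def
  proof (intro sum.cong refl)
    fix \<mu> \<nu> assume "\<mu> \<in> keys a"
    then have "\<And>p. p \<notin> {1..l} \<Longrightarrow> \<mu> p = 0" using assms by blast
    then have "d_left_pow l \<mu> (single \<nu> (lookup b \<nu>)) = (\<Sum>lam | lam \<le> \<mu>. single (\<mu> + \<nu> - lam)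
        (of_nat (\<Prod>p\<in>{1..l}. \<mu> p choose lam p) * partial_pow l lam (lookup b \<nu>)))"
      by (rule d_left_pow_single)
    then show "(\<Sum>lam | lam \<le> \<mu>. single (\<mu> + \<nu> - lam) (lookup a \<mu> *
        (of_nat (\<Prod>p\<in>{1..l}. \<mu> p choose lam p) * partial_pow l lam (lookup b \<nu>)))) =
      single 0 (lookup a \<mu>) * d_left_pow l \<mu> (single \<nu> (lookup b \<nu>))"
      by (simp only: sum_distrib_left mult_single add_0)
  qed
  also have "\<dots> = (\<Sum>\<mu>\<in>keys a. single 0 (lookup a \<mu>) * d_left_pow l \<mu> (\<Sum>\<nu>\<in>keys b. single \<nu> (lookup b \<nu>)))"
    by (intro sum.cong refl)
      (simp add: additive_sum[of "d_left_pow l \<mu>" for \<mu>, OF d_left_pow_add] sum_distrib_left)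
  finally show ?thesis by (simp add: sum_single op_act_def)
qed

lemma op_scale_eq_mult:
  fixes b :: "'a::field gen_op"
  shows "op_scale r b = single 0 (single 0 r) * b"
proof -
  have "(Poly_Mapping.map ((*) r) :: 'a gen_fun \<Rightarrow> _) = (*) (single 0 r)"
    by (rule ext) (rule mult_map_scale_conv_mult)
  then have "op_scale r b = Poly_Mapping.map ((*) (single 0 r)) b"
    by (simp only: op_scale_def)
  then show ?thesis by (simp add: mult_map_scale_conv_mult)
qed

lemma d_left_op_scale: "d_left p (op_scale r b) = op_scale r (d_left p b)"
  by (simp add: op_scale_eq_mult d_left_single_zero_mult)

lemma d_left_pow_op_scale: "d_left_pow n \<mu> (op_scale r b) = op_scale r (d_left_pow n \<mu> b)"
proof -
  have "(d_left p ^^ m) (op_scale r b) = op_scale r ((d_left p ^^ m) b)"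
    for p m and b :: "'a gen_op"
    by (induction m) (auto simp: d_left_op_scale)
  then show ?thesis by (induction n arbitrary: b) auto
qed

text \<open>In the Leibniz sum for \<mu>, the power \<partial>^\<kappa> comes from the single index
  \<open>lam = \<mu> - \<kappa>\<close>; the binomial coefficient is rewritten by its symmetry. The
  guard \<kappa> \<le> \<mu> is there because subtraction of naturals is truncated.\<close>

lemma lookup_op_act_fun:
  assumes "\<And>\<mu> p. \<mu> \<in> keys a \<Longrightarrow> p \<notin> {1..l} \<Longrightarrow> \<mu> p = 0"
  shows "lookup (op_act l a (single 0 u)) \<kappa> = (\<Sum>\<mu> | \<mu> \<in> keys a \<and> \<kappa> \<le> \<mu>.
    lookup a \<mu> * (of_nat (\<Prod>p\<in>{1..l}. \<mu> p choose \<kappa> p) * partial_pow l (\<mu> - \<kappa>) u))"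
proof -
  have "lookup (single 0 v * d_left_pow l \<mu> (single 0 u)) \<kappa> = (if \<kappa> \<le> \<mu> then
      v * (of_nat (\<Prod>p\<in>{1..l}. \<mu> p choose \<kappa> p) * partial_pow l (\<mu> - \<kappa>) u) else 0)"
    if "\<mu> \<in> keys a" for \<mu> v
  proof -
    have supp: "\<mu> p = 0" if "p \<notin> {1..l}" for p using assms \<open>\<mu> \<in> keys a\<close> that by blast
    have "lookup (d_left_pow l \<mu> (single 0 u)) \<kappa> = (\<Sum>lam | lam \<le> \<mu>.
        if lam = \<mu> - \<kappa> \<and> \<kappa> \<le> \<mu> then of_nat (\<Prod>p\<in>{1..l}. \<mu> p choose lam p) * partial_pow l lam u else 0)"
    proof (subst d_left_pow_single, use supp in blast, unfold lookup_sum, rule sum.cong)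
      fix lam assume "lam \<in> {lam. lam \<le> \<mu>}"
      then have "\<mu> - lam = \<kappa> \<longleftrightarrow> lam = \<mu> - \<kappa> \<and> \<kappa> \<le> \<mu>"
        by (auto simp: fun_ext_simps le_fun_def) (metis diff_diff_cancel, metis diff_le_self)
      then show "lookup (single (\<mu> + 0 - lam) (of_nat (\<Prod>p\<in>{1..l}. \<mu> p choose lam p) * partial_pow l lam u)) \<kappa> =
          (if lam = \<mu> - \<kappa> \<and> \<kappa> \<le> \<mu> then of_nat (\<Prod>p\<in>{1..l}. \<mu> p choose lam p) * partial_pow l lam u else 0)"
        by (simp add: lookup_single when_def)
    qed simp
    also have "\<dots> = (if \<kappa> \<le> \<mu> then
        of_nat (\<Prod>p\<in>{1..l}. \<mu> p choose (\<mu> - \<kappa>) p) * partial_pow l (\<mu> - \<kappa>) u else 0)"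
    proof (cases "\<kappa> \<le> \<mu>")
      case True
      then have "\<mu> - \<kappa> \<le> \<mu>" by (auto simp: le_fun_def)
      with True show ?thesis using finite_le_fun[of l \<mu>] supp by (simp add: sum.delta' sum.delta)
    qed simp
    also have "(\<Prod>p\<in>{1..l}. \<mu> p choose (\<mu> - \<kappa>) p) = (\<Prod>p\<in>{1..l}. \<mu> p choose \<kappa> p)" if "\<kappa> \<le> \<mu>"
      using that by (intro prod.cong) (auto simp: le_fun_def binomial_symmetric[symmetric])
    ultimately show ?thesis by (simp add: lookup_mult_single_zero)
  qed
  then have "lookup (op_act l a (single 0 u)) \<kappa> = (\<Sum>\<mu>\<in>keys a. if \<kappa> \<le> \<mu> then
      lookup a \<mu> * (of_nat (\<Prod>p\<in>{1..l}. \<mu> p choose \<kappa> p) * partial_pow l (\<mu> - \<kappa>) u) else 0)"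
    by (simp add: op_act_def lookup_sum)
  then show ?thesis by (simp add: sum.inter_filter[symmetric])
qed

context assoc_alg
begin

lemma two_weyl_pairs_coboundary:
  assumes "weyl_pair x d" "weyl_pair y d'" "br y x = 0" "br d' x = 0" "\<psi> \<in> cocycles2 L"
  shows "\<psi> \<in> coboundaries2 L"
proof -
  interpret alg_cocycle C mul scl e \<psi>
    using assms(5) by unfold_locales
  show ?thesis
    using assms psi_centralizer_two_pairs[of x y d']
    by (intro coboundary_criterion[of x d]) (auto simp: weyl_pair_def ad_nilpotent_def)
qed

end

section \<open>The carrier of the algebra of generalized differential operators\<close>

locale gen_weyl =
  fixes l1 l2 l3 l4 :: nat and \<Gamma> :: "(nat \<Rightarrow> 'a::field_char_0) set"
  assumes nondegenerate: "nondegenerate_subgroup l1 (l1 + l2 + l3 + l4) \<Gamma>"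
begin

abbreviation l :: nat where "l \<equiv> l1 + l2 + l3 + l4"
abbreviation J :: "(nat \<Rightarrow> int) set" where "J \<equiv> J_set l1 l2 l3 l4"
abbreviation C :: "'a gen_op set" where "C \<equiv> op_carrier l1 l2 l3 l4 \<Gamma>"

definition A :: "'a gen_fun set" where "A = {u. keys u \<subseteq> \<Gamma> \<times> J}"

lemma \<Gamma>_zero [simp]: "0 \<in> \<Gamma>"
  and \<Gamma>_add [simp]: "\<alpha> \<in> \<Gamma> \<Longrightarrow> \<beta> \<in> \<Gamma> \<Longrightarrow> \<alpha> + \<beta> \<in> \<Gamma>"
  and \<Gamma>_minus [simp]: "\<alpha> \<in> \<Gamma> \<Longrightarrow> - \<alpha> \<in> \<Gamma>"
  and \<Gamma>_supp: "\<alpha> \<in> \<Gamma> \<Longrightarrow> p \<notin> {l1 + 1..l} \<Longrightarrow> \<alpha> p = 0"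
  using nondegenerate unfolding nondegenerate_subgroup_def Let_def by blast+

text \<open>A functional that vanishes on \<Gamma> vanishes on its span, which contains the unit
  vector of position q. With c' = 0 and any q' this provides an exponent with nonzero entry at q;
  with both coefficients it provides a nonzero 2 by 2 determinant.\<close>

lemma \<Gamma>_separates:
  assumes "q \<in> {l1 + 1..l}" "c \<noteq> 0" "q' \<noteq> q"
  shows "\<exists>\<beta>\<in>\<Gamma>. c * \<beta> q + c' * \<beta> q' \<noteq> 0"
proof (rule ccontr)
  assume "\<not> ?thesis"
  then have zero: "\<beta> \<in> \<Gamma> \<Longrightarrow> c * \<beta> q + c' * \<beta> q' = 0" for \<beta> by blast
  define sc :: "'a \<Rightarrow> (nat \<Rightarrow> 'a) \<Rightarrow> nat \<Rightarrow> 'a" where "sc = (\<lambda>c v p. c * v p)"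
  interpret V: module sc
    by unfold_locales (auto simp: sc_def fun_ext_simps algebra_simps)
  obtain B where B: "B \<subseteq> \<Gamma>" "V.span B = {v. \<forall>p. p \<notin> {l1 + 1..l} \<longrightarrow> v p = 0}"
    using nondegenerate unfolding nondegenerate_subgroup_def Let_def sc_def by blast
  have "V.span B \<subseteq> {v. c * v q + c' * v q' = 0}"
  proof (rule V.span_minimal)
    show "V.subspace {v. c * v q + c' * v q' = 0}"
    proof (rule V.subspaceI)
      fix x y assume "x \<in> {v. c * v q + c' * v q' = 0}" "y \<in> {v. c * v q + c' * v q' = 0}"
      then have "(c * x q + c' * x q') + (c * y q + c' * y q') = 0" by simp
      then show "x + y \<in> {v. c * v q + c' * v q' = 0}"
        by (simp add: plus_fun_apply algebra_simps)
    next
      fix r x assume "x \<in> {v. c * v q + c' * v q' = 0}"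
      then have "r * (c * x q + c' * x q') = 0" by simp
      then show "sc r x \<in> {v. c * v q + c' * v q' = 0}"
        by (simp add: sc_def algebra_simps)
    qed (simp add: zero_fun_apply)
  qed (use zero B(1) in blast)
  moreover have "0(q := 1) \<in> V.span B"
    using assms(1) by (auto simp: B(2) zero_fun_apply)
  ultimately show False using assms by (auto simp: zero_fun_apply)
qed

lemma A_zero [simp]: "0 \<in> A"
  by (simp add: A_def)

lemma A_add [simp]: "u \<in> A \<Longrightarrow> v \<in> A \<Longrightarrow> u + v \<in> A"
  using keys_add[of u v] by (auto simp: A_def)

lemma A_uminus [simp]: "u \<in> A \<Longrightarrow> - u \<in> A"
  by (auto simp: A_def in_keys_iff subset_iff)

lemma A_diff [simp]: "u \<in> A \<Longrightarrow> v \<in> A \<Longrightarrow> u - v \<in> A"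
  using A_add[of u "- v"] by simp

lemma A_sum [simp]: "(\<And>x. x \<in> X \<Longrightarrow> f x \<in> A) \<Longrightarrow> sum f X \<in> A"
  by (induction X rule: infinite_finite_induct) auto

lemma J_zero [simp]: "0 \<in> J"
  by (auto simp: J_set_def zero_fun_apply)

lemma J_add: "i \<in> J \<Longrightarrow> j \<in> J \<Longrightarrow> i + j \<in> J"
  by (auto simp: J_set_def plus_fun_apply)

lemma J_unit: "p \<in> {1..l1 + l2 + l3} \<Longrightarrow> 0(p := 1) \<in> J"
  by (auto simp: J_set_def zero_fun_apply)

lemma A_single: "\<alpha> \<in> \<Gamma> \<Longrightarrow> i \<in> J \<Longrightarrow> single (\<alpha>, i) r \<in> A"
  by (simp add: A_def)

lemma A_const [simp]: "single 0 r \<in> A"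
  by (auto simp: A_def zero_prod_def)

lemma A_one [simp]: "1 \<in> A"
  using A_const[of 1] by simp

lemma A_mult [simp]: "u \<in> A \<Longrightarrow> v \<in> A \<Longrightarrow> u * v \<in> A"
proof -
  assume "u \<in> A" "v \<in> A"
  then have "a + b \<in> \<Gamma> \<times> J" if "a \<in> keys u" "b \<in> keys v" for a b
    using that by (cases a, cases b) (auto simp: A_def subset_iff intro!: J_add \<Gamma>_add)
  then show "u * v \<in> A"
    using keys_mult[of u v] unfolding A_def by blast
qed

lemma A_induct [consumes 1, case_names single add]:
  assumes "u \<in> A"
    and "\<And>\<alpha> i r. \<alpha> \<in> \<Gamma> \<Longrightarrow> i \<in> J \<Longrightarrow> P (single (\<alpha>, i) r)"
    and "\<And>u v. \<lbrakk>u \<in> A; v \<in> A; P u; P v\<rbrakk> \<Longrightarrow>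
      P (u + v)"
  shows "P u"
proof -
  have "(\<Sum>k\<in>X. single k (lookup u k)) \<in> A \<and> P (\<Sum>k\<in>X. single k (lookup u k))" if "X \<subseteq> keys u" for X
    using finite_subset[OF that finite_keys] that
  proof (induction X rule: finite_induct)
    case empty
    then show ?case using assms(2)[of 0 0 0] by simp
  next
    case (insert k X)
    then have "fst k \<in> \<Gamma>" "snd k \<in> J" using assms(1) by (auto simp: A_def)
    then show ?case using insert assms(2)[of "fst k" "snd k"] assms(3) A_single[of "fst k" "snd k"] by simp
  qed
  from this[of "keys u"] show ?thesis by (simp add: sum_single)
qed

text \<open>The key \<open>i - 0(p := 1)\<close> leaves \<open>J\<close> only if
  \<open>i p = 0\<close>, and then its coefficient is 0.\<close>

lemma A_partial [simp]:
  assumes "u \<in> A" "p \<in> {1..l}"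
  shows "partial p u \<in> A"
  using assms(1)
proof (induction u rule: A_induct)
  case (single \<alpha> i r)
  have "single (\<alpha>, i - 0(p := 1)) (r * of_int (i p)) \<in> A"
  proof (cases "i p = 0")
    case False
    then have "i - 0(p := 1) \<in> J"
      unfolding J_set_def
    proof (intro CollectI conjI allI ballI impI)
      fix q assume "q \<notin> {1..l}"
      then show "(i - 0(p := 1)) q = 0"
        using single(2) assms(2) by (auto simp: J_set_def zero_fun_apply)
    next
      fix q assume "q \<in> {1..l1 + l2}"
      then have "0 \<le> i q" using single(2) by (auto simp: J_set_def)
      then show "0 \<le> (i - 0(p := 1)) q" using False by (auto simp: zero_fun_apply)
    next
      fix q assume "q \<in> {l1 + l2 + l3 + 1..l}"
      then have "i q = 0" using single(2) by (auto simp: J_set_def)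
      then show "(i - 0(p := 1)) q = 0" using False by (auto simp: zero_fun_apply)
    qed
    then show ?thesis using single(1) by (simp add: A_single)
  qed simp
  then show ?case using single by (simp add: partial_single A_single)
qed (simp add: partial_add)

lemma C_iff: "a \<in> C \<longleftrightarrow> (\<forall>\<mu>\<in>keys a. (\<forall>p. p \<notin> {1..l} \<longrightarrow> \<mu> p = 0) \<and> lookup a \<mu> \<in> A)"
  by (auto simp: op_carrier_def A_def)

lemma C_supp: "\<lbrakk>a \<in> C; \<mu> \<in> keys a; p \<notin> {1..l}\<rbrakk> \<Longrightarrow>
      \<mu> p = 0"
  by (simp add: C_iff)

lemma C_lookup: "a \<in> C \<Longrightarrow> lookup a \<mu> \<in> A"
  by (cases "\<mu> \<in> keys a") (auto simp: C_iff in_keys_iff)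

lemma C_add: "a \<in> C \<Longrightarrow> b \<in> C \<Longrightarrow> a + b \<in> C"
  unfolding C_iff using keys_add[of a b] by (auto simp: lookup_add C_lookup[unfolded C_iff] dest!: subsetD)

lemma C_single: "(\<And>p. p \<notin> {1..l} \<Longrightarrow> \<mu> p = 0) \<Longrightarrow> u \<in> A \<Longrightarrow> single \<mu> u \<in> C"
  by (simp add: C_iff)

lemma C_fun [simp]: "u \<in> A \<Longrightarrow> single 0 u \<in> C"
  by (simp add: C_single zero_fun_apply)

lemma C_d [simp]: "p \<in> {1..l} \<Longrightarrow> u \<in> A \<Longrightarrow> single (0(p := 1)) u \<in> C"
  by (rule C_single) (auto simp: zero_fun_apply)

lemma C_fun_mult: "u \<in> A \<Longrightarrow> b \<in> C \<Longrightarrow> single 0 u * b \<in> C"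
proof -
  assume "u \<in> A" "b \<in> C"
  moreover have "keys (single 0 u * b) \<subseteq> keys b"
    by (auto simp: lookup_mult_single_zero in_keys_iff)
  ultimately show "single 0 u * b \<in> C"
    using C_supp[of b] C_lookup[of b] unfolding C_iff[of "single 0 u * b"]
    by (auto simp only: lookup_mult_single_zero intro!: A_mult)
qed

lemma C_sum: "(\<And>x. x \<in> X \<Longrightarrow> f x \<in> C) \<Longrightarrow> sum f X \<in> C"
  by (induction X rule: infinite_finite_induct) (auto simp: C_add C_iff[of 0])

lemma C_d_left:
  assumes "p \<in> {1..l}" "b \<in> C"
  shows "d_left p b \<in> C"
proof -
  have "d_left p b = (\<Sum>\<mu>\<in>keys b. d_left p (single \<mu> (lookup b \<mu>)))"
    by (simp only: additive_sum[of "d_left p", OF d_left_add, symmetric] sum_single)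
  also have "\<dots> \<in> C"
  proof (rule C_sum)
    fix \<mu> assume "\<mu> \<in> keys b"
    then have "\<mu> r = 0" if "r \<notin> {1..l}" for r using C_supp assms that by blast
    then show "d_left p (single \<mu> (lookup b \<mu>)) \<in> C"
      unfolding d_left_single using assms C_lookup
      by (intro C_add C_single) (auto simp: plus_fun_apply zero_fun_apply)
  qed
  finally show ?thesis .
qed

lemma C_d_left_pow: "n \<le> l \<Longrightarrow> b \<in> C \<Longrightarrow> d_left_pow n \<mu> b \<in> C"
proof (induction n arbitrary: b)
  case (Suc n)
  have "(d_left (Suc n) ^^ m) b \<in> C" for m
    by (induction m) (use Suc.prems in \<open>auto intro!: C_d_left\<close>)
  then show ?case using Suc by simp
qed simp

lemma op_mult_C: "a \<in> C \<Longrightarrow> op_mult l a b = op_act l a b"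
  by (rule op_mult_eq_op_act) (rule C_supp)

lemma C_op_act: "a \<in> C \<Longrightarrow> b \<in> C \<Longrightarrow> op_act l a b \<in> C"
  unfolding op_act_def by (intro C_sum C_fun_mult C_lookup C_d_left_pow) auto

lemma one_eq_xd: "xd 0 0 0 = 1"
  unfolding xd_def by (simp add: zero_prod_def[symmetric])

lemma C_op_scale: "a \<in> C \<Longrightarrow> op_scale r a \<in> C"
  by (simp add: op_scale_eq_mult C_fun_mult)

text \<open>The laws of the product are confined to the carrier: for a key \<mu> of infinite support
  there are infinitely many \<open>lam \<le> \<mu>\<close>, the sum in \<open>op_mult\<close> is 0,
  and already the right unit law fails. On the carrier \<open>op_mult\<close> is
  \<open>op_act\<close>.\<close>

sublocale assoc_alg C "op_mult l" op_scale "xd 0 0 0"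
proof
  fix a b c :: "'a gen_op" and r s :: 'a
  show "a \<in> C \<Longrightarrow> b \<in> C \<Longrightarrow> a + b \<in> C" by (rule C_add)
  show "a \<in> C \<Longrightarrow> op_scale r a \<in> C" by (rule C_op_scale)
  show "a \<in> C \<Longrightarrow> b \<in> C \<Longrightarrow> op_mult l a b \<in> C" by (simp add: op_mult_C C_op_act)
  show "xd 0 0 0 \<in> C" unfolding one_eq_xd using C_fun[of 1] by simp
  show "\<lbrakk>a \<in> C; b \<in> C; c \<in> C\<rbrakk> \<Longrightarrow>
      op_mult l (a + b) c = op_mult l a c + op_mult l b c"
    by (simp add: op_mult_C C_add op_act_add_left)
  show "\<lbrakk>a \<in> C; b \<in> C; c \<in> C\<rbrakk> \<Longrightarrow>
      op_mult l a (b + c) = op_mult l a b + op_mult l a c"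
    by (simp add: op_mult_C op_act_add_right)
  show "a \<in> C \<Longrightarrow> b \<in> C \<Longrightarrow> op_mult l (op_scale r a) b = op_scale r (op_mult l a b)"
    by (simp add: op_mult_C C_op_scale) (simp add: op_scale_eq_mult op_act_mult)
  show "a \<in> C \<Longrightarrow> b \<in> C \<Longrightarrow> op_mult l a (op_scale r b) = op_scale r (op_mult l a b)"
    by (simp add: op_mult_C op_act_def d_left_pow_op_scale)
      (simp add: op_scale_eq_mult sum_distrib_left mult.left_commute)
  show "\<lbrakk>a \<in> C; b \<in> C; c \<in> C\<rbrakk> \<Longrightarrow>
      op_mult l (op_mult l a b) c = op_mult l a (op_mult l b c)"
    by (simp add: op_mult_C C_op_act op_act_assoc)
  show "a \<in> C \<Longrightarrow> op_mult l (xd 0 0 0) a = a"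
    unfolding one_eq_xd
    using op_mult_C[of 1 a] C_fun[of 1] op_act_single[of l 0 1 a] by simp
  show "a \<in> C \<Longrightarrow> op_mult l a (xd 0 0 0) = a"
    unfolding one_eq_xd using op_act_one_right[of a l] C_supp[of a] by (simp add: op_mult_C)
  show "op_scale r (a + b) = op_scale r a + op_scale r b"
    by (simp add: op_scale_eq_mult algebra_simps)
  show "op_scale (r + s) a = op_scale r a + op_scale s a"
    by (simp add: op_scale_eq_mult single_add algebra_simps)
  show "op_scale r (op_scale s a) = op_scale (r * s) a"
    by (simp add: op_scale_eq_mult mult_single flip: mult.assoc)
  show "op_scale 1 a = a"
    by (simp add: op_scale_eq_mult)
qed

lemma W_algebra_eq_L: "W_algebra l1 l2 l3 l4 \<Gamma> = L"
  by (simp add: W_algebra_def L_def br_def fun_eq_iff)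

lemma mul_fun: "u \<in> A \<Longrightarrow> op_mult l (single 0 u) b = single 0 u * b"
  by (simp add: op_mult_C op_act_single)

lemma mul_d:
  assumes "p \<in> {1..l}" "u \<in> A"
  shows "op_mult l (single (0(p := 1)) u) b = single 0 u * d_left p b"
  using assms d_left_pow_Suc[of p l 0 b] by (simp add: op_mult_C op_act_single C_d[unfolded One_nat_def])

lemma br_fun_fun: "u \<in> A \<Longrightarrow> v \<in> A \<Longrightarrow> br (single 0 u) (single 0 v) = 0"
  by (simp add: br_def mul_fun mult.commute)

lemma br_d_fun:
  assumes "p \<in> {1..l}" "w \<in> A" "u \<in> A"
  shows "br (single (0(p := 1)) w) (single 0 u) = single 0 (w * partial p u)"
proof -
  have "br (single (0(p := 1)) w) (single 0 u) =
      single 0 w * d_left p (single 0 u) - single 0 u * single (0(p := 1)) w"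
    by (simp only: br_def mul_d[OF assms(1,2)] mul_fun[OF assms(3)])
  also have "\<dots> = single 0 (w * partial p u)"
    by (simp only: d_left_single distrib_left mult_single add_0 mult.commute[of w u]) simp
  finally show ?thesis .
qed

section \<open>Order filtration, Weyl pairs, and vanishing in at least two directions\<close>

definition op_order_below :: "nat \<Rightarrow> 'a gen_op set" where
  "op_order_below n = {a \<in> C. \<forall>\<mu>\<in>keys a. (\<Sum>p\<in>{1..l}. \<mu> p) < n}"

text \<open>The term \<mu> = \<kappa> of the product a u cancels against u a because functions
  commute, so only \<mu> > \<kappa> contributes: bracketing with a function lowers the
  order.\<close>

lemma lookup_br_fun:
  assumes "a \<in> C" "u \<in> A"
  shows "lookup (br a (single 0 u)) \<kappa> = (\<Sum>\<mu> | \<mu> \<in> keys a \<and> \<kappa> < \<mu>.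
    lookup a \<mu> * (of_nat (\<Prod>p\<in>{1..l}. \<mu> p choose \<kappa> p) * partial_pow l (\<mu> - \<kappa>) u))"
proof -
  let ?t = "\<lambda>\<mu>. lookup a \<mu> * (of_nat (\<Prod>p\<in>{1..l}. \<mu> p choose \<kappa> p) * partial_pow l (\<mu> - \<kappa>) u)"
  have "\<kappa> - \<kappa> = 0" by (auto simp: fun_ext_simps)
  then have diag: "?t \<kappa> = lookup a \<kappa> * u" by simp
  have "{\<mu>. \<mu> \<in> keys a \<and> \<kappa> \<le> \<mu>} = {\<mu>. \<mu> \<in> keys a \<and> \<kappa> < \<mu>} \<union> (if \<kappa> \<in> keys a then {\<kappa>} else {})"
    by (auto simp: order.order_iff_strict)
  moreover have "finite {\<mu>. \<mu> \<in> keys a \<and> \<kappa> < \<mu>}"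
    by (rule finite_subset[of _ "keys a"]) auto
  ultimately have "(\<Sum>\<mu> | \<mu> \<in> keys a \<and> \<kappa> \<le> \<mu>. ?t \<mu>) =
      (\<Sum>\<mu> | \<mu> \<in> keys a \<and> \<kappa> < \<mu>. ?t \<mu>) + (if \<kappa> \<in> keys a then ?t \<kappa> else 0)"
    by (simp add: sum.union_disjoint del: of_nat_prod)
  moreover have "(if \<kappa> \<in> keys a then ?t \<kappa> else 0) = u * lookup a \<kappa>"
    unfolding diag by (simp add: in_keys_iff mult.commute)
  ultimately show ?thesis
    using lookup_op_act_fun[of a l u \<kappa>] C_supp[of a] assms
    by (simp add: br_def op_mult_C op_act_single lookup_minus lookup_mult_single_zero del: of_nat_prod)
qed

lemma br_fun_order:
  assumes "a \<in> op_order_below (Suc n)" "u \<in> A"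
  shows "br a (single 0 u) \<in> op_order_below n"
  unfolding op_order_below_def
proof (intro CollectI conjI ballI)
  have a: "a \<in> C" "\<And>\<mu>. \<mu> \<in> keys a \<Longrightarrow> (\<Sum>p\<in>{1..l}. \<mu> p) < Suc n"
    using assms by (auto simp: op_order_below_def)
  show "br a (single 0 u) \<in> C" using a assms by simp
  fix \<kappa> assume "\<kappa> \<in> keys (br a (single 0 u))"
  moreover have "lookup (br a (single 0 u)) \<kappa> = 0" if "{\<mu>. \<mu> \<in> keys a \<and> \<kappa> < \<mu>} = {}"
    by (simp only: lookup_br_fun[OF a(1) assms(2)] that sum.empty)
  ultimately have "{\<mu>. \<mu> \<in> keys a \<and> \<kappa> < \<mu>} \<noteq> {}" by (auto simp: in_keys_iff)
  then obtain \<mu> where \<mu>: "\<mu> \<in> keys a" "\<kappa> < \<mu>" by auto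
  have le: "\<kappa> p \<le> \<mu> p" for p using \<mu>(2) by (simp add: order_less_imp_le le_funD)
  have "\<exists>p. \<kappa> p < \<mu> p"
    using \<mu>(2) unfolding less_le_not_le[of \<kappa> \<mu>] le_fun_def by (auto simp: not_le)
  then obtain p where p: "\<kappa> p < \<mu> p" by blast
  then have "p \<in> {1..l}" using C_supp[OF a(1) \<mu>(1), of p] by auto
  then have "(\<Sum>p\<in>{1..l}. \<kappa> p) < (\<Sum>p\<in>{1..l}. \<mu> p)"
    using le p by (intro sum_strict_mono_ex1) auto
  then show "(\<Sum>p\<in>{1..l}. \<kappa> p) < n" using a(2)[OF \<mu>(1)] by simp
qed

lemma ad_nilpotent_fun:
  assumes "u \<in> A"
  shows "ad_nilpotent (single 0 u)"
proof -
  have "a \<in> op_order_below n \<Longrightarrow> (ad (single 0 u) ^^ n) a = 0" for a n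
  proof (induction n arbitrary: a)
    case 0
    then have "keys a = {}" by (auto simp: op_order_below_def)
    then have "a = 0" by (auto intro!: poly_mapping_eqI simp: in_keys_iff)
    then show ?case by simp
  next
    case (Suc n)
    then show ?case using br_fun_order[OF Suc.prems assms] by (simp only: funpow_Suc_right comp_def)
  qed
  moreover have "\<exists>n. a \<in> op_order_below n" if "a \<in> C" for a
  proof -
    have "(\<Sum>p\<in>{1..l}. \<mu> p) < Suc (\<Sum>\<mu>\<in>keys a. \<Sum>p\<in>{1..l}. \<mu> p)" if "\<mu> \<in> keys a" for \<mu>
      using member_le_sum[of \<mu> "keys a" "\<lambda>\<mu>. \<Sum>p\<in>{1..l}. \<mu> p"] that by (simp add: less_Suc_eq_le)
    then show ?thesis using that by (auto simp: op_order_below_def)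
  qed
  ultimately show ?thesis using assms by (fastforce simp: ad_nilpotent_def)
qed

lemma weyl_pair_fun:
  assumes "u \<in> A" "w \<in> A" "p \<in> {1..l}" "w * partial p u = 1"
  shows "weyl_pair (single 0 u) (single (0(p := 1)) w)"
  unfolding weyl_pair_def
  using ad_nilpotent_fun[OF assms(1)] C_d[OF assms(3,2)] br_d_fun[OF assms(3,2,1)] assms(4)
  by (simp add: one_eq_xd)

definition coord :: "nat \<Rightarrow> 'a gen_fun" where
  "coord p = single (0, 0(p := 1)) 1"

lemma coord_A: "p \<in> {1..l1 + l2 + l3} \<Longrightarrow> coord p \<in> A"
  unfolding coord_def by (intro A_single J_unit) simp_all

lemma partial_coord: "partial q (coord p) = (if p = q then 1 else 0)"
  by (simp add: coord_def partial_single zero_fun_apply zero_prod_def[symmetric])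

lemma weyl_pair_coord:
  assumes "p \<in> {1..l1 + l2 + l3}"
  shows "weyl_pair (single 0 (coord p)) (single (0(p := 1)) 1)"
  using assms by (intro weyl_pair_fun coord_A) (auto simp: partial_coord)

lemma partial_exponential: "partial q (single (\<alpha>, 0) r) = single (\<alpha>, 0) (r * \<alpha> q)"
  by (simp add: partial_single zero_fun_apply)

text \<open>Since x^\<alpha> is an invertible eigenvector of \<partial>_p, d = x^(-\<alpha>)
  \<partial>_p / \<alpha>_p works where no coordinate function is available.\<close>

lemma weyl_pair_exponential:
  assumes "\<alpha> \<in> \<Gamma>" "p \<in> {1..l}" "\<alpha> p \<noteq> 0"
  shows "weyl_pair (single 0 (single (\<alpha>, 0) 1)) (single (0(p := 1)) (single (- \<alpha>, 0) (1 / \<alpha> p)))"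
  using assms
  by (intro weyl_pair_fun A_single)
    (auto simp: partial_exponential mult_single zero_prod_def[symmetric])

text \<open>Coordinates exist in the positions up to l1 + l2 + l3. If there is any, position 1 has
  one, and a pair in direction 2, of either kind, commutes with it because \<partial>_2 kills the
  first coordinate. Otherwise both elements are exponentials, and the derivation has to be chosen so
  that it kills one of them.\<close>

lemma coboundary_if_two_directions:
  assumes "l \<ge> 2" "\<psi> \<in> cocycles2 L"
  shows "\<psi> \<in> coboundaries2 L"
proof (cases "l1 + l2 + l3 = 0")
  case False
  define p :: nat where "p = 1"
  have p: "p \<in> {1..l1 + l2 + l3}" using False by (auto simp: p_def)
  define q :: nat where "q = 2"
  have q: "q \<in> {1..l}" "q \<noteq> p" using assms by (auto simp: p_def q_def)
  show ?thesis
  proof (cases "q \<le> l1 + l2 + l3")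
    case True
    then have q': "q \<in> {1..l1 + l2 + l3}" by (auto simp: q_def)
    show ?thesis
      using p q q' br_d_fun[of q 1 "coord p"]
      by (intro two_weyl_pairs_coboundary[OF weyl_pair_coord[OF p] weyl_pair_coord[OF q'] _ _ assms(2)]
          br_fun_fun) (auto simp: coord_A partial_coord)
  next
    case False
    obtain \<alpha> where \<alpha>: "\<alpha> \<in> \<Gamma>" "\<alpha> q \<noteq> 0"
      using \<Gamma>_separates[of q 1 "Suc q" 0] False q by auto
    show ?thesis
      using p q \<alpha> br_d_fun[of q "single (- \<alpha>, 0) (1 / \<alpha> q)" "coord p"]
      by (intro two_weyl_pairs_coboundary[OF weyl_pair_coord[OF p]
            weyl_pair_exponential[OF \<alpha>(1) q(1) \<alpha>(2)] _ _ assms(2)] br_fun_fun)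
        (auto simp: coord_A partial_coord A_single)
  qed
next
  case True
  then have ind: "1 \<in> {l1 + 1..l}" "2 \<in> {l1 + 1..l}" "1 \<in> {1..l}" "2 \<in> {1..l}"
    using assms(1) by auto
  obtain \<alpha> where \<alpha>: "\<alpha> \<in> \<Gamma>" "\<alpha> 1 \<noteq> 0"
    using \<Gamma>_separates[of 1 1 2 0] ind by auto
  obtain \<beta> where \<beta>: "\<beta> \<in> \<Gamma>" "\<alpha> 1 * \<beta> 2 + - \<alpha> 2 * \<beta> 1 \<noteq> 0"
    using \<Gamma>_separates[of 2 "\<alpha> 1" 1 "- \<alpha> 2"] ind \<alpha> by auto
  \<comment> \<open>The derivation \<alpha>_1 \<partial>_2 - \<alpha>_2 \<partial>_1 kills
    x^\<alpha> and multiplies x^\<beta> by the determinant D; dividing by D x^\<beta> gives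
    [d, x^\<beta>] = 1.\<close>
  define D where "D = \<alpha> 1 * \<beta> 2 + - \<alpha> 2 * \<beta> 1"
  define d :: "'a gen_op" where "d = single (0(2 := 1)) (single (- \<beta>, 0) (\<alpha> 1 / D)) +
      single (0(1 := 1)) (single (- \<beta>, 0) (- \<alpha> 2 / D))"
  have mA: "single (- \<beta>, 0) r \<in> A" "single (\<gamma>, 0) r \<in> A" if "\<gamma> \<in> \<Gamma>" for r \<gamma>
    using \<beta> that by (auto intro!: A_single)
  have dC: "d \<in> C"
    unfolding d_def using ind mA[OF \<beta>(1)] by (intro C_add C_d)
  have br_d: "br d (single 0 (single (\<gamma>, 0) 1)) =
      single 0 (single (\<gamma> - \<beta>, 0) ((\<alpha> 1 * \<gamma> 2 - \<alpha> 2 * \<gamma> 1) / D))"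
    if "\<gamma> \<in> \<Gamma>" for \<gamma>
  proof -
    have "br d (single 0 (single (\<gamma>, 0) 1)) =
        single 0 (single (- \<beta>, 0) (\<alpha> 1 / D) * partial 2 (single (\<gamma>, 0) 1)) +
        single 0 (single (- \<beta>, 0) (- \<alpha> 2 / D) * partial 1 (single (\<gamma>, 0) 1))"
      unfolding d_def using ind mA that
      by (simp only: br_add_left C_d C_fun br_d_fun)
    also have "\<dots> = single 0 (single (\<gamma> - \<beta>, 0) (\<alpha> 1 / D * \<gamma> 2 + - \<alpha> 2 / D * \<gamma> 1))"
      by (simp only: partial_exponential mult_single single_add[symmetric]) (simp add: single_add)
    also have "\<alpha> 1 / D * \<gamma> 2 + - \<alpha> 2 / D * \<gamma> 1 = (\<alpha> 1 * \<gamma> 2 - \<alpha> 2 * \<gamma> 1) / D"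
      by (simp add: diff_divide_distrib)
    finally show ?thesis .
  qed
  have "weyl_pair (single 0 (single (\<beta>, 0) 1)) d"
    unfolding weyl_pair_def
    using dC br_d[OF \<beta>(1)] \<beta>(2) ad_nilpotent_fun[OF mA(2)[OF \<beta>(1)]]
    by (simp add: D_def zero_prod_def[symmetric] one_eq_xd)
  moreover have "br d (single 0 (single (\<alpha>, 0) 1)) = 0"
    using br_d[OF \<alpha>(1)] by (simp add: mult.commute)
  ultimately show ?thesis
    using weyl_pair_exponential[OF \<alpha>(1) ind(3) \<alpha>(2)] assms(2) br_fun_fun mA(2) \<alpha>(1) \<beta>(1)
    by (blast intro: two_weyl_pairs_coboundary)
qed

end

section \<open>One direction: centralizers and the polynomial case\<close>

locale gen_weyl_1 = gen_weyl +
  assumes l_eq: "l = 1"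
begin

lemma C_key: "a \<in> C \<Longrightarrow> \<mu> \<in> keys a \<Longrightarrow> \<mu> = 0(1 := \<mu> 1)"
  using C_supp[of a \<mu>] by (auto simp: fun_ext_simps l_eq)

lemma J_key: "i \<in> J \<Longrightarrow> i = 0(1 := i 1)"
  by (auto simp: fun_ext_simps l_eq J_set_def)

text \<open>If a has order n > 0 with leading coefficient a_n, the coefficient of \<partial>^(n-1)
  in [a, u] is n a_n \<partial>(u). As \<partial>(u) has the inverse w and n is invertible in
  characteristic 0, a_n would be 0.\<close>

lemma centralizer_fun:
  assumes "u \<in> A" "partial 1 u * w = 1" "a \<in> C" "br a (single 0 u) = 0"
  shows "a = single 0 (lookup a 0)"
proof (rule ccontr)
  assume neq: "a \<noteq> single 0 (lookup a 0)"
  have S: "keys a - {0} \<noteq> {}"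
  proof
    assume "keys a - {0} = {}"
    then have "lookup a k = lookup (single 0 (lookup a 0)) k" for k
      by (cases "k = 0") (auto simp: in_keys_iff lookup_single when_def)
    then show False using neq poly_mapping_eqI by blast
  qed
  define n where "n = Max ((\<lambda>\<mu>. \<mu> 1) ` (keys a - {0}))"
  have "n \<in> (\<lambda>\<mu>. \<mu> 1) ` (keys a - {0})"
    unfolding n_def using S by (intro Max_in) auto
  then obtain \<mu> where \<mu>: "\<mu> \<in> keys a" "\<mu> \<noteq> 0" "\<mu> 1 = n" by auto
  have \<mu>_eq: "\<mu> = 0(1 := n)" using C_key[OF assms(3) \<mu>(1)] \<mu>(3) by simp
  have "n \<noteq> 0" using \<mu>_eq \<mu>(2) by (auto simp: fun_ext_simps split: if_splits)
  define \<kappa> :: "nat \<Rightarrow> nat" where "\<kappa> = 0(1 := n - 1)"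
  have "{\<nu>. \<nu> \<in> keys a \<and> \<kappa> < \<nu>} = {\<mu>}"
  proof (intro equalityI subsetI)
    fix \<nu> assume "\<nu> \<in> {\<nu>. \<nu> \<in> keys a \<and> \<kappa> < \<nu>}"
    then have \<nu>: "\<nu> \<in> keys a" "\<kappa> < \<nu>" by auto
    have \<nu>_eq: "\<nu> = 0(1 := \<nu> 1)" using C_key[OF assms(3) \<nu>(1)] .
    have "n - 1 < \<nu> 1"
    proof (rule ccontr)
      assume "\<not> ?thesis"
      then have "\<nu> \<le> \<kappa>" by (subst \<nu>_eq) (auto simp: \<kappa>_def le_fun_def)
      then show False using \<nu>(2) by simp
    qed
    moreover have "\<nu> 1 \<le> n"
      unfolding n_def using \<nu> \<open>n - 1 < \<nu> 1\<close> by (intro Max_ge) (auto simp: zero_fun_apply)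
    ultimately have "\<nu> 1 = n" by simp
    then show "\<nu> \<in> {\<mu>}" using \<nu>_eq \<mu>_eq by simp
  next
    fix \<nu> assume "\<nu> \<in> {\<mu>}"
    moreover have "\<kappa> \<le> \<mu>" "\<not> \<mu> \<le> \<kappa>"
      using \<open>n \<noteq> 0\<close> by (auto simp: \<mu>_eq \<kappa>_def le_fun_def intro!: exI[of _ 1])
    ultimately show "\<nu> \<in> {\<nu>. \<nu> \<in> keys a \<and> \<kappa> < \<nu>}" using \<mu>(1) by auto
  qed
  then have "lookup (br a (single 0 u)) \<kappa> =
      lookup a \<mu> * (of_nat (\<Prod>p\<in>{1..l}. \<mu> p choose \<kappa> p) * partial_pow l (\<mu> - \<kappa>) u)"
    by (simp add: lookup_br_fun[OF assms(3,1)] del: of_nat_prod)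
  moreover have "(\<Prod>p\<in>{1..l}. \<mu> p choose \<kappa> p) = n"
    using \<open>n \<noteq> 0\<close> by (cases n) (simp_all add: l_eq \<mu>_eq \<kappa>_def)
  moreover have "partial_pow l (\<mu> - \<kappa>) u = partial 1 u"
    using \<open>n \<noteq> 0\<close> by (simp add: l_eq \<mu>_eq \<kappa>_def)
  ultimately have "lookup a \<mu> * (of_nat n * partial 1 u) = 0"
    using assms(4) by (simp del: of_nat_prod)
  then have "lookup a \<mu> * (of_nat n * partial 1 u) * w = 0" by simp
  then have "lookup a \<mu> * of_nat n = 0"
    using assms(2) by (simp add: mult.assoc)
  then have "single 0 (of_nat n) * lookup a \<mu> = 0" by (simp add: mult.commute)
  moreover have "lookup a \<mu> = single 0 (1 / of_nat n) * (single 0 (of_nat n) * lookup a \<mu>)"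
    using \<open>n \<noteq> 0\<close> by (simp add: mult_single flip: mult.assoc single_of_nat)
  ultimately have "lookup a \<mu> = 0" by simp
  then show False using \<mu>(1) by (simp add: in_keys_iff)
qed

text \<open>For \<alpha>_1 = 0 this is the power rule, for \<alpha>_1 \<noteq> 0 integration by
  parts, which lowers the exponent until it is 0. Both rely on nonnegative exponents: the power rule
  breaks down at exponent -1.\<close>

lemma partial_surj:
  assumes "l1 + l2 = 1" "u \<in> A"
  shows "\<exists>v\<in>A. partial 1 v = u"
proof -
  have mono: "\<exists>v\<in>A. partial 1 v = single (\<alpha>, 0(1 := int n)) r" if \<alpha>: "\<alpha> \<in> \<Gamma>" for \<alpha> n r
  proof (cases "\<alpha> 1 = 0")
    case True
    have J: "0(1 := int (Suc n)) \<in> J" using assms(1) by (auto simp: J_set_def zero_fun_apply)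
    have eq: "0(1 := int (Suc n)) - 0(1 := 1) = 0(1 := int n)" by (auto simp: fun_ext_simps)
    have "partial 1 (single (\<alpha>, 0(1 := int (Suc n))) (r / of_nat (Suc n))) = single (\<alpha>, 0(1 := int n)) r"
      unfolding partial_single eq using True by (simp del: of_nat_Suc)
    then show ?thesis using A_single[OF \<alpha> J] by blast
  next
    case False
    show ?thesis
    proof (induction n arbitrary: r)
      case 0
      have "0(1 := int 0) = 0" by (auto simp: fun_ext_simps)
      moreover have "partial 1 (single (\<alpha>, 0) (r / \<alpha> 1)) = single (\<alpha>, 0) r"
        using False by (simp add: partial_exponential)
      ultimately show ?case using A_single[OF \<alpha> J_zero] by metis
    next
      case (Suc n)
      have J: "0(1 := int (Suc n)) \<in> J" using assms(1) by (auto simp: J_set_def zero_fun_apply)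
      have eq: "0(1 := int (Suc n)) - 0(1 := 1) = 0(1 := int n)" by (auto simp: fun_ext_simps)
      have "partial 1 (single (\<alpha>, 0(1 := int (Suc n))) (r / \<alpha> 1)) =
          single (\<alpha>, 0(1 := int (Suc n))) r + single (\<alpha>, 0(1 := int n)) (r / \<alpha> 1 * of_nat (Suc n))"
        unfolding partial_single eq using False by simp
      moreover obtain v where "v \<in> A" "partial 1 v = single (\<alpha>, 0(1 := int n)) (r / \<alpha> 1 * of_nat (Suc n))"
        using Suc.IH by blast
      ultimately have "partial 1 (single (\<alpha>, 0(1 := int (Suc n))) (r / \<alpha> 1) - v) =
          single (\<alpha>, 0(1 := int (Suc n))) r"
        by (simp only: additive_diff[of "partial 1", OF partial_add]) simp
      then show ?case using A_diff[OF A_single[OF \<alpha> J] \<open>v \<in> A\<close>] by blast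
    qed
  qed
  show ?thesis
    using assms(2)
  proof (induction u rule: A_induct)
    case (single \<alpha> i r)
    have "i 1 \<ge> 0" using single assms(1) by (auto simp: J_set_def)
    then have "i = 0(1 := int (nat (i 1)))" using J_key[OF single(2)] by simp
    then show ?case using mono[OF single(1)] by metis
  next
    case (add u u')
    then show ?case using A_add partial_add by metis
  qed
qed

lemma coboundary_if_polynomial_direction:
  assumes "l1 + l2 = 1" "\<psi> \<in> cocycles2 L"
  shows "\<psi> \<in> coboundaries2 L"
proof -
  interpret alg_cocycle C "op_mult l" op_scale "xd 0 0 0" \<psi>
    using assms(2) by unfold_locales
  have 1: "1 \<in> {1..l1 + l2 + l3}" using assms(1) by auto
  note wp = weyl_pair_coord[OF 1]
  show ?thesis
  proof (rule coboundary_criterion[OF wp])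
    fix k assume k: "k \<in> C" "br k (single 0 (coord 1)) = 0"
    have "k = single 0 (lookup k 0)"
      using 1 k by (intro centralizer_fun[of "coord 1" 1]) (auto simp: coord_A partial_coord)
    moreover obtain v where v: "v \<in> A" "partial 1 v = lookup k 0"
      using partial_surj[OF assms(1) C_lookup[OF k(1)]] by blast
    ultimately have "k = br (single (0(1 := 1)) 1) (single 0 v)"
      using br_d_fun[of 1 1 v] l_eq by simp
    then show "\<psi> (single 0 (coord 1)) k = 0"
      using psi_bracket_pair[OF wp, of "single 0 v"] br_fun_fun v coord_A[OF 1] by simp
  qed
qed

end

section \<open>Cohomology classes\<close>

lemma coboundary2_add: "coboundary2 L f + coboundary2 L g = coboundary2 L (\<lambda>x. f x + g x)"
  by (auto simp: coboundary2_def fun_eq_iff plus_fun_apply)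

lemma coboundary2_scale: "(\<lambda>u v. c * coboundary2 L f u v) = coboundary2 L (\<lambda>x. c * f x)"
  by (auto simp: coboundary2_def fun_eq_iff)

lemma linear_on_add: "linear_on L f \<Longrightarrow> linear_on L g \<Longrightarrow> linear_on L (\<lambda>x. f x + g x)"
  by (auto simp: linear_on_def algebra_simps)

lemma linear_on_scale: "linear_on L f \<Longrightarrow> linear_on L (\<lambda>x. c * f x)"
  by (auto simp: linear_on_def algebra_simps)

lemma coboundaries2_add:
  assumes "\<phi> \<in> coboundaries2 L" "\<psi> \<in> coboundaries2 L"
  shows "\<phi> + \<psi> \<in> coboundaries2 L"
proof -
  obtain f g where "linear_on L f" "\<phi> = coboundary2 L f" "linear_on L g" "\<psi> = coboundary2 L g"
    using assms by (auto simp: coboundaries2_def)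
  moreover from this have "linear_on L (\<lambda>x. f x + g x)" by (intro linear_on_add)
  ultimately show ?thesis by (auto simp: coboundaries2_def coboundary2_add)
qed

lemma coboundaries2_scale:
  assumes "\<phi> \<in> coboundaries2 L"
  shows "(\<lambda>u v. c * \<phi> u v) \<in> coboundaries2 L"
proof -
  obtain f where "linear_on L f" "\<phi> = coboundary2 L f"
    using assms by (auto simp: coboundaries2_def)
  moreover from this have "linear_on L (\<lambda>x. c * f x)" by (intro linear_on_scale)
  ultimately show ?thesis by (auto simp: coboundaries2_def coboundary2_scale)
qed

lemma coboundaries2_zero: "0 \<in> coboundaries2 L"
proof -
  have "linear_on L (\<lambda>x. 0)" by (simp add: linear_on_def)
  moreover have "coboundary2 L (\<lambda>x. 0) = 0" by (auto simp: coboundary2_def fun_ext_simps)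
  ultimately show ?thesis unfolding coboundaries2_def by (metis imageI mem_Collect_eq)
qed

lemma coboundaries2_uminus: "\<phi> \<in> coboundaries2 L \<Longrightarrow> - \<phi> \<in> coboundaries2 L"
  using coboundaries2_scale[of \<phi> L "- 1"] by (simp add: fun_Compl_def)

lemma coh_class_eq_iff: "coh_class L \<phi> = coh_class L \<psi> \<longleftrightarrow> \<phi> - \<psi> \<in> coboundaries2 L"
proof
  assume "coh_class L \<phi> = coh_class L \<psi>"
  moreover have "\<phi> \<in> coh_class L \<phi>"
    using coboundaries2_zero[of L] by (force simp: coh_class_def elt_set_plus_def)
  ultimately obtain \<chi> where "\<chi> \<in> coboundaries2 L" "\<phi> = \<psi> + \<chi>"
    by (auto simp: coh_class_def elt_set_plus_def)
  then show "\<phi> - \<psi> \<in> coboundaries2 L" by simp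
next
  assume *: "\<phi> - \<psi> \<in> coboundaries2 L"
  then have "- (\<phi> - \<psi>) \<in> coboundaries2 L" by (rule coboundaries2_uminus)
  then have **: "\<psi> - \<phi> \<in> coboundaries2 L" by simp
  have "\<exists>\<chi>'\<in>coboundaries2 L. \<phi> + \<chi> = \<psi> + \<chi>'" if "\<chi> \<in> coboundaries2 L" for \<chi>
    using coboundaries2_add[OF * that] by (intro bexI[of _ "\<phi> - \<psi> + \<chi>"]) simp_all
  moreover have "\<exists>\<chi>'\<in>coboundaries2 L. \<psi> + \<chi> = \<phi> + \<chi>'" if "\<chi> \<in> coboundaries2 L" for \<chi>
    using coboundaries2_add[OF ** that] by (intro bexI[of _ "\<psi> - \<phi> + \<chi>"]) simp_all
  ultimately show "coh_class L \<phi> = coh_class L \<psi>"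
    by (auto simp: coh_class_def elt_set_plus_def)
qed

lemma coh_class_add: "coh_class L \<phi> + coh_class L \<psi> = coh_class L (\<phi> + \<psi>)"
proof -
  have "coboundaries2 L + coboundaries2 L = coboundaries2 L"
  proof
    show "coboundaries2 L + coboundaries2 L \<subseteq> coboundaries2 L"
      by (auto simp: set_plus_def intro: coboundaries2_add)
    show "coboundaries2 L \<subseteq> coboundaries2 L + coboundaries2 L"
      using coboundaries2_zero[of L] by (rule set_zero_plus2)
  qed
  then show ?thesis
    by (simp add: coh_class_def set_plus_rearrange)
qed

lemma H2_scale_coh_class: "H2_scale L c (coh_class L \<phi>) = coh_class L (\<lambda>u v. c * \<phi> u v)"
proof
  show "H2_scale L c (coh_class L \<phi>) \<subseteq> coh_class L (\<lambda>u v. c * \<phi> u v)"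
  proof
    fix \<chi> assume "\<chi> \<in> H2_scale L c (coh_class L \<phi>)"
    then obtain \<eta> \<eta>' where *: "\<eta> \<in> coboundaries2 L" "\<eta>' \<in> coboundaries2 L"
        "\<chi> = (\<lambda>u v. c * (\<phi> + \<eta>) u v) + \<eta>'"
      by (auto simp: H2_scale_def coh_class_def elt_set_plus_def set_plus_def)
    have "\<chi> = (\<lambda>u v. c * \<phi> u v) + ((\<lambda>u v. c * \<eta> u v) + \<eta>')"
      unfolding *(3) by (auto simp: fun_ext_simps algebra_simps)
    then show "\<chi> \<in> coh_class L (\<lambda>u v. c * \<phi> u v)"
      using coboundaries2_add[OF coboundaries2_scale[OF *(1)] *(2)]
      unfolding coh_class_def elt_set_plus_def by blast
  qed
next
  show "coh_class L (\<lambda>u v. c * \<phi> u v) \<subseteq> H2_scale L c (coh_class L \<phi>)"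
  proof
    fix \<chi> assume "\<chi> \<in> coh_class L (\<lambda>u v. c * \<phi> u v)"
    then obtain \<eta> where *: "\<eta> \<in> coboundaries2 L" "\<chi> = (\<lambda>u v. c * \<phi> u v) + \<eta>"
      by (auto simp: coh_class_def elt_set_plus_def)
    have "\<phi> \<in> coh_class L \<phi>"
      using coboundaries2_zero[of L] by (force simp: coh_class_def elt_set_plus_def)
    then show "\<chi> \<in> H2_scale L c (coh_class L \<phi>)"
      using * unfolding H2_scale_def by (blast intro: set_plus_intro)
  qed
qed

lemma cocycles2_zero: "0 \<in> cocycles2 L"
  by (simp add: cocycles2_def linear_on_def zero_fun_apply)

lemma cocycles2D:
  assumes "\<phi> \<in> cocycles2 L"
  shows cocycles2_outside: "u \<notin> lie_carrier L \<or> v \<notin> lie_carrier L \<Longrightarrow> \<phi> u v = 0"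
    and cocycles2_linear_right: "u \<in> lie_carrier L \<Longrightarrow> linear_on L (\<lambda>v. \<phi> u v)"
    and cocycles2_linear_left: "v \<in> lie_carrier L \<Longrightarrow> linear_on L (\<lambda>u. \<phi> u v)"
    and cocycles2_antisym: "u \<in> lie_carrier L \<Longrightarrow> v \<in> lie_carrier L \<Longrightarrow> \<phi> u v = - \<phi> v u"
    and cocycles2_jacobi: "\<lbrakk>u \<in> lie_carrier L; v \<in> lie_carrier L; w \<in> lie_carrier L\<rbrakk> \<Longrightarrow>
      \<phi> (lie_bracket L u v) w + \<phi> (lie_bracket L v w) u + \<phi> (lie_bracket L w u) v = 0"
  using assms unfolding cocycles2_def by blast+

lemma cocycles2I:
  assumes "\<And>u v. u \<notin> lie_carrier L \<or> v \<notin> lie_carrier L \<Longrightarrow> \<phi> u v = 0"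
    and "\<And>u. u \<in> lie_carrier L \<Longrightarrow> linear_on L (\<lambda>v. \<phi> u v)"
    and "\<And>v. v \<in> lie_carrier L \<Longrightarrow> linear_on L (\<lambda>u. \<phi> u v)"
    and "\<And>u v. u \<in> lie_carrier L \<Longrightarrow> v \<in> lie_carrier L \<Longrightarrow> \<phi> u v = - \<phi> v u"
    and "\<And>u v w. \<lbrakk>u \<in> lie_carrier L; v \<in> lie_carrier L; w \<in> lie_carrier L\<rbrakk> \<Longrightarrow>
      \<phi> (lie_bracket L u v) w + \<phi> (lie_bracket L v w) u + \<phi> (lie_bracket L w u) v = 0"
  shows "\<phi> \<in> cocycles2 L"
  using assms unfolding cocycles2_def by blast

lemma cocycles2_add:
  assumes "\<phi> \<in> cocycles2 L" "\<psi> \<in> cocycles2 L"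
  shows "\<phi> + \<psi> \<in> cocycles2 L"
proof (rule cocycles2I, unfold plus_fun_apply)
  fix u v w assume uv: "u \<in> lie_carrier L" "v \<in> lie_carrier L"
  show "\<phi> u v + \<psi> u v = - (\<phi> v u + \<psi> v u)"
    using cocycles2_antisym[OF assms(1) uv] cocycles2_antisym[OF assms(2) uv] by simp
  assume w: "w \<in> lie_carrier L"
  show "\<phi> (lie_bracket L u v) w + \<psi> (lie_bracket L u v) w +
      (\<phi> (lie_bracket L v w) u + \<psi> (lie_bracket L v w) u) +
      (\<phi> (lie_bracket L w u) v + \<psi> (lie_bracket L w u) v) = 0"
    using arg_cong2[where f = "(+)", OF cocycles2_jacobi[OF assms(1) uv w] cocycles2_jacobi[OF assms(2) uv w]]
    by (simp add: add_ac)
next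
  fix u v assume "u \<notin> lie_carrier L \<or> v \<notin> lie_carrier L"
  then show "\<phi> u v + \<psi> u v = 0"
    using assms[THEN cocycles2_outside, of u v] by simp
next
  fix u assume "u \<in> lie_carrier L"
  from assms[THEN cocycles2_linear_right, OF this]
  show "linear_on L (\<lambda>v. \<phi> u v + \<psi> u v)" by (rule linear_on_add)
next
  fix v assume "v \<in> lie_carrier L"
  from assms[THEN cocycles2_linear_left, OF this]
  show "linear_on L (\<lambda>u. \<phi> u v + \<psi> u v)" by (rule linear_on_add)
qed

lemma cocycles2_scale:
  assumes "\<phi> \<in> cocycles2 L"
  shows "(\<lambda>u v. c * \<phi> u v) \<in> cocycles2 L"
proof (rule cocycles2I)
  fix u v w assume uv: "u \<in> lie_carrier L" "v \<in> lie_carrier L"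
  show "c * \<phi> u v = - (c * \<phi> v u)"
    using cocycles2_antisym[OF assms uv] by simp
  assume w: "w \<in> lie_carrier L"
  show "c * \<phi> (lie_bracket L u v) w + c * \<phi> (lie_bracket L v w) u + c * \<phi> (lie_bracket L w u) v = 0"
    using arg_cong[where f = "(*) c", OF cocycles2_jacobi[OF assms uv w]] by (simp add: algebra_simps)
next
  fix u v assume "u \<notin> lie_carrier L \<or> v \<notin> lie_carrier L"
  then show "c * \<phi> u v = 0"
    using assms[THEN cocycles2_outside, of u v] by simp
next
  fix u assume "u \<in> lie_carrier L"
  from cocycles2_linear_right[OF assms this]
  show "linear_on L (\<lambda>v. c * \<phi> u v)" by (rule linear_on_scale)
next
  fix v assume "v \<in> lie_carrier L"
  from cocycles2_linear_left[OF assms this]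
  show "linear_on L (\<lambda>u. c * \<phi> u v)" by (rule linear_on_scale)
qed

lemma cocycles2_diff:
  assumes "\<phi> \<in> cocycles2 L" "\<psi> \<in> cocycles2 L"
  shows "\<phi> - \<psi> \<in> cocycles2 L"
proof -
  have "\<phi> + (\<lambda>u v. (- 1) * \<psi> u v) \<in> cocycles2 L"
    using assms by (intro cocycles2_add cocycles2_scale)
  moreover have "\<phi> + (\<lambda>u v. (- 1) * \<psi> u v) = \<phi> - \<psi>"
    by (simp add: fun_ext_simps)
  ultimately show ?thesis by simp
qed

lemma H2_trivial:
  assumes "cocycles2 L \<subseteq> coboundaries2 L"
  shows "H2 L = {coh_class L 0}"
proof -
  have "coh_class L \<phi> = coh_class L 0" if "\<phi> \<in> cocycles2 L" for \<phi>
    using assms that by (auto simp: coh_class_eq_iff)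
  then have "coh_class L ` cocycles2 L \<subseteq> {coh_class L 0}" by blast
  moreover have "coh_class L 0 \<in> coh_class L ` cocycles2 L" using cocycles2_zero by blast
  ultimately show ?thesis unfolding H2_def by blast
qed

context assoc_alg
begin

text \<open>The Jacobi sum is the cyclic sum for (a, b, c) minus that for (b, a, c). Linearity in
  the second argument comes from antisymmetry, and the extension by 0 is the normalization in
  \<open>cocycles2\<close>.\<close>

lemma cyclic_imp_cocycle:
  assumes add: "\<And>a b c. \<lbrakk>a \<in> C; b \<in> C; c \<in> C\<rbrakk> \<Longrightarrow>
      \<phi> (a + b) c = \<phi> a c + \<phi> b c"
    and scale: "\<And>r a b. a \<in> C \<Longrightarrow> b \<in> C \<Longrightarrow> \<phi> (scl r a) b = r * \<phi> a b"
    and anti: "\<And>a b. a \<in> C \<Longrightarrow> b \<in> C \<Longrightarrow> \<phi> a b = - \<phi> b a"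
    and cyclic: "\<And>a b c. \<lbrakk>a \<in> C; b \<in> C; c \<in> C\<rbrakk> \<Longrightarrow>
      \<phi> (a \<bullet> b) c + \<phi> (b \<bullet> c) a + \<phi> (c \<bullet> a) b = 0"
  shows "(\<lambda>a b. if a \<in> C \<and> b \<in> C then \<phi> a b else 0) \<in> cocycles2 L"
proof -
  have diff: "\<phi> (a - b) c = \<phi> a c - \<phi> b c" if "a \<in> C" "b \<in> C" "c \<in> C" for a b c
    using add[of "a - b" b c] that by simp
  have jacobi: "\<phi> (br a b) c + \<phi> (br b c) a + \<phi> (br c a) b = 0" if "a \<in> C" "b \<in> C" "c \<in> C" for a b c
  proof -
    have "\<phi> (br a b) c + \<phi> (br b c) a + \<phi> (br c a) b =
        (\<phi> (a \<bullet> b) c + \<phi> (b \<bullet> c) a + \<phi> (c \<bullet> a) b) - (\<phi> (b \<bullet> a) c + \<phi> (a \<bullet> c) b + \<phi> (c \<bullet> b) a)"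
      using that by (simp add: br_def diff)
    then show ?thesis using cyclic that by simp
  qed
  have add': "\<phi> a (b + c) = \<phi> a b + \<phi> a c" if "a \<in> C" "b \<in> C" "c \<in> C" for a b c
    using anti[of a "b + c"] anti[of a b] anti[of a c] add[of b c a] that by simp
  have scale': "\<phi> a (scl r b) = r * \<phi> a b" if "a \<in> C" "b \<in> C" for a b r
    using anti[of a "scl r b"] anti[of a b] scale[of b a r] that by simp
  show ?thesis
  proof (rule cocycles2I, unfold L_simps)
    fix u v assume "u \<in> C" "v \<in> C"
    then show "(if u \<in> C \<and> v \<in> C then \<phi> u v else 0) = - (if v \<in> C \<and> u \<in> C then \<phi> v u else 0)"
      using anti[of u v] by simp
  next
    fix u v w assume "u \<in> C" "v \<in> C" "w \<in> C"
    then show "(if br u v \<in> C \<and> w \<in> C then \<phi> (br u v) w else 0) +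
        (if br v w \<in> C \<and> u \<in> C then \<phi> (br v w) u else 0) +
        (if br w u \<in> C \<and> v \<in> C then \<phi> (br w u) v else 0) = 0"
      using jacobi[of u v w] by simp
  next
    fix u assume "u \<in> C"
    then show "linear_on L (\<lambda>v. if u \<in> C \<and> v \<in> C then \<phi> u v else 0)"
      using add'[of u] scale'[of u] by (simp add: linear_on_def)
  next
    fix v assume "v \<in> C"
    then show "linear_on L (\<lambda>u. if u \<in> C \<and> v \<in> C then \<phi> u v else 0)"
      using add[of _ _ v] scale[of _ v] by (simp add: linear_on_def)
  qed auto
qed

end

section \<open>Residue cocycles\<close>

declare One_nat_def [simp del]

text \<open>For k < 0 the convention decides: at k = -1 the left side is 0 by definition and the
  right side has the factor k + 1 = 0; below that both divided powers are 0.\<close>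

lemma divided_power_Suc:
  "\<gamma> * divided_power \<gamma> k = of_int (k + 1) * divided_power \<gamma> (k + 1)"
proof (cases "k \<ge> 0")
  case True
  then obtain n where "k = int n" by (metis nonneg_int_cases)
  moreover have "nat (int n + 1) = Suc n" by simp
  ultimately show ?thesis
    by (simp add: divided_power_def field_simps del: of_nat_Suc) (simp add: algebra_simps)
next
  case False
  then show ?thesis by (cases "k = - 1") (auto simp: divided_power_def)
qed

section \<open>Residues and the pairing of operators\<close>

definition weighted_sum :: "('k \<Rightarrow> 'a) \<Rightarrow> ('k \<Rightarrow>\<^sub>0 'a::comm_ring_1) \<Rightarrow> 'a" where
  "weighted_sum w u = (\<Sum>k\<in>keys u. lookup u k * w k)"

lemma weighted_sum_add: "weighted_sum w (u + v) = weighted_sum w u + weighted_sum w v"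
  unfolding weighted_sum_def by (rule setsum_keys_plus_distrib) (auto simp: algebra_simps)

lemma weighted_sum_single [simp]: "weighted_sum w (single k r) = r * w k"
  by (simp add: weighted_sum_def)

lemma weighted_sum_zero [simp]: "weighted_sum w 0 = 0"
  by (simp add: weighted_sum_def)

lemma weighted_sum_scale:
  fixes u :: "('k::monoid_add) \<Rightarrow>\<^sub>0 ('a::comm_ring_1)"
  shows "weighted_sum w (single 0 r * u) = r * weighted_sum w u"
  by (rule additive_ext[where a = u])
    (auto simp: weighted_sum_add distrib_left mult_single)

text \<open>The functional \<open>weighted_sum (residue_weight b)\<close> kills all derivatives; it takes the value \<open>b \<gamma>\<close>
  at \<open>x\<^bsup>\<gamma>,-1\<^esup>\<close> and is a residue when \<open>b\<close> is supported at \<open>0\<close>.\<close>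

definition residue_weight ::
    "((nat \<Rightarrow> 'a) \<Rightarrow> 'a) \<Rightarrow> (nat \<Rightarrow> 'a::field_char_0) \<times> (nat \<Rightarrow> int) \<Rightarrow> 'a" where
  "residue_weight b = (\<lambda>(\<gamma>, i). b \<gamma> * divided_power (\<gamma> 1) (- 1 - i 1))"

abbreviation residue :: "((nat \<Rightarrow> 'a) \<Rightarrow> 'a) \<Rightarrow> 'a::field_char_0 gen_fun \<Rightarrow> 'a" where
  "residue b \<equiv> weighted_sum (residue_weight b)"

text \<open>The weight at x^(\<gamma>,i) is b \<gamma> times the coefficient of t^(-1) in t^i
  exp(\<gamma> t), and derivatives have residue 0. In formulas, \<open>divided_power_Suc\<close> at
  k = -1 - i makes the two terms of \<partial> x^(\<gamma>,i) cancel.\<close>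

lemma residue_partial: "residue b (partial 1 u) = 0"
proof (rule additive_ext[where a = u and g = "\<lambda>_. 0"])
  fix k :: "(nat \<Rightarrow> 'a) \<times> (nat \<Rightarrow> int)" and r
  obtain \<alpha> i where k: "k = (\<alpha>, i)" by (cases k)
  have "\<alpha> 1 * divided_power (\<alpha> 1) (- 1 - i 1) = - of_int (i 1) * divided_power (\<alpha> 1) (- i 1)"
    using divided_power_Suc[of "\<alpha> 1" "- 1 - i 1"] by simp
  then have "r * b \<alpha> * (\<alpha> 1 * divided_power (\<alpha> 1) (- 1 - i 1)) =
      r * b \<alpha> * (- of_int (i 1) * divided_power (\<alpha> 1) (- i 1))"
    by (rule arg_cong)
  then show "residue b (partial 1 (single k r)) = 0"
    by (simp add: k partial_single weighted_sum_add residue_weight_def algebra_simps)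
qed (simp_all add: weighted_sum_add partial_add)

lemma residue_partial_pow_mult:
  "residue b ((partial 1 ^^ n) u * v) = (- 1) ^ n * residue b (u * (partial 1 ^^ n) v)"
proof (induction n arbitrary: v)
  case (Suc n)
  have "residue b (partial 1 ((partial 1 ^^ n) u * v)) = 0" by (rule residue_partial)
  then have "residue b ((partial 1 ^^ Suc n) u * v) = - residue b ((partial 1 ^^ n) u * partial 1 v)"
    by (simp add: partial_mult weighted_sum_add eq_neg_iff_add_eq_0)
  also have "\<dots> = - ((- 1) ^ n * residue b (u * (partial 1 ^^ n) (partial 1 v)))"
    by (simp only: Suc.IH)
  finally show ?case by (simp add: funpow_swap1)
qed simp

text \<open>The Kac--Peterson cocycle in a Laurent variable is m! n! / (m + n + 1)! Res(f^(n+1)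
  g^(m)) at (f \<partial>^m, g \<partial>^n), the exponents of f and g counting derivatives. Moving
  all derivatives to f produces the sign (-1)^m.\<close>

definition pairing_coeff :: "nat \<Rightarrow> nat \<Rightarrow> 'a::field_char_0" where
  "pairing_coeff m n = (- 1) ^ m * fact m * fact n / fact (m + n + 1)"

text \<open>Kept with values in functions, so that one pairing serves every residue weight and its
  finitely many exponents bound the \<gamma> that contribute to a given pair of operators.\<close>

definition fun_pairing :: "'a::field_char_0 gen_op \<Rightarrow> 'a gen_op \<Rightarrow> 'a gen_fun" where
  "fun_pairing a b = (\<Sum>\<mu>\<in>keys a. \<Sum>\<nu>\<in>keys b. single 0 (pairing_coeff (\<mu> 1) (\<nu> 1)) *
    ((partial 1 ^^ (\<mu> 1 + \<nu> 1 + 1)) (lookup a \<mu>) * lookup b \<nu>))"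

lemma funpow_partial_add: "(partial p ^^ n) (u + v) = (partial p ^^ n) u + (partial p ^^ n) v"
  by (induction n) (auto simp: partial_add)

lemma funpow_partial_zero [simp]: "(partial p ^^ n) 0 = 0"
  by (induction n) auto

lemma funpow_partial_scale: "(partial p ^^ n) (single 0 r * u) = single 0 r * (partial p ^^ n) u"
  by (induction n) (auto simp: partial_mult)

lemma fun_pairing_add_left: "fun_pairing (a + a') b = fun_pairing a b + fun_pairing a' b"
  unfolding fun_pairing_def
  by (rule setsum_keys_plus_distrib) (auto simp: funpow_partial_add partial_add algebra_simps sum.distrib)

lemma fun_pairing_add_right: "fun_pairing a (b + b') = fun_pairing a b + fun_pairing a b'"
proof -
  have "(\<Sum>\<nu>\<in>keys (b + b'). single 0 (pairing_coeff m (\<nu> 1)) * ((partial 1 ^^ (m + \<nu> 1 + 1)) u * lookup (b + b') \<nu>)) =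
     (\<Sum>\<nu>\<in>keys b. single 0 (pairing_coeff m (\<nu> 1)) * ((partial 1 ^^ (m + \<nu> 1 + 1)) u * lookup b \<nu>)) +
     (\<Sum>\<nu>\<in>keys b'. single 0 (pairing_coeff m (\<nu> 1)) * ((partial 1 ^^ (m + \<nu> 1 + 1)) u * lookup b' \<nu>))"
    for m u
    by (rule setsum_keys_plus_distrib) (auto simp: algebra_simps)
  then show ?thesis by (simp add: fun_pairing_def sum.distrib)
qed

lemma fun_pairing_single:
  "fun_pairing (single \<mu> u) (single \<nu> v) =
    single 0 (pairing_coeff (\<mu> 1) (\<nu> 1)) * ((partial 1 ^^ (\<mu> 1 + \<nu> 1 + 1)) u * v)"
  by (cases "u = 0"; cases "v = 0") (simp_all add: fun_pairing_def)

definition pairing :: "((nat \<Rightarrow> 'a) \<Rightarrow> 'a) \<Rightarrow> 'a::field_char_0 gen_op \<Rightarrow> 'a gen_op \<Rightarrow> 'a" where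
  "pairing w a b = residue w (fun_pairing a b)"

lemma pairing_add_left: "pairing w (a + a') b = pairing w a b + pairing w a' b"
  by (simp add: pairing_def fun_pairing_add_left weighted_sum_add)

lemma pairing_add_right: "pairing w a (b + b') = pairing w a b + pairing w a b'"
  by (simp add: pairing_def fun_pairing_add_right weighted_sum_add)

lemma pairing_zero [simp]: "pairing w 0 b = 0" "pairing w a 0 = 0"
  by (simp_all add: pairing_def fun_pairing_def)

lemma pairing_single:
  "pairing w (single \<mu> u) (single \<nu> v) =
    pairing_coeff (\<mu> 1) (\<nu> 1) * residue w ((partial 1 ^^ (\<mu> 1 + \<nu> 1 + 1)) u * v)"
  by (simp only: pairing_def fun_pairing_single weighted_sum_scale)

text \<open>Moving the m + n + 1 derivatives to the other factor costs (-1)^(m+n+1), which turns the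
  sign (-1)^m of \<open>pairing_coeff\<close> into -(-1)^n.\<close>

lemma pairing_antisym: "pairing w a b = - pairing w b a"
proof (rule additive_ext[where a = a])
  fix \<mu> :: "nat \<Rightarrow> nat" and u
  show "pairing w (single \<mu> u) b = - pairing w b (single \<mu> u)"
  proof (rule additive_ext[where a = b])
    fix \<nu> :: "nat \<Rightarrow> nat" and v
    define m n where "m = \<mu> 1" and "n = \<nu> 1"
    have "(- 1) ^ m * (- 1) ^ (m + n + 1) = (- ((- 1) ^ n) :: 'a)"
      by (simp add: power_add flip: power_mult_distrib)
    moreover have "pairing_coeff m n * (- 1) ^ (m + n + 1) =
        ((- 1) ^ m * (- 1) ^ (m + n + 1)) * (fact m * fact n / fact (m + n + 1) :: 'a)"
      by (simp only: pairing_coeff_def divide_inverse mult_ac)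
    moreover have "- ((- 1) ^ n) * (fact m * fact n / fact (m + n + 1)) = (- pairing_coeff n m :: 'a)"
      by (simp only: pairing_coeff_def divide_inverse add.commute[of n m] mult_minus_left mult_minus_right mult_ac)
    ultimately have "pairing_coeff m n * (- 1) ^ (m + n + 1) = (- pairing_coeff n m :: 'a)"
      by (simp only:)
    then show "pairing w (single \<mu> u) (single \<nu> v) = - pairing w (single \<nu> v) (single \<mu> u)"
      unfolding pairing_single residue_partial_pow_mult[of w "\<mu> 1 + \<nu> 1 + 1"] m_def n_def
      by (simp only: mult.assoc[symmetric]) (simp add: add.commute mult.commute[of u])
  qed (simp_all add: pairing_add_left pairing_add_right)
qed (simp_all add: pairing_add_left pairing_add_right)

lemma pairing_scale: "pairing w (op_scale r a) b = r * pairing w a b"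
  unfolding op_scale_eq_mult
proof (rule additive_ext[where a = a])
  fix \<mu> :: "nat \<Rightarrow> nat" and u
  show "pairing w (single 0 (single 0 r) * single \<mu> u) b = r * pairing w (single \<mu> u) b"
  proof (rule additive_ext[where a = b])
    fix \<nu> :: "nat \<Rightarrow> nat" and v
    show "pairing w (single 0 (single 0 r) * single \<mu> u) (single \<nu> v) = r * pairing w (single \<mu> u) (single \<nu> v)"
      by (simp only: mult_single add_0 pairing_single funpow_partial_scale mult.assoc weighted_sum_scale
          mult.left_commute)
  qed (simp_all add: pairing_add_right algebra_simps)
qed (simp_all add: pairing_add_left algebra_simps)

context gen_weyl_1
begin

lemma C_induct [consumes 1, case_names single add]:
  assumes "a \<in> C"
    and "\<And>m u. u \<in> A \<Longrightarrow> P (single (0(1 := m)) u)"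
    and "\<And>a b. \<lbrakk>a \<in> C; b \<in> C; P a; P b\<rbrakk> \<Longrightarrow>
      P (a + b)"
  shows "P a"
proof -
  have single: "single \<mu> (lookup a \<mu>) \<in> C \<and> P (single \<mu> (lookup a \<mu>))" if "\<mu> \<in> keys a" for \<mu>
    using assms(2)[of "lookup a \<mu>" "\<mu> 1"] C_key[OF assms(1) that] C_lookup[OF assms(1), of \<mu>]
      C_supp[OF assms(1) that] by (metis C_single)
  have P0: "P 0" using assms(2)[of 0 0] by simp
  have "(\<Sum>\<mu>\<in>X. single \<mu> (lookup a \<mu>)) \<in> C \<and> P (\<Sum>\<mu>\<in>X. single \<mu> (lookup a \<mu>))"
    if "X \<subseteq> keys a" for X
    using finite_subset[OF that finite_keys] that
    by (induction X rule: finite_induct) (auto simp: single P0 intro: assms(3))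
  from this[of "keys a"] show ?thesis by (simp add: sum_single)
qed

lemma C_single_1: "u \<in> A \<Longrightarrow> single (0(1 := m)) u \<in> C"
  by (rule C_single) (auto simp: l_eq zero_fun_apply)

lemma mul_single:
  assumes "u \<in> A"
  shows "op_mult l (single (0(1 := m)) u) (single (0(1 := n)) v) =
    (\<Sum>k\<le>m. single (0(1 := m + n - k)) (of_nat (m choose k) * (u * (partial 1 ^^ k) v)))"
proof -
  have idx: "(0 :: nat \<Rightarrow> nat)(1 := n) + 0(1 := m - k) = 0(1 := m + n - k)" if "k \<le> m" for k
    using that by (auto simp: fun_ext_simps)
  have *: "(\<Sum>k\<le>m. single 0 u * single (0(1 := n) + 0(1 := m - k)) (of_nat (m choose k) * (partial 1 ^^ k) v)) =
      (\<Sum>k\<le>m. single (0(1 := m + n - k)) (of_nat (m choose k) * (u * (partial 1 ^^ k) v)) :: 'a gen_op)"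
    by (intro sum.cong refl) (simp only: idx atMost_iff mult_single add_0 mult.left_commute)
  have "op_mult l (single (0(1 := m)) u) (single (0(1 := n)) v) =
      single 0 u * (d_left 1 ^^ m) (single (0(1 := n)) v)"
    unfolding op_mult_C[OF C_single_1[OF assms]] op_act_single by (simp add: l_eq One_nat_def)
  also have "\<dots> = (\<Sum>k\<le>m. single 0 u * single (0(1 := n) + 0(1 := m - k)) (of_nat (m choose k) * (partial 1 ^^ k) v))"
    by (simp only: funpow_d_left_single sum_distrib_left)
  finally show ?thesis unfolding * .
qed

lemma lookup_mul_zero:
  assumes "u \<in> A"
  shows "lookup (op_mult l (single (0(1 := m)) u) (single (0(1 := n)) v)) 0 =
    (if n = 0 then u * (partial 1 ^^ m) v else 0)"
proof -
  have "lookup (single ((0 :: nat \<Rightarrow> nat)(1 := m + n - k)) f) 0 = (if n = 0 \<and> k = m then f else 0)" if "k \<le> m" for k and f :: "'a gen_fun"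
  proof -
    have eq: "0(1 := m + n - k) = (0 :: nat \<Rightarrow> nat) \<longleftrightarrow> n = 0 \<and> k = m"
      using that by (auto simp: fun_ext_simps split: if_splits)
    show ?thesis by (simp only: lookup_single when_def eq)
  qed
  then have "lookup (op_mult l (single (0(1 := m)) u) (single (0(1 := n)) v)) 0 =
      (\<Sum>k\<le>m. if n = 0 \<and> k = m then of_nat (m choose k) * (u * (partial 1 ^^ k) v) else 0)"
    unfolding mul_single[OF assms] lookup_sum by (intro sum.cong) auto
  also have "\<dots> = (if n = 0 then u * (partial 1 ^^ m) v else 0)"
    by (cases "n = 0") (simp_all add: sum.delta)
  finally show ?thesis .
qed

end

section \<open>The Laurent direction: cyclicity and classification of residue cocycles\<close>

locale gen_weyl_3 = gen_weyl_1 +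
  assumes l3_eq: "l3 = 1"
begin

lemma one_coord: "1 \<in> {1..l1 + l2 + l3}"
  using l3_eq by simp

lemma coord_1 [simp]: "coord 1 \<in> A"
  by (rule coord_A[OF one_coord])

abbreviation t :: "'a gen_op" where "t \<equiv> single 0 (coord 1)"

lemma t_C: "t \<in> C" by simp

lemma weyl_pair_t: "weyl_pair t (single (0(1 := 1)) 1)"
  by (rule weyl_pair_coord[OF one_coord])

text \<open>As \<partial>(t) = 1, only k = 0 and k = 1 survive in the Leibniz sum, and the term k =
  0 is cancelled by the opposite product. For m = 0 the truncated index m - 1 is harmless, its
  coefficient being 0.\<close>

lemma br_single_t:
  assumes "u \<in> A"
  shows "br (single (0(1 := m)) u) t = single (0(1 := m - 1)) (of_nat m * u)"
proof -
  have z: "(0 :: nat \<Rightarrow> nat)(1 := 0) = 0" by (auto simp: fun_ext_simps)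
  have p: "(partial 1 ^^ k) (coord 1) = (if k = 0 then coord 1 else if k = 1 then 1 else 0)" for k
    by (induction k) (auto simp: partial_coord)
  have "op_mult l (single (0(1 := m)) u) t =
      (\<Sum>k\<le>m. single (0(1 := m - k)) (of_nat (m choose k) * (u * (partial 1 ^^ k) (coord 1))))"
    using mul_single[OF assms, of m 0 "coord 1"] by (simp only: z add_0_right)
  also have "\<dots> = (\<Sum>k\<in>{0, 1} \<inter> {..m}. single (0(1 := m - k)) (of_nat (m choose k) * (u * (partial 1 ^^ k) (coord 1))))"
    by (rule sum.mono_neutral_right) (auto simp: p)
  also have "\<dots> = single (0(1 := m)) (u * coord 1) + single (0(1 := m - 1)) (of_nat m * u)"
  proof (cases "m = 0")
    case True
    then show ?thesis by simp
  next
    case False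
    then have "{0, 1} \<inter> {..m} = {0, 1}" by auto
    then show ?thesis by (simp add: p partial_coord choose_one del: Int_insert_left)
  qed
  finally show ?thesis
    unfolding br_def mul_fun[OF coord_1] by (simp add: mult_single mult.commute)
qed

lemma lookup_br_zero_add:
  assumes "a \<in> C" "b \<in> C" "c \<in> C"
  shows "lookup (br (a + b) c) 0 = lookup (br a c) 0 + lookup (br b c) 0"
    "lookup (br c (a + b)) 0 = lookup (br c a) 0 + lookup (br c b) 0"
  using assms by (simp_all add: br_add_left br_add_right lookup_add)

text \<open>The pairing is not invariant under [-, t]; this measures the failure. Since m c(m-1, n)
  + n c(m, n-1) = 0 for c = \<open>pairing_coeff\<close> and m, n \<ge> 1, only pairs with m = 0 or
  n = 0 contribute, and up to integration by parts they give the residue of the order 0 part of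
  [b, a].\<close>

lemma pairing_derivation:
  assumes "a \<in> C" "b \<in> C"
  shows "pairing w (br a t) b + pairing w a (br b t) = residue w (lookup (br b a) 0)"
  using assms
proof (induction a rule: C_induct)
  case (single m u)
  note uA = single(1)
  from \<open>b \<in> C\<close> show ?case
  proof (induction b rule: C_induct)
    case (single n v)
    note vA = single(1)
    have val: "((0 :: nat \<Rightarrow> nat)(1 := k)) 1 = k" for k by simp
    have coeff_Suc: "of_nat (Suc j) * pairing_coeff j n = (- 1) ^ j * fact (Suc j) * fact n / (fact (Suc j + n) :: 'a)"
        "of_nat (Suc j) * pairing_coeff n j = (- 1) ^ n * fact (Suc j) * fact n / (fact (Suc j + n) :: 'a)" for j n
    proof -
      have "j + n + 1 = Suc j + n" "n + j + 1 = Suc j + n" by simp_all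
      then show "of_nat (Suc j) * pairing_coeff j n = (- 1) ^ j * fact (Suc j) * fact n / (fact (Suc j + n) :: 'a)"
          "of_nat (Suc j) * pairing_coeff n j = (- 1) ^ n * fact (Suc j) * fact n / (fact (Suc j + n) :: 'a)"
        by (simp_all only: pairing_coeff_def fact_Suc[of j] divide_inverse mult_ac)
    qed
    have of_nat_mult: "of_nat k * f = single 0 (of_nat k) * f" for k and f :: "'a gen_fun"
      by simp
    have residue_of_nat: "residue w (of_nat k * f) = of_nat k * residue w f" for k f
      by (simp only: of_nat_mult weighted_sum_scale)
    have left: "pairing w (br (single (0(1 := m)) u) t) (single (0(1 := n)) v) =
      (if m = 0 then 0 else (- 1) ^ (m - 1) * fact m * fact n / fact (m + n) *
        residue w ((partial 1 ^^ (m + n)) u * v))"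
    proof (cases m)
      case (Suc j)
      have "pairing w (br (single (0(1 := m)) u) t) (single (0(1 := n)) v) =
          (of_nat (Suc j) * pairing_coeff j n) * residue w ((partial 1 ^^ (j + n + 1)) u * v)"
        unfolding br_single_t[OF uA] pairing_single val of_nat_mult funpow_partial_scale mult.assoc
          weighted_sum_scale Suc by (simp add: mult.left_commute)
      moreover have "m + n = j + n + 1" "Suc j + n = j + n + 1" using Suc by simp_all
      ultimately show ?thesis unfolding coeff_Suc using Suc by (simp only:) simp
    qed (unfold br_single_t[OF uA], simp)
    have right: "pairing w (single (0(1 := m)) u) (br (single (0(1 := n)) v) t) =
      (if n = 0 then 0 else (- 1) ^ m * fact m * fact n / fact (m + n) *
        residue w ((partial 1 ^^ (m + n)) u * v))"
    proof (cases n)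
      case (Suc j)
      have "pairing w (single (0(1 := m)) u) (br (single (0(1 := n)) v) t) =
          (of_nat (Suc j) * pairing_coeff m j) * residue w ((partial 1 ^^ (m + j + 1)) u * v)"
        unfolding br_single_t[OF vA] pairing_single val of_nat_mult
          mult.left_commute[of _ "single 0 (of_nat n)"] weighted_sum_scale Suc
        by (simp add: mult.left_commute residue_of_nat del: of_nat_Suc)
      moreover have "m + n = m + j + 1" "Suc j + m = m + j + 1" using Suc by simp_all
      ultimately show ?thesis unfolding coeff_Suc using Suc
        by (simp only:) (simp add: mult.commute mult.left_commute del: fact_Suc funpow.simps)
    qed (unfold br_single_t[OF vA], simp)
    have "residue w (lookup (br (single (0(1 := n)) v) (single (0(1 := m)) u)) 0) =
        (if m = 0 then residue w (v * (partial 1 ^^ n) u) else 0) -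
        (if n = 0 then residue w (u * (partial 1 ^^ m) v) else 0)"
      unfolding br_def lookup_minus lookup_mul_zero[OF uA] lookup_mul_zero[OF vA]
      by (simp add: additive_diff[of "residue w", OF weighted_sum_add])
    also have "residue w (u * (partial 1 ^^ m) v) = (- 1) ^ m * residue w ((partial 1 ^^ m) u * v)"
      unfolding residue_partial_pow_mult by (simp flip: mult.assoc power_mult_distrib)
    finally have val: "residue w (lookup (br (single (0(1 := n)) v) (single (0(1 := m)) u)) 0) =
        (if m = 0 then residue w (v * (partial 1 ^^ n) u) else 0) -
        (if n = 0 then (- 1) ^ m * residue w ((partial 1 ^^ m) u * v) else 0)" .
    show ?case
      unfolding left right val
      by (cases m; cases n) (simp_all add: mult.commute[of v] del: fact_Suc funpow.simps)
  next
    case (add b b')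
    show ?case
      unfolding br_add_left[OF add(1,2) t_C] pairing_add_right
        lookup_br_zero_add(1)[OF add(1,2) C_single_1[OF uA]] weighted_sum_add
      by (simp only: add.IH[symmetric]) (simp only: add_ac)
  qed
next
  case (add a a')
  show ?case
    unfolding br_add_left[OF add(1,2) t_C] pairing_add_left
      lookup_br_zero_add(2)[OF add(1,2) \<open>b \<in> C\<close>] weighted_sum_add
    by (simp only: add.IH[OF \<open>b \<in> C\<close>, symmetric]) (simp only: add_ac)
qed

text \<open>In the cyclic sum Z the failures from \<open>pairing_derivation\<close> add up to the
  residue of the order 0 part of [c, ab] + [a, bc] + [b, ca] = 0, so Z is invariant under [-, t].
  Writing a = [a', t] moves the bracket onto b or c, and induction on the sum of their nilpotency
  indices ends with a zero argument.\<close>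

lemma pairing_cyclic:
  assumes "a \<in> C" "b \<in> C" "c \<in> C"
  shows "pairing w (op_mult l a b) c + pairing w (op_mult l b c) a + pairing w (op_mult l c a) b = 0"
proof -
  define Z where "Z a b c = pairing w (op_mult l a b) c + pairing w (op_mult l b c) a +
    pairing w (op_mult l c a) b" for a b c
  have derivation: "Z (br a t) b c + Z a (br b t) c + Z a b (br c t) = 0"
    if C: "a \<in> C" "b \<in> C" "c \<in> C" for a b c
  proof -
    have "Z (br a t) b c + Z a (br b t) c + Z a b (br c t) =
        (pairing w (br (op_mult l a b) t) c + pairing w (op_mult l a b) (br c t)) +
        (pairing w (br (op_mult l b c) t) a + pairing w (op_mult l b c) (br a t)) +
        (pairing w (br (op_mult l c a) t) b + pairing w (op_mult l c a) (br b t))"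
      using C by (simp add: Z_def br_mul_left pairing_add_left)
    also have "\<dots> = residue w (lookup (br c (op_mult l a b) + br a (op_mult l b c) + br b (op_mult l c a)) 0)"
      using C by (simp add: pairing_derivation lookup_add weighted_sum_add)
    also have "br c (op_mult l a b) + br a (op_mult l b c) + br b (op_mult l c a) = 0"
      using C by (simp add: br_def mul_assoc)
    finally show ?thesis by simp
  qed
  have "Z a b c = 0"
    if "a \<in> C" "b \<in> C" "c \<in> C" "(ad t ^^ p) b = 0" "(ad t ^^ q) c = 0" for a b c p q
    using that
  proof (induction "p + q" arbitrary: a b c p q rule: less_induct)
    case less
    show ?case
    proof (cases "p = 0 \<or> q = 0")
      case True
      then have "b = 0 \<or> c = 0" using less.prems by auto
      then show ?thesis using less.prems by (auto simp: Z_def)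
    next
      case False
      then obtain p' q' where pq: "p = Suc p'" "q = Suc q'" by (metis not0_implies_Suc)
      obtain a' where a': "a' \<in> C" "br a' t = a" using weyl_pair_surj[OF weyl_pair_t less.prems(1)] by blast
      have nil: "(ad t ^^ p') (br b t) = 0" "(ad t ^^ q') (br c t) = 0"
        using less.prems(4,5) by (simp_all only: pq funpow_Suc_right comp_def)
      have "Z a' (br b t) c = 0"
        using less.prems a' t_C nil pq by (intro less.hyps[of p' q]) simp_all
      moreover have "Z a' b (br c t) = 0"
        using less.prems a' t_C nil pq by (intro less.hyps[of p q']) simp_all
      ultimately show ?thesis using derivation[of a' b c] a' less.prems by simp
    qed
  qed
  moreover obtain p q where "(ad t ^^ p) b = 0" "(ad t ^^ q) c = 0"
    using weyl_pair_t assms unfolding weyl_pair_def ad_nilpotent_def by blast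
  ultimately show ?thesis using assms unfolding Z_def by blast
qed

definition residue_cocycle :: "((nat \<Rightarrow> 'a) \<Rightarrow> 'a) \<Rightarrow> 'a gen_op \<Rightarrow> 'a gen_op \<Rightarrow> 'a" where
  "residue_cocycle w a b = (if a \<in> C \<and> b \<in> C then pairing w a b else 0)"

lemma residue_cocycle_cocycles2: "residue_cocycle w \<in> cocycles2 L"
  unfolding residue_cocycle_def[abs_def]
  by (rule cyclic_imp_cocycle) (auto simp: pairing_add_left pairing_scale intro: pairing_antisym pairing_cyclic)

text \<open>Leibniz rule for an exponential times t^i, with i possibly negative. The product
  binom(n, s) [i]_s is written as n! binom(i, s) / (n - s)!, so that n! cancels against
  \<open>pairing_coeff\<close>.\<close>

lemma funpow_partial_single:
  fixes \<alpha> :: "nat \<Rightarrow> 'a"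
  shows "(partial 1 ^^ n) (single (\<alpha>, 0(1 := i)) 1) = (\<Sum>s\<le>n. single (\<alpha>, 0(1 := i - int s))
    (fact n * (of_int i gchoose s) * divided_power (\<alpha> 1) (int n - int s)))"
proof (induction n)
  case 0
  then show ?case by (simp add: divided_power_def)
next
  case (Suc n)
  define g :: "nat \<Rightarrow> 'a \<Rightarrow> 'a gen_fun" where "g s r = single (\<alpha>, 0(1 := i - int s)) r" for s r
  define D :: "nat \<Rightarrow> 'a" where "D s = divided_power (\<alpha> 1) (int (Suc n) - int s)" for s
  define c where "c s = (of_int i gchoose s :: 'a)" for s
  have g_add: "g s r + g s r' = g s (r + r')" for s r r' by (simp add: g_def single_add)
  have shift: "(0 :: nat \<Rightarrow> int)(1 := i - int s) - 0(1 := 1) = 0(1 := i - int (Suc s))" for s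
    by (auto simp: fun_ext_simps)
  have D: "divided_power (\<alpha> 1) (int n - int s) = D (Suc s)" for s by (simp add: D_def)
  have D': "D (Suc s) * \<alpha> 1 = (of_nat (Suc n) - of_nat s) * D s" for s
    using divided_power_Suc[of "\<alpha> 1" "int n - int s"] by (simp add: D_def algebra_simps)
  have c': "c s * of_int (i - int s) = of_nat (Suc s) * c (Suc s)" for s
    using gbinomial_absorb_comp[of "of_int i :: 'a" s] gbinomial_absorption[of s "of_int i :: 'a"]
    by (simp add: c_def mult.commute)
  have "(partial 1 ^^ Suc n) (single (\<alpha>, 0(1 := i)) 1) =
      (\<Sum>s\<le>n. partial 1 (single (\<alpha>, 0(1 := i - int s)) (fact n * c s * D (Suc s))))"
    by (simp only: funpow.simps comp_def Suc.IH additive_sum[of "partial 1", OF partial_add] D c_def)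
  also have "\<dots> = (\<Sum>s\<le>n. g s (fact n * c s * (D (Suc s) * \<alpha> 1)) +
      g (Suc s) (fact n * (c s * of_int (i - int s)) * D (Suc s)))"
    unfolding partial_single shift g_def by (intro sum.cong refl) (simp add: mult_ac)
  also have "\<dots> = (\<Sum>s\<le>n. g s (fact n * c s * ((of_nat (Suc n) - of_nat s) * D s))) +
      (\<Sum>s\<le>n. g (Suc s) (fact n * (of_nat (Suc s) * c (Suc s)) * D (Suc s)))"
    by (simp only: D' c' sum.distrib)
  \<comment> \<open>The sum may be extended to s = n + 1, where the factor n + 1 - s is 0; in the
    other sum the new term s = 0 has the factor s.\<close>
  also have "(\<Sum>s\<le>n. g s (fact n * c s * ((of_nat (Suc n) - of_nat s) * D s))) =
      (\<Sum>s\<le>Suc n. g s (fact n * c s * ((of_nat (Suc n) - of_nat s) * D s)))"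
    by (simp add: g_def)
  also have "(\<Sum>s\<le>n. g (Suc s) (fact n * (of_nat (Suc s) * c (Suc s)) * D (Suc s))) =
      (\<Sum>s\<le>Suc n. g s (fact n * (of_nat s * c s) * D s))"
    unfolding sum.atMost_Suc_shift[of _ n] by (simp add: g_def)
  finally have "(partial 1 ^^ Suc n) (single (\<alpha>, 0(1 := i)) 1) =
      (\<Sum>s\<le>Suc n. g s (fact n * c s * ((of_nat (Suc n) - of_nat s) * D s) + fact n * (of_nat s * c s) * D s))"
    by (simp only: sum.distrib[symmetric] g_add)
  also have "\<dots> = (\<Sum>s\<le>Suc n. g s (fact (Suc n) * c s * D s))"
    by (intro sum.cong refl arg_cong2[where f = g]) (simp add: algebra_simps)
  finally show ?case by (simp only: g_def c_def D_def)
qed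

text \<open>The residue of x^(\<alpha>+\<beta>, i-s+j) is w(\<alpha> + \<beta>) times the divided
  power of exponent -1 - (i - s + j) = s - i - j - 1, and (\<mu> + \<nu> + 1)! cancels against the
  denominator of \<open>pairing_coeff\<close>.\<close>

lemma pairing_xd:
  fixes w :: "(nat \<Rightarrow> 'a) \<Rightarrow> 'a"
  shows "pairing w (xd \<alpha> (0(1 := i)) (0(1 := \<mu>))) (xd \<beta> (0(1 := j)) (0(1 := \<nu>))) =
    w (\<alpha> + \<beta>) * ((- 1) ^ \<mu> * fact \<mu> * fact \<nu> *
      (\<Sum>s = 0..\<mu> + \<nu> + 1. (of_int i gchoose s) * (\<alpha> 1 ^ (\<mu> + \<nu> + 1 - s) / fact (\<mu> + \<nu> + 1 - s)) *
        divided_power ((\<alpha> + \<beta>) 1) (int s - i - j - 1)))"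
proof -
  define N where "N = \<mu> + \<nu> + 1"
  have idx: "(0 :: nat \<Rightarrow> int)(1 := i - int s) + 0(1 := j) = 0(1 := i - int s + j)" for s
    by (auto simp: fun_ext_simps)
  have dp: "divided_power (\<alpha> 1) (int N - int s) = \<alpha> 1 ^ (N - s) / fact (N - s)" if "s \<le> N" for s
    using that by (simp add: divided_power_def nat_diff_distrib)
  have "residue w ((partial 1 ^^ N) (single (\<alpha>, 0(1 := i)) 1) * single (\<beta>, 0(1 := j)) 1) =
      (\<Sum>s\<le>N. fact N * (of_int i gchoose s) * divided_power (\<alpha> 1) (int N - int s) *
        (w (\<alpha> + \<beta>) * divided_power ((\<alpha> + \<beta>) 1) (- 1 - (i - int s + j))))"
    by (simp only: funpow_partial_single sum_distrib_right mult_single add_Pair idx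
      additive_sum[of "residue w", OF weighted_sum_add] weighted_sum_single)
     (simp add: residue_weight_def)
  also have "\<dots> = (\<Sum>s = 0..N. fact N * w (\<alpha> + \<beta>) * ((of_int i gchoose s) * (\<alpha> 1 ^ (N - s) / fact (N - s)) *
        divided_power ((\<alpha> + \<beta>) 1) (int s - i - j - 1)))"
    unfolding atMost_atLeast0
  proof (intro sum.cong refl)
    fix s assume "s \<in> {0..N}"
    moreover have "- 1 - (i - int s + j) = int s - i - j - 1" by simp
    ultimately show "fact N * (of_int i gchoose s) * divided_power (\<alpha> 1) (int N - int s) *
        (w (\<alpha> + \<beta>) * divided_power ((\<alpha> + \<beta>) 1) (- 1 - (i - int s + j))) =
      fact N * w (\<alpha> + \<beta>) * ((of_int i gchoose s) * (\<alpha> 1 ^ (N - s) / fact (N - s)) *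
        divided_power ((\<alpha> + \<beta>) 1) (int s - i - j - 1))"
      by (simp only: dp atLeastAtMost_iff) (simp only: mult_ac)
  qed
  finally have "residue w ((partial 1 ^^ N) (single (\<alpha>, 0(1 := i)) 1) * single (\<beta>, 0(1 := j)) 1) =
      fact N * w (\<alpha> + \<beta>) * (\<Sum>s = 0..N. (of_int i gchoose s) * (\<alpha> 1 ^ (N - s) / fact (N - s)) *
        divided_power ((\<alpha> + \<beta>) 1) (int s - i - j - 1))"
    by (simp only: sum_distrib_left)
  moreover have "pairing_coeff \<mu> \<nu> * fact N = ((- 1) ^ \<mu> * fact \<mu> * fact \<nu> :: 'a)"
    by (simp add: pairing_coeff_def N_def del: fact_Suc)
  moreover have "p * S = v * (X * T)" if "S = F * v * T" "p * F = X" for p S v X T F :: 'a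
    by (simp only: that(1) that(2)[symmetric] mult_ac)
  moreover have val: "((0 :: nat \<Rightarrow> nat)(1 := k)) 1 = k" for k by simp
  ultimately show ?thesis
    unfolding xd_def pairing_single val N_def[symmetric] by blast
qed

end

lemma residue_add: "residue (\<lambda>\<gamma>. w \<gamma> + w' \<gamma>) u = residue w u + residue w' u"
  unfolding weighted_sum_def sum.distrib[symmetric]
  by (intro sum.cong refl) (auto simp: residue_weight_def algebra_simps)

lemma residue_scale: "residue (\<lambda>\<gamma>. c * w \<gamma>) u = c * residue w u"
  unfolding weighted_sum_def sum_distrib_left
  by (intro sum.cong refl) (auto simp: residue_weight_def algebra_simps)

lemma residue_cong:
  assumes "\<And>\<gamma>. \<gamma> \<in> fst ` keys u \<Longrightarrow> w \<gamma> = w' \<gamma>"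
  shows "residue w u = residue w' u"
  unfolding weighted_sum_def
proof (intro sum.cong refl)
  fix k assume "k \<in> keys u"
  then have "w (fst k) = w' (fst k)" using assms by blast
  then show "lookup u k * residue_weight w k = lookup u k * residue_weight w' k"
    by (simp add: residue_weight_def split_def)
qed

definition delta :: "'b \<Rightarrow> 'b \<Rightarrow> 'a::zero_neq_one" where
  "delta \<gamma> = (\<lambda>\<gamma>'. if \<gamma>' = \<gamma> then 1 else 0)"

lemma residue_delta_outside: "\<gamma> \<notin> fst ` keys u \<Longrightarrow> residue (delta \<gamma>) u = 0"
proof -
  assume "\<gamma> \<notin> fst ` keys u"
  then have "residue (delta \<gamma>) u = residue (\<lambda>_. 0) u"
    by (intro residue_cong) (auto simp: delta_def)
  also have "\<dots> = 0" by (simp add: weighted_sum_def residue_weight_def split_def)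
  finally show ?thesis .
qed

lemma residue_eq_sum_delta:
  "residue b u = (\<Sum>\<gamma>\<in>fst ` keys u. b \<gamma> * residue (delta \<gamma>) u)"
proof -
  have "(\<Sum>\<gamma>\<in>fst ` keys u. b \<gamma> * residue (delta \<gamma>) u) =
      (\<Sum>\<gamma>\<in>fst ` keys u. \<Sum>k\<in>keys u. lookup u k * (if \<gamma> = fst k then b \<gamma> * divided_power (fst k 1) (- 1 - snd k 1) else 0))"
    unfolding weighted_sum_def sum_distrib_left
    by (intro sum.cong refl) (auto simp: residue_weight_def delta_def split_def)
  also have "\<dots> = (\<Sum>k\<in>keys u. \<Sum>\<gamma>\<in>fst ` keys u. lookup u k * (if \<gamma> = fst k then b \<gamma> * divided_power (fst k 1) (- 1 - snd k 1) else 0))"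
    by (rule sum.swap)
  also have "\<dots> = (\<Sum>k\<in>keys u. lookup u k * residue_weight b k)"
    by (intro sum.cong refl)
      (simp add: sum_distrib_left[symmetric] sum.delta residue_weight_def split_def)
  finally show ?thesis by (simp add: weighted_sum_def)
qed

context gen_weyl_3
begin

lemma l_components: "l1 = 0" "l2 = 0" "l4 = 0"
  using l_eq l3_eq by simp_all

lemma J_all: "0(1 := i) \<in> J"
  by (auto simp: J_set_def l_components l3_eq zero_fun_apply)

lemma A_funpow_partial: "u \<in> A \<Longrightarrow> (partial 1 ^^ n) u \<in> A"
  by (induction n) (auto simp: l_eq)

lemma fun_pairing_A: "a \<in> C \<Longrightarrow> b \<in> C \<Longrightarrow> fun_pairing a b \<in> A"
  unfolding fun_pairing_def by (intro A_sum A_mult A_const A_funpow_partial C_lookup)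

lemma A_fst_keys: "u \<in> A \<Longrightarrow> fst ` keys u \<subseteq> \<Gamma>"
  by (auto simp: A_def)

lemma residue_cocycle_add:
  "residue_cocycle (\<lambda>\<gamma>. w \<gamma> + w' \<gamma>) = residue_cocycle w + residue_cocycle w'"
  by (auto simp: residue_cocycle_def pairing_def residue_add fun_ext_simps)

lemma residue_cocycle_scale:
  "residue_cocycle (\<lambda>\<gamma>. c * w \<gamma>) = (\<lambda>u v. c * residue_cocycle w u v)"
  by (auto simp: residue_cocycle_def pairing_def residue_scale fun_eq_iff)

lemma residue_cocycle_cong:
  assumes "\<And>\<gamma>. \<gamma> \<in> \<Gamma> \<Longrightarrow> w \<gamma> = w' \<gamma>"
  shows "residue_cocycle w = residue_cocycle w'"
proof (intro ext)
  fix u v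
  have "residue w (fun_pairing u v) = residue w' (fun_pairing u v)" if "u \<in> C" "v \<in> C"
    using A_fst_keys[OF fun_pairing_A[OF that]] assms by (intro residue_cong) blast
  then show "residue_cocycle w u v = residue_cocycle w' u v"
    by (simp add: residue_cocycle_def pairing_def)
qed

lemma residue_cocycle_delta_support:
  "{\<gamma> \<in> \<Gamma>. residue_cocycle (delta \<gamma>) u v \<noteq> 0} \<subseteq> fst ` keys (fun_pairing u v)"
  using residue_delta_outside[of _ "fun_pairing u v"] by (auto simp: residue_cocycle_def pairing_def)

lemma finite_residue_cocycle_delta: "finite {\<gamma> \<in> \<Gamma>. residue_cocycle (delta \<gamma>) u v \<noteq> 0}"
  by (rule finite_subset[OF residue_cocycle_delta_support]) simp

lemma sum_residue_cocycle_delta: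
  "(\<lambda>u v. \<Sum>\<gamma> | \<gamma> \<in> \<Gamma> \<and> residue_cocycle (delta \<gamma>) u v \<noteq> 0. b \<gamma> * residue_cocycle (delta \<gamma>) u v) =
    residue_cocycle b"
proof (intro ext)
  fix u v
  show "(\<Sum>\<gamma> | \<gamma> \<in> \<Gamma> \<and> residue_cocycle (delta \<gamma>) u v \<noteq> 0. b \<gamma> * residue_cocycle (delta \<gamma>) u v) =
    residue_cocycle b u v"
  proof (cases "u \<in> C \<and> v \<in> C")
    case True
    define k where "k = fun_pairing u v"
    have res: "residue_cocycle w u v = residue w k" for w
      using True by (simp add: residue_cocycle_def pairing_def k_def)
    have "fst ` keys k \<subseteq> \<Gamma>" using True A_fst_keys fun_pairing_A by (simp add: k_def)
    then have "(\<Sum>\<gamma> | \<gamma> \<in> \<Gamma> \<and> residue (delta \<gamma>) k \<noteq> 0. b \<gamma> * residue (delta \<gamma>) k) =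
        (\<Sum>\<gamma>\<in>fst ` keys k. b \<gamma> * residue (delta \<gamma>) k)"
      by (intro sum.mono_neutral_left) (use residue_delta_outside[of _ k] in auto)
    then show ?thesis by (simp only: res residue_eq_sum_delta[of b k])
  qed (auto simp: residue_cocycle_def)
qed

lemma residue_cocycle_t:
  assumes "k \<in> A"
  shows "residue_cocycle w t (single 0 k) = residue w k"
proof -
  have "pairing w t (single 0 k) = pairing_coeff 0 0 * residue w ((partial 1 ^^ (0 + 0 + 1)) (coord 1) * k)"
    unfolding pairing_single zero_fun_apply ..
  also have "(partial 1 ^^ (0 + 0 + 1)) (coord 1) = 1"
    using partial_coord[of 1 1] by (simp add: One_nat_def)
  also have "pairing_coeff 0 0 * residue w (1 * k) = residue w k"
    by (simp add: pairing_coeff_def)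
  finally show ?thesis
    using assms by (simp add: residue_cocycle_def)
qed

text \<open>Functions commute with t, so a coboundary vanishes at (t, x^(\<gamma>,-1)), where
  \<open>residue_cocycle w\<close> has the value w \<gamma>.\<close>

lemma residue_cocycle_coboundary_imp:
  assumes "residue_cocycle w \<in> coboundaries2 L" "\<gamma> \<in> \<Gamma>"
  shows "w \<gamma> = 0"
proof -
  obtain f where f: "linear_on L f" "residue_cocycle w = coboundary2 L f"
    using assms(1) by (auto simp: coboundaries2_def)
  define k :: "'a gen_fun" where "k = single (\<gamma>, 0(1 := - 1)) 1"
  have k: "k \<in> A" unfolding k_def by (intro A_single assms J_all)
  have "f 0 = 0"
    using f(1)[unfolded linear_on_def] zero_C scl_zero[of 0] by (metis L_simps(1,2) mult_zero_left)
  then have "residue_cocycle w t (single 0 k) = 0"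
    using k by (simp add: f(2) coboundary2_def br_fun_fun)
  moreover have "residue w k = w \<gamma>"
    by (simp add: k_def residue_weight_def divided_power_def)
  ultimately show ?thesis using residue_cocycle_t[OF k] by simp
qed

lemma cocycle_eq_residue_cocycle:
  assumes "\<psi> \<in> cocycles2 L"
  shows "\<exists>w. \<psi> - residue_cocycle w \<in> coboundaries2 L"
proof -
  \<comment> \<open>Normalized so that \<chi>(t, -) vanishes at each x^(\<gamma>,-1) with \<gamma>
    in \<Gamma>.\<close>
  define w where "w \<gamma> = \<psi> t (single 0 (single (\<gamma>, 0(1 := - 1)) 1))" for \<gamma>
  define \<chi> where "\<chi> = \<psi> - residue_cocycle w"
  have "\<chi> \<in> cocycles2 L"
    unfolding \<chi>_def by (intro cocycles2_diff assms residue_cocycle_cocycles2)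
  then interpret alg_cocycle C "op_mult l" op_scale "xd 0 0 0" \<chi>
    by unfold_locales
  define R where "R k = \<chi> t (single 0 k)" for k
  have R_add: "R (u + v) = R u + R v" if "u \<in> A" "v \<in> A" for u v
    using that t_C by (simp add: R_def single_add psi_add_right)
  have R_scale: "R (single 0 r * u) = r * R u" if "u \<in> A" for r u
    using that t_C psi_scl_right[of t "single 0 u" r] by (simp add: R_def op_scale_eq_mult mult_single)
  have R_partial: "R (partial 1 u) = 0" if "u \<in> A" for u
    using psi_bracket_pair[OF weyl_pair_t, of "single 0 u"] br_fun_fun[OF that coord_1]
      br_d_fun[of 1 1 u] that l_eq by (simp add: R_def)
  have R_init: "R (single (\<gamma>, 0(1 := - 1)) 1) = 0" if "\<gamma> \<in> \<Gamma>" for \<gamma>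
    using residue_cocycle_t[of "single (\<gamma>, 0(1 := - 1)) 1" w] A_single[OF that J_all]
    by (simp add: R_def \<chi>_def w_def residue_weight_def divided_power_def)
  have mono: "R (single (\<gamma>, 0(1 := i)) 1) = 0" if \<gamma>: "\<gamma> \<in> \<Gamma>" for \<gamma> i
  proof -
    define D where "D i = R (single (\<gamma>, 0(1 := i)) 1)" for i
    \<comment> \<open>Derivatives are killed, which links neighbouring exponents. The factor i is 0
      at i = 0, so this link is cut between -1 and 0: negative exponents descend from -1, while the
      others ascend from 0 if \<gamma>_1 \<noteq> 0 and follow directly from the rule at n + 1 if
      \<gamma>_1 = 0.\<close>
    have rec: "\<gamma> 1 * D i + of_int i * D (i - 1) = 0" for i
    proof -
      have "(0 :: nat \<Rightarrow> int)(1 := i) - 0(1 := 1) = 0(1 := i - 1)" by (auto simp: fun_ext_simps)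
      then have "partial 1 (single (\<gamma>, 0(1 := i)) 1) =
          single 0 (\<gamma> 1) * single (\<gamma>, 0(1 := i)) 1 + single 0 (of_int i) * single (\<gamma>, 0(1 := i - 1)) 1"
        by (simp add: partial_single mult_single del: single_of_int)
      moreover have "R (partial 1 (single (\<gamma>, 0(1 := i)) 1)) = 0"
        by (rule R_partial) (rule A_single[OF \<gamma> J_all])
      ultimately show ?thesis
        using A_single[OF \<gamma> J_all] by (simp add: R_add R_scale D_def del: single_of_int)
    qed
    have neg: "D (- 1 - int n) = 0" for n
    proof (induction n)
      case 0
      then show ?case using R_init[OF \<gamma>] by (simp add: D_def)
    next
      case (Suc n)
      have "of_int (- 1 - int n) * D (- 1 - int n - 1) = 0"
        using rec[of "- 1 - int n"] Suc by simp
      moreover have "of_int (- 1 - int n) \<noteq> (0 :: 'a)" by (subst of_int_eq_0_iff) simp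
      ultimately have "D (- 1 - int n - 1) = 0" by (metis mult_eq_0_iff)
      moreover have "- 1 - int n - 1 = - 1 - int (Suc n)" by simp
      ultimately show ?case by simp
    qed
    have pos: "D (int n) = 0" for n
    proof (cases "\<gamma> 1 = 0")
      case True
      have "of_int (int n + 1) * D (int n) = 0" using rec[of "int n + 1"] True by simp
      moreover have "of_int (int n + 1) \<noteq> (0 :: 'a)" by (subst of_int_eq_0_iff) simp
      ultimately show ?thesis by (metis mult_eq_0_iff)
    next
      case False
      show ?thesis
      proof (induction n)
        case 0
        then show ?case using rec[of 0] False by simp
      next
        case (Suc n)
        then show ?case using rec[of "int (Suc n)"] False by simp
      qed
    qed
    have "D i = 0"
    proof (cases "i \<ge> 0")
      case True
      then show ?thesis using pos[of "nat i"] by simp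
    next
      case False
      then have "i = - 1 - int (nat (- 1 - i))" by simp
      then show ?thesis using neg[of "nat (- 1 - i)"] by simp
    qed
    then show ?thesis by (simp add: D_def)
  qed
  have R_zero: "R k = 0" if "k \<in> A" for k
    using that
  proof (induction k rule: A_induct)
    case (single \<gamma> i r)
    have "R (single (\<gamma>, i) 1) = 0" using mono[OF single(1), of "i 1"] J_key[OF single(2)] by simp
    then show ?case
      using R_scale[OF A_single[OF single, of 1], of r] by (simp add: mult_single)
  qed (simp add: R_add)
  have "\<chi> \<in> coboundaries2 L"
  proof (rule coboundary_criterion[OF weyl_pair_t])
    fix k assume k: "k \<in> C" "br k t = 0"
    have "k = single 0 (lookup k 0)"
      using k by (intro centralizer_fun[of "coord 1" 1]) (auto simp: partial_coord)
    then show "\<chi> t k = 0" using R_zero[OF C_lookup[OF k(1), of 0]] by (simp add: R_def)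
  qed
  then show ?thesis by (auto simp: \<chi>_def)
qed

abbreviation residue_class :: "(nat \<Rightarrow> 'a) \<Rightarrow> ('a gen_op \<Rightarrow> 'a gen_op \<Rightarrow> 'a) set" where
  "residue_class \<gamma> \<equiv> coh_class L (residue_cocycle (delta \<gamma>))"

lemma H2_scale_residue_class:
  "H2_scale L c (residue_class \<gamma>) = coh_class L (residue_cocycle (\<lambda>\<gamma>'. c * delta \<gamma> \<gamma>'))"
  by (simp add: H2_scale_coh_class residue_cocycle_scale)

lemma coh_class_residue_cocycle_eq_imp:
  assumes "coh_class L (residue_cocycle w) = coh_class L (residue_cocycle w')" "\<gamma> \<in> \<Gamma>"
  shows "w \<gamma> = w' \<gamma>"
proof -
  have "residue_cocycle w - residue_cocycle w' = residue_cocycle (\<lambda>\<gamma>. w \<gamma> + (- 1) * w' \<gamma>)"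
    unfolding residue_cocycle_add residue_cocycle_scale by (simp add: fun_ext_simps)
  then have "residue_cocycle (\<lambda>\<gamma>. w \<gamma> + (- 1) * w' \<gamma>) \<in> coboundaries2 L"
    using assms(1) by (simp add: coh_class_eq_iff)
  from residue_cocycle_coboundary_imp[OF this assms(2)] show ?thesis by simp
qed

lemma H2_scale_residue_class_inject:
  assumes "H2_scale L c (residue_class \<gamma>) = H2_scale L c' (residue_class \<gamma>)" "\<gamma> \<in> \<Gamma>"
  shows "c = c'"
  using coh_class_residue_cocycle_eq_imp[OF assms[unfolded H2_scale_residue_class]] by (simp add: delta_def)

lemma residue_class_nonzero: "\<gamma> \<in> \<Gamma> \<Longrightarrow> residue_class \<gamma> \<noteq> coh_class L 0"
proof
  assume "\<gamma> \<in> \<Gamma>" "residue_class \<gamma> = coh_class L 0"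
  then have "residue_cocycle (delta \<gamma>) \<in> coboundaries2 L" by (simp add: coh_class_eq_iff)
  from residue_cocycle_coboundary_imp[OF this \<open>\<gamma> \<in> \<Gamma>\<close>] show False by (simp add: delta_def)
qed

text \<open>Each line is parametrized injectively by its scalar, so a member of the product amounts
  to a weight b on \<Gamma>, and \<Phi> sends it to the class of \<open>residue_cocycle b\<close>.
  Linearity of \<Phi> is linearity of the residue in its weight.\<close>

theorem H2_product:
  "\<exists>\<Phi>. bij_betw \<Phi> (\<Pi>\<^sub>E \<gamma>\<in>\<Gamma>. H2_line L (residue_class \<gamma>)) (H2 L) \<and>
    (\<forall>h \<in> (\<Pi>\<^sub>E \<gamma>\<in>\<Gamma>. H2_line L (residue_class \<gamma>)). \<forall>h' \<in> (\<Pi>\<^sub>E \<gamma>\<in>\<Gamma>. H2_line L (residue_class \<gamma>)).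
        \<Phi> (\<lambda>\<gamma>\<in>\<Gamma>. h \<gamma> + h' \<gamma>) = \<Phi> h + \<Phi> h') \<and>
    (\<forall>c. \<forall>h \<in> (\<Pi>\<^sub>E \<gamma>\<in>\<Gamma>. H2_line L (residue_class \<gamma>)).
        \<Phi> (\<lambda>\<gamma>\<in>\<Gamma>. H2_scale L c (h \<gamma>)) = H2_scale L c (\<Phi> h)) \<and>
    (\<forall>b. residue_cocycle b \<in> cocycles2 L \<and>
        \<Phi> (\<lambda>\<gamma>\<in>\<Gamma>. H2_scale L (b \<gamma>) (residue_class \<gamma>)) = coh_class L (residue_cocycle b))"
proof -
  define P where "P = (\<Pi>\<^sub>E \<gamma>\<in>\<Gamma>. H2_line L (residue_class \<gamma>))"
  define E where "E b = (\<lambda>\<gamma>\<in>\<Gamma>. H2_scale L (b \<gamma>) (residue_class \<gamma>))" for b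
  \<comment> \<open>On \<Gamma> the scalar is unique by
    \<open>H2_scale_residue_class_inject\<close>; \<open>residue_cocycle_cong\<close> absorbs the
    arbitrary values outside \<Gamma>.\<close>
  define coef where "coef h \<gamma> = (SOME c. h \<gamma> = H2_scale L c (residue_class \<gamma>))" for h \<gamma>
  define \<Phi> where "\<Phi> h = coh_class L (residue_cocycle (coef h))" for h
  have E_P: "E b \<in> P" for b by (auto simp: E_def P_def H2_line_def)
  have coef_E: "coef (E b) \<gamma> = b \<gamma>" if "\<gamma> \<in> \<Gamma>" for b \<gamma>
  proof -
    have "E b \<gamma> = H2_scale L (coef (E b) \<gamma>) (residue_class \<gamma>)"
      unfolding coef_def by (rule someI[of _ "b \<gamma>"]) (simp add: E_def that)
    then show ?thesis using H2_scale_residue_class_inject[OF _ that] that by (simp add: E_def)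
  qed
  have P_E: "E (coef h) = h" if "h \<in> P" for h
  proof
    fix \<gamma>
    show "E (coef h) \<gamma> = h \<gamma>"
    proof (cases "\<gamma> \<in> \<Gamma>")
      case True
      then have "\<exists>c. h \<gamma> = H2_scale L c (residue_class \<gamma>)"
        using that by (auto simp: P_def PiE_iff H2_line_def)
      then have "h \<gamma> = H2_scale L (coef h \<gamma>) (residue_class \<gamma>)"
        unfolding coef_def by (rule someI_ex)
      then show ?thesis using True by (simp add: E_def)
    next
      case False
      then show ?thesis using that by (auto simp: P_def E_def PiE_iff extensional_def)
    qed
  qed
  have \<Phi>_E: "\<Phi> (E b) = coh_class L (residue_cocycle b)" for b
    unfolding \<Phi>_def using residue_cocycle_cong[of "coef (E b)" b] coef_E by simp
  have E_add: "(\<lambda>\<gamma>\<in>\<Gamma>. E b \<gamma> + E b' \<gamma>) = E (\<lambda>\<gamma>. b \<gamma> + b' \<gamma>)" for b b'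
    by (auto simp: E_def fun_eq_iff H2_scale_coh_class coh_class_add plus_fun_def algebra_simps)
  have E_scale: "(\<lambda>\<gamma>\<in>\<Gamma>. H2_scale L c (E b \<gamma>)) = E (\<lambda>\<gamma>. c * b \<gamma>)" for b c
    by (auto simp: E_def fun_eq_iff H2_scale_coh_class mult.assoc)
  have bij: "bij_betw \<Phi> P (H2 L)"
  proof (rule bij_betwI')
    fix h h' assume h: "h \<in> P" "h' \<in> P"
    have "h = h'" if eq: "\<Phi> h = \<Phi> h'"
    proof -
      have "coef h \<gamma> = coef h' \<gamma>" if "\<gamma> \<in> \<Gamma>" for \<gamma>
        using coh_class_residue_cocycle_eq_imp[OF eq[unfolded \<Phi>_def] that] .
      then have "E (coef h) = E (coef h')" unfolding E_def by (intro restrict_ext) simp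
      then show ?thesis using P_E h by metis
    qed
    then show "\<Phi> h = \<Phi> h' \<longleftrightarrow> h = h'" by blast
  next
    fix h assume "h \<in> P"
    show "\<Phi> h \<in> H2 L" unfolding \<Phi>_def H2_def using residue_cocycle_cocycles2 by blast
  next
    fix X assume "X \<in> H2 L"
    then obtain \<psi> where \<psi>: "\<psi> \<in> cocycles2 L" "X = coh_class L \<psi>" by (auto simp: H2_def)
    obtain w where "\<psi> - residue_cocycle w \<in> coboundaries2 L"
      using cocycle_eq_residue_cocycle[OF \<psi>(1)] by blast
    then have "X = \<Phi> (E w)" by (simp add: \<psi>(2) \<Phi>_E coh_class_eq_iff)
    then show "\<exists>h\<in>P. X = \<Phi> h" using E_P by blast
  qed
  have add: "\<Phi> (\<lambda>\<gamma>\<in>\<Gamma>. h \<gamma> + h' \<gamma>) = \<Phi> h + \<Phi> h'" if "h \<in> P" "h' \<in> P" for h h'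
  proof -
    have "\<Phi> (\<lambda>\<gamma>\<in>\<Gamma>. E (coef h) \<gamma> + E (coef h') \<gamma>) = \<Phi> (E (coef h)) + \<Phi> (E (coef h'))"
      unfolding E_add \<Phi>_E coh_class_add residue_cocycle_add ..
    then show ?thesis using P_E that by simp
  qed
  have scale: "\<Phi> (\<lambda>\<gamma>\<in>\<Gamma>. H2_scale L c (h \<gamma>)) = H2_scale L c (\<Phi> h)" if "h \<in> P" for c h
  proof -
    have "\<Phi> (\<lambda>\<gamma>\<in>\<Gamma>. H2_scale L c (E (coef h) \<gamma>)) = H2_scale L c (\<Phi> (E (coef h)))"
      unfolding E_scale \<Phi>_E H2_scale_coh_class residue_cocycle_scale ..
    then show ?thesis using P_E that by simp
  qed
  show ?thesis
    by (intro exI[of _ \<Phi>] conjI ballI allI)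
      (rule bij[unfolded P_def] \<Phi>_E[unfolded E_def] residue_cocycle_cocycles2 |
        rule add[unfolded P_def] scale[unfolded P_def]; assumption)+
qed

end

section \<open>Indefinite sums of polynomials\<close>

text \<open>Translation enters through the product of operators: p(\<partial>) x^\<beta> = x^\<beta>
  p(\<partial> + \<beta>).\<close>

definition shift :: "'a::comm_ring_1 \<Rightarrow> 'a poly \<Rightarrow> 'a poly" where
  "shift c p = pcompose p [:c, 1:]"

lemma shift_add: "shift c (p + q) = shift c p + shift c q"
  and shift_mult: "shift c (p * q) = shift c p * shift c q"
  and shift_smult: "shift c (smult r p) = smult r (shift c p)"
  and shift_diff: "shift c (p - q) = shift c p - shift c q"
  and shift_one [simp]: "shift c 1 = 1"
  and poly_shift: "poly (shift c p) x = poly p (x + c)"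
  by (simp_all add: shift_def pcompose_add pcompose_mult pcompose_smult pcompose_diff pcompose_1
      poly_pcompose add.commute)

lemma shift_shift: "shift c (shift d p) = shift (c + d) p"
  by (simp add: shift_def pcompose_assoc[symmetric] pcompose_pCons add.commute)

lemma shift_zero [simp]: "shift 0 p = p"
  by (simp add: shift_def pcompose_idR)

definition fdiff :: "'a::comm_ring_1 poly \<Rightarrow> 'a poly" where
  "fdiff p = shift 1 p - p"

lemma fdiff_add: "fdiff (p + q) = fdiff p + fdiff q"
  and fdiff_smult: "fdiff (smult r p) = smult r (fdiff p)"
  and fdiff_diff: "fdiff (p - q) = fdiff p - fdiff q"
  by (simp_all add: fdiff_def shift_add shift_smult shift_diff smult_diff_right)

lemma fdiff_shift: "fdiff (shift c p) = shift c (fdiff p)"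
  by (simp add: fdiff_def shift_shift shift_diff add.commute)

lemma fdiff_mult: "fdiff (p * q) = p * fdiff q + fdiff p * shift 1 q"
  by (simp add: fdiff_def shift_mult algebra_simps)

text \<open>Invariant under translation by 1, p takes the value p(0) at all naturals; in
  characteristic 0 these are infinitely many points.\<close>

lemma fdiff_eq_0_imp:
  fixes p :: "'a::field_char_0 poly"
  assumes "fdiff p = 0"
  shows "poly p x = poly p 0"
proof -
  have "poly p (of_nat n) = poly p 0" for n
  proof (induction n)
    case (Suc n)
    have "poly (fdiff p) (of_nat n) = 0" using assms by simp
    then show ?case using Suc by (simp add: fdiff_def poly_shift add.commute)
  qed simp
  then have "range (of_nat :: nat \<Rightarrow> 'a) \<subseteq> {x. poly (p - [:poly p 0:]) x = 0}" by auto
  moreover have "infinite (range (of_nat :: nat \<Rightarrow> 'a))"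
    by (rule range_inj_infinite) (rule inj_of_nat)
  ultimately have "p - [:poly p 0:] = 0"
    using poly_roots_finite finite_subset by blast
  then have "poly (p - [:poly p 0:]) x = 0" by simp
  then show ?thesis by simp
qed

primrec falling_poly :: "nat \<Rightarrow> 'a::comm_ring_1 poly" where
  "falling_poly 0 = 1"
| "falling_poly (Suc n) = falling_poly n * [:- of_nat n, 1:]"

lemma poly_falling_poly_Suc: "poly (falling_poly (Suc n)) x = x * poly (falling_poly n) (x - 1)"
proof (induction n arbitrary: x)
  case (Suc n)
  have "poly (falling_poly (Suc (Suc n))) x = poly (falling_poly (Suc n)) x * (x - of_nat (Suc n))"
    by (simp add: algebra_simps)
  also have "\<dots> = x * (poly (falling_poly n) (x - 1) * (x - 1 - of_nat n))"
    unfolding Suc.IH by (simp add: algebra_simps)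
  also have "\<dots> = x * poly (falling_poly (Suc n)) (x - 1)"
    by (simp add: algebra_simps)
  finally show ?case .
qed simp

lemma poly_falling_poly: "poly (falling_poly n) x = fact n * ((x :: 'a::field_char_0) gchoose n)"
proof (induction n)
  case (Suc n)
  have "of_nat (Suc n) * (x gchoose Suc n) = (x - of_nat n) * (x gchoose n)"
    using gbinomial_absorb_comp[of x n] gbinomial_absorption[of n x] by simp
  then have "fact n * (of_nat (Suc n) * (x gchoose Suc n)) = fact n * ((x - of_nat n) * (x gchoose n))"
    by (rule arg_cong)
  then show ?case using Suc by (simp add: algebra_simps)
qed simp

text \<open>Power rule for differences: the two values share the factor x (x - 1) ... (x - n + 1),
  and the remaining factors differ by (x + 1) - (x - n) = n + 1.\<close>

lemma fdiff_falling_poly: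
  "fdiff (falling_poly (Suc n)) = smult (of_nat (Suc n)) (falling_poly n :: 'a::field_char_0 poly)"
proof (rule poly_eq_poly_eq_iff[THEN iffD1], rule ext)
  fix x :: 'a
  have "poly (fdiff (falling_poly (Suc n))) x =
      (x + 1) * poly (falling_poly n) x - poly (falling_poly n) x * (x - of_nat n)"
    using poly_falling_poly_Suc[of n "x + 1"]
    by (simp add: fdiff_def poly_shift algebra_simps)
  then show "poly (fdiff (falling_poly (Suc n))) x = poly (smult (of_nat (Suc n)) (falling_poly n)) x"
    by (simp add: algebra_simps)
qed

inductive falling_span :: "'a::comm_ring_1 poly \<Rightarrow> bool" where
  generator: "falling_span (smult c (falling_poly n))"
| add: "falling_span p \<Longrightarrow> falling_span q \<Longrightarrow> falling_span (p + q)"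

text \<open>From x [x]_n = [x]_(n+1) + n [x]_n. Being closed under multiplication by x and
  containing the constants, the span exhausts all polynomials.\<close>

lemma falling_span_mult_x: "falling_span p \<Longrightarrow> falling_span (pCons 0 p)"
  for p :: "'a::field_char_0 poly"
proof (induction rule: falling_span.induct)
  case (generator c n)
  have "pCons 0 (smult c (falling_poly n)) =
      smult c (falling_poly (Suc n)) + smult (c * of_nat n) (falling_poly n :: 'a poly)"
    by (rule poly_eq_poly_eq_iff[THEN iffD1], rule ext) (simp add: algebra_simps)
  then show ?case by (simp only: falling_span.intros)
next
  case (add p q)
  have "pCons 0 (p + q) = pCons 0 p + pCons 0 q" by simp
  with add.IH show ?case by (simp only: falling_span.add)
qed

lemma falling_span_UNIV: "falling_span (h :: 'a::field_char_0 poly)"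
proof (induction h)
  case 0
  show ?case using falling_span.generator[of 0] by simp
next
  case (pCons a p)
  have "pCons a p = smult a (falling_poly 0) + pCons 0 p" by simp
  with pCons.IH show ?case
    by (simp only: falling_span.add falling_span.generator falling_span_mult_x)
qed

lemma fdiff_surj:
  fixes h :: "'a::field_char_0 poly"
  shows "\<exists>p. fdiff p = h"
  using falling_span_UNIV[of h]
proof (induction rule: falling_span.induct)
  case (generator c n)
  have "fdiff (smult (c / of_nat (Suc n)) (falling_poly (Suc n))) = smult c (falling_poly n :: 'a poly)"
    unfolding fdiff_smult fdiff_falling_poly by (simp del: of_nat_Suc)
  then show ?case by blast
next
  case (add p q)
  then show ?case using fdiff_add by metis
qed

text \<open>For \<open>b - a\<close> a natural number this is the sum of \<open>h\<close> over \<open>a, a + 1, \<dots>, b - 1\<close>.\<close>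

definition psum :: "'a::field_char_0 poly \<Rightarrow> 'a \<Rightarrow> 'a \<Rightarrow> 'a" where
  "psum h a b = poly (SOME p. fdiff p = h) b - poly (SOME p. fdiff p = h) a"

lemma psum_eqI:
  assumes "fdiff p = h"
  shows "psum h a b = poly p b - poly p a"
proof -
  define q where "q = (SOME p. fdiff p = h)"
  have "fdiff q = h" unfolding q_def by (rule someI[of _ p]) (rule assms)
  then have "fdiff (q - p) = 0" using assms by (simp add: fdiff_diff)
  from fdiff_eq_0_imp[OF this, of a] fdiff_eq_0_imp[OF this, of b]
  have "poly q b - poly p b = poly q a - poly p a" by simp
  then show ?thesis unfolding psum_def q_def[symmetric] by algebra
qed

lemma psum_add: "psum (g + h) a b = psum g a b + psum h a b"
proof -
  obtain p q where "fdiff p = g" "fdiff q = h" using fdiff_surj by metis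
  then show ?thesis using psum_eqI[of p g] psum_eqI[of q h] psum_eqI[of "p + q" "g + h"]
    by (simp add: fdiff_add)
qed

lemma psum_smult: "psum (smult c h) a b = c * psum h a b"
proof -
  obtain p where "fdiff p = h" using fdiff_surj by metis
  then have "psum h a b = poly p b - poly p a" "psum (smult c h) a b = poly (smult c p) b - poly (smult c p) a"
    using psum_eqI[of p h a b] psum_eqI[of "smult c p" "smult c h" a b] by (simp_all add: fdiff_smult)
  then show ?thesis by (simp add: right_diff_distrib)
qed

lemma psum_shift: "psum (shift c h) a b = psum h (a + c) (b + c)"
proof -
  obtain p where "fdiff p = h" using fdiff_surj by metis
  then show ?thesis using psum_eqI[of p h] psum_eqI[of "shift c p" "shift c h"]
    by (simp add: fdiff_shift poly_shift)
qed

lemma psum_split: "psum h a b + psum h b c = psum h a c"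
  by (simp add: psum_def)

lemma psum_swap: "psum h a b = - psum h b a"
  by (simp add: psum_def)

lemma psum_step: "psum h a (a + 1) = poly h a"
proof -
  obtain p where p: "fdiff p = h" using fdiff_surj by metis
  then have "poly h a = poly p (a + 1) - poly p a" by (auto simp: fdiff_def poly_shift)
  then show ?thesis using psum_eqI[OF p] by simp
qed

lemma psum_by_parts:
  "psum (p * fdiff q) a b = poly (p * q) b - poly (p * q) a - psum (fdiff p * shift 1 q) a b"
proof -
  have "psum (p * fdiff q) a b + psum (fdiff p * shift 1 q) a b = poly (p * q) b - poly (p * q) a"
    using psum_eqI[OF fdiff_mult[of p q]] by (simp add: psum_add)
  then show ?thesis by (simp add: algebra_simps)
qed

text \<open>Summation by parts trades one factor of the first falling power for one of the second: m
  decreases while n and \<alpha> increase by 1, so both are kept arbitrary. The boundary terms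
  vanish because the first factor is 0 at 0 and the second, translated by \<alpha>, is 0 at
  -\<alpha>.\<close>

lemma psum_falling_poly:
  "psum (falling_poly m * shift \<alpha> (falling_poly n)) (- \<alpha>) 0 =
    (- 1) ^ m * fact m * fact n * ((\<alpha> + of_nat m) gchoose (m + n + 1))"
proof (induction m arbitrary: n \<alpha>)
  case 0
  have "psum (falling_poly n) 0 \<alpha> = poly (falling_poly (Suc n)) \<alpha> / of_nat (Suc n)"
    using psum_eqI[of "smult (1 / of_nat (Suc n)) (falling_poly (Suc n))" "falling_poly n" 0 \<alpha>]
      poly_falling_poly_Suc[of n 0]
    by (simp add: fdiff_smult fdiff_falling_poly del: falling_poly.simps of_nat_Suc)
  also have "\<dots> = fact n * (\<alpha> gchoose Suc n)"
    unfolding poly_falling_poly fact_Suc by (simp del: of_nat_Suc)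
  finally show ?case by (simp add: psum_shift One_nat_def)
next
  case (Suc m)
  define q where "q = smult (1 / of_nat (Suc n)) (shift \<alpha> (falling_poly (Suc n)))"
  have ff0: "poly (falling_poly (Suc k)) 0 = (0 :: 'a)" for k
    using poly_falling_poly_Suc[of k "0 :: 'a"] by simp
  have "fdiff q = shift \<alpha> (falling_poly n)"
    by (simp add: q_def fdiff_smult fdiff_shift fdiff_falling_poly shift_smult del: falling_poly.simps of_nat_Suc)
  then have "psum (falling_poly (Suc m) * shift \<alpha> (falling_poly n)) (- \<alpha>) 0 =
      psum (falling_poly (Suc m) * fdiff q) (- \<alpha>) 0" by simp
  also have "\<dots> = - psum (fdiff (falling_poly (Suc m)) * shift 1 q) (- \<alpha>) 0"
    unfolding psum_by_parts by (simp add: ff0 q_def poly_shift del: falling_poly.simps)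
  also have "fdiff (falling_poly (Suc m)) * shift 1 q =
      smult (of_nat (Suc m) / of_nat (Suc n)) (falling_poly m * shift (\<alpha> + 1) (falling_poly (Suc n)))"
    by (simp add: fdiff_falling_poly q_def shift_smult shift_shift add.commute
        del: falling_poly.simps of_nat_Suc)
  also have "psum \<dots> (- \<alpha>) 0 = of_nat (Suc m) / of_nat (Suc n) *
      psum (falling_poly m * shift (\<alpha> + 1) (falling_poly (Suc n))) (- \<alpha>) 0"
    by (rule psum_smult)
  \<comment> \<open>The lower end moves from -\<alpha> to -(\<alpha> + 1) at the cost of the summand
    at the new end, which is 0: its second factor is a falling power of positive length at
    0.\<close>
  also have "psum (falling_poly m * shift (\<alpha> + 1) (falling_poly (Suc n))) (- \<alpha>) 0 =
      psum (falling_poly m * shift (\<alpha> + 1) (falling_poly (Suc n))) (- (\<alpha> + 1)) 0"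
    using psum_split[of "falling_poly m * shift (\<alpha> + 1) (falling_poly (Suc n))" "- (\<alpha> + 1)" "- (\<alpha> + 1) + 1" 0]
      psum_step[of "falling_poly m * shift (\<alpha> + 1) (falling_poly (Suc n))" "- (\<alpha> + 1)"]
    by (simp add: poly_shift ff0 del: falling_poly.simps)
  also have "\<dots> = (- 1) ^ m * fact m * fact (Suc n) * ((\<alpha> + 1 + of_nat m) gchoose (m + Suc n + 1))"
    by (rule Suc.IH)
  also have "\<alpha> + 1 + of_nat m = \<alpha> + of_nat (Suc m)" by simp
  also have "m + Suc n + 1 = Suc m + n + 1" by simp
  finally show ?case
    by (simp add: fact_Suc field_simps del: of_nat_Suc)
qed

section \<open>The Kac--Peterson cocycle\<close>

definition basis_sum :: "('k \<Rightarrow> 'm \<Rightarrow> 'a) \<Rightarrow> ('k \<Rightarrow>\<^sub>0 ('m \<Rightarrow>\<^sub>0 'a::comm_ring_1)) \<Rightarrow> 'a" where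
  "basis_sum w a = (\<Sum>\<mu>\<in>keys a. weighted_sum (w \<mu>) (lookup a \<mu>))"

lemma basis_sum_add: "basis_sum w (a + b) = basis_sum w a + basis_sum w b"
  unfolding basis_sum_def by (rule setsum_keys_plus_distrib) (auto simp: weighted_sum_add)

lemma basis_sum_single: "basis_sum w (single \<mu> (single k r)) = r * w \<mu> k"
proof (cases "r = 0")
  case False
  then have "single k r \<noteq> 0" by (metis lookup_single_eq lookup_zero)
  then show ?thesis by (simp add: basis_sum_def)
qed (simp add: basis_sum_def)

lemma basis_sum_add_weight:
  "basis_sum (\<lambda>\<mu> k. w \<mu> k + w' \<mu> k) a = basis_sum w a + basis_sum w' a"
  by (simp add: basis_sum_def weighted_sum_def sum.distrib algebra_simps)

lemma basis_sum_op_scale: "basis_sum w (op_scale r a) = r * basis_sum w a"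
  unfolding op_scale_eq_mult
proof (rule additive_ext[where a = a])
  fix \<mu> u
  show "basis_sum w (single 0 (single 0 r) * single \<mu> u) = r * basis_sum w (single \<mu> u)"
  proof (rule additive_ext[where a = u])
    fix k c
    show "basis_sum w (single 0 (single 0 r) * single \<mu> (single k c)) = r * basis_sum w (single \<mu> (single k c))"
      by (simp only: mult_single add_0 basis_sum_single mult.assoc)
  qed (simp_all add: basis_sum_add single_add algebra_simps)
qed (simp_all add: basis_sum_add algebra_simps)

text \<open>Let x^\<alpha> f(\<partial>) act by x^j to f(j) x^(j+\<alpha>). The Kac--Peterson
  cocycle, which stems from infinite matrices, has at (x^\<alpha> f(\<partial>), x^(-\<alpha>)
  g(\<partial>)) the sum of f(j) g(j + \<alpha>) over -\<alpha> \<le> j < 0 as its value;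
  \<open>psum\<close> extends this to \<alpha> that are not natural numbers.\<close>

definition kac_peterson_weight ::
    "(nat \<Rightarrow> nat) \<Rightarrow> (nat \<Rightarrow> 'a::field_char_0) \<times> (nat \<Rightarrow> int) \<Rightarrow>
     (nat \<Rightarrow> nat) \<Rightarrow> (nat \<Rightarrow> 'a) \<times> (nat \<Rightarrow> int) \<Rightarrow> 'a" where
  "kac_peterson_weight \<mu> k \<nu> k' = (if fst k + fst k' = 0
    then psum (monom 1 (\<mu> 1) * shift (fst k 1) (monom 1 (\<nu> 1))) (- fst k 1) 0 else 0)"

definition kp_form :: "'a::field_char_0 gen_op \<Rightarrow> 'a gen_op \<Rightarrow> 'a" where
  "kp_form a b = basis_sum (\<lambda>\<mu> k. basis_sum (kac_peterson_weight \<mu> k) b) a"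

lemma kp_form_add_left:
  "kp_form (a + a') b = kp_form a b + kp_form a' b"
  by (simp add: kp_form_def basis_sum_add)

lemma kp_form_add_right:
  "kp_form a (b + b') = kp_form a b + kp_form a b'"
  by (simp add: kp_form_def basis_sum_add basis_sum_add_weight)

lemma kp_form_scale: "kp_form (op_scale r a) b = r * kp_form a b"
  by (simp add: kp_form_def basis_sum_op_scale)

text \<open>\<open>op_of_poly \<alpha> p\<close> is \<open>x\<^bsup>\<alpha>\<^esup> p(\<partial>)\<close>.\<close>

definition op_of_poly :: "(nat \<Rightarrow> 'a) \<Rightarrow> 'a::field_char_0 poly \<Rightarrow> 'a gen_op" where
  "op_of_poly \<alpha> p = (\<Sum>j\<le>degree p. single (0(1 := j)) (single (\<alpha>, 0) (coeff p j)))"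

lemma op_of_poly_extend:
  assumes "degree p \<le> n"
  shows "op_of_poly \<alpha> p = (\<Sum>j\<le>n. single (0(1 := j)) (single (\<alpha>, 0) (coeff p j)))"
  unfolding op_of_poly_def
proof (intro sum.mono_neutral_left ballI)
  fix j assume "j \<in> {..n} - {..degree p}"
  then have "coeff p j = 0" by (simp add: coeff_eq_0)
  then show "single (0(1 := j)) (single (\<alpha>, 0) (coeff p j)) = 0" by simp
qed (use assms in auto)

lemma op_of_poly_add: "op_of_poly \<alpha> (p + q) = op_of_poly \<alpha> p + op_of_poly \<alpha> q"
proof -
  define n where "n = max (degree p) (degree q)"
  have "degree (p + q) \<le> n" "degree p \<le> n" "degree q \<le> n"
    using degree_add_le_max[of p q] by (auto simp: n_def)
  then show ?thesis
    by (simp add: op_of_poly_extend[of _ n] single_add sum.distrib del: fun_upd_apply)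
qed

lemma op_of_poly_monom: "op_of_poly \<alpha> (monom r m) = single (0(1 := m)) (single (\<alpha>, 0) r)"
proof -
  have "op_of_poly \<alpha> (monom r m) = (\<Sum>j\<le>m. single (0(1 := j)) (single (\<alpha>, 0) (coeff (monom r m) j)))"
    by (rule op_of_poly_extend) (rule degree_monom_le)
  also have "\<dots> = (\<Sum>j\<in>{m}. single (0(1 := j)) (single (\<alpha>, 0) (coeff (monom r m) j)))"
    by (rule sum.mono_neutral_right) auto
  finally show ?thesis by simp
qed

lemma poly_induct_monom [case_names monom add]:
  fixes p :: "'a::comm_ring_1 poly"
  assumes "\<And>r m. P (monom r m)" "\<And>p q. P p \<Longrightarrow> P q \<Longrightarrow> P (p + q)"
  shows "P p"
proof -
  have "P (\<Sum>i\<in>X. monom (coeff p i) i)" if "finite X" for X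
    using that
  proof (induction X rule: finite_induct)
    case empty
    then show ?case using assms(1)[of 0 0] by simp
  qed (auto intro: assms)
  from this[of "{..degree p}"] show ?thesis by (simp add: poly_as_sum_of_monoms)
qed

lemma kp_form_op_of_poly:
  "kp_form (op_of_poly \<alpha> p) (op_of_poly \<beta> q) =
    (if \<alpha> + \<beta> = 0 then psum (p * shift (\<alpha> 1) q) (- \<alpha> 1) 0 else 0)"
proof (induction p rule: poly_induct_monom)
  case (monom r m)
  show ?case
  proof (induction q rule: poly_induct_monom)
    case (monom s n)
    have val: "((0 :: nat \<Rightarrow> nat)(1 := k)) 1 = k" for k by simp
    have "monom r m = smult r (monom 1 m)" "monom s n = smult s (monom 1 n)"
      by (simp_all add: smult_monom)
    then have "monom r m * shift (\<alpha> 1) (monom s n) = smult (r * s) (monom 1 m * shift (\<alpha> 1) (monom 1 n))"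
      by (simp only: shift_smult mult_smult_left mult_smult_right smult_smult mult.commute[of s r])
    then show ?case
      unfolding op_of_poly_monom kp_form_def basis_sum_single kac_peterson_weight_def val fst_conv
      by (simp add: psum_smult)
  qed (simp add: op_of_poly_add kp_form_add_right shift_add distrib_left psum_add)
qed (simp add: op_of_poly_add kp_form_add_left distrib_right psum_add)

context gen_weyl_1
begin

lemma op_of_poly_C: "\<alpha> \<in> \<Gamma> \<Longrightarrow> op_of_poly \<alpha> p \<in> C"
  unfolding op_of_poly_def by (intro C_sum C_single_1 A_single J_zero)

text \<open>This is p(\<partial>) x^\<beta> = x^\<beta> p(\<partial> + \<beta>). For monomials it
  compares the Leibniz sum with the binomial expansion of (\<partial> + \<beta>)^m.\<close>

lemma mul_op_of_poly:
  assumes "\<alpha> \<in> \<Gamma>" "\<beta> \<in> \<Gamma>"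
  shows "op_mult l (op_of_poly \<alpha> p) (op_of_poly \<beta> q) = op_of_poly (\<alpha> + \<beta>) (shift (\<beta> 1) p * q)"
proof (induction p rule: poly_induct_monom)
  case (monom r m)
  show ?case
  proof (induction q rule: poly_induct_monom)
    case (monom s n)
    have part: "(partial 1 ^^ k) (single (\<beta>, 0) s) = single (\<beta>, 0) (s * \<beta> 1 ^ k)" for k
      by (induction k) (auto simp: partial_exponential mult_ac)
    have monomial: "of_nat (m choose k) * (single (\<alpha>, 0) r * (partial 1 ^^ k) (single (\<beta>, 0) s)) =
        single (\<alpha> + \<beta>, 0) (of_nat (m choose k) * (r * (s * \<beta> 1 ^ k)))" for k
      unfolding part mult_single single_of_nat[symmetric] by (simp add: zero_prod_def)
    have "shift (\<beta> 1) (monom r m) * monom s n =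
        (\<Sum>k\<le>m. monom (of_nat (m choose k) * (r * (s * \<beta> 1 ^ k))) (m + n - k))"
    proof -
      have "shift (\<beta> 1) (monom r m) = smult r (([:\<beta> 1:] + monom 1 1) ^ m)"
      proof -
        have "shift (\<beta> 1) ([:0, 1:] ^ m) = shift (\<beta> 1) [:0, 1:] ^ m"
          by (induction m) (simp_all only: power_0 power_Suc shift_mult shift_one)
        moreover have "shift (\<beta> 1) [:0, 1:] = [:\<beta> 1:] + monom 1 1"
          by (simp add: shift_def pcompose_pCons monom_altdef)
        ultimately show ?thesis by (simp only: monom_altdef[of r] shift_smult)
      qed
      also have "([:\<beta> 1:] + monom 1 1) ^ m = (\<Sum>k\<le>m. of_nat (m choose k) * [:\<beta> 1:] ^ k * monom 1 1 ^ (m - k))"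
        by (rule binomial_ring)
      also have "\<dots> = (\<Sum>k\<le>m. monom (of_nat (m choose k) * \<beta> 1 ^ k) (m - k))"
        by (intro sum.cong refl)
          (simp add: monom_power of_nat_poly poly_const_pow smult_monom)
      finally have "shift (\<beta> 1) (monom r m) * monom s n =
          (\<Sum>k\<le>m. smult r (monom (of_nat (m choose k) * \<beta> 1 ^ k) (m - k)) * monom s n)"
        by (simp only: additive_sum[of "smult r", OF smult_add_right] sum_distrib_right)
      also have "\<dots> = (\<Sum>k\<le>m. monom (of_nat (m choose k) * (r * (s * \<beta> 1 ^ k))) (m + n - k))"
        by (intro sum.cong refl) (simp add: smult_monom mult_monom mult_ac add.commute[of n m])
      finally show ?thesis .
    qed
    then have "op_of_poly (\<alpha> + \<beta>) (shift (\<beta> 1) (monom r m) * monom s n) =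
        (\<Sum>k\<le>m. single (0(1 := m + n - k)) (single (\<alpha> + \<beta>, 0) (of_nat (m choose k) * (r * (s * \<beta> 1 ^ k)))))"
      by (simp only: additive_sum[of "op_of_poly (\<alpha> + \<beta>)", OF op_of_poly_add] op_of_poly_monom)
    then show ?case
      unfolding op_of_poly_monom mul_single[OF A_single[OF assms(1) J_zero]] monomial by simp
  next
    case (add q q')
    then show ?case
      by (simp add: op_of_poly_add distrib_left op_mult_C op_of_poly_C[OF assms(1)] op_act_add_right)
  qed
next
  case (add p p')
  then show ?case
    using op_of_poly_C[OF assms(1), of p] op_of_poly_C[OF assms(1), of p'] op_of_poly_C[OF assms(2), of q]
    by (simp only: op_of_poly_add shift_add distrib_right mul_add_left)
qed

end

section \<open>The exponential direction: cyclicity and uniqueness of the Kac--Peterson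
  class\<close>

locale gen_weyl_4 = gen_weyl_1 +
  assumes l4_eq: "l4 = 1"
begin

lemma J_eq: "J = {0}"
  using l_eq l4_eq by (auto simp: J_set_def fun_ext_simps) metis

lemma C_induct_poly [consumes 1, case_names op_of_poly add]:
  assumes "a \<in> C"
    and "\<And>\<alpha> p. \<alpha> \<in> \<Gamma> \<Longrightarrow> P (op_of_poly \<alpha> p)"
    and "\<And>a b. \<lbrakk>a \<in> C; b \<in> C; P a; P b\<rbrakk> \<Longrightarrow>
      P (a + b)"
  shows "P a"
  using assms(1)
proof (induction a rule: C_induct)
  case (single m u)
  then show ?case
  proof (induction u rule: A_induct)
    case (single \<alpha> i r)
    then have "single (0(1 := m)) (single (\<alpha>, i) r) = op_of_poly \<alpha> (monom r m)"
      by (simp only: J_eq singleton_iff op_of_poly_monom)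
    then show ?case using assms(2)[OF single(1)] by (simp only:)
  next
    case (add u v)
    then show ?case unfolding single_add by (intro assms(3) C_single_1)
  qed
qed (rule assms)

text \<open>Translating the summation variable by \<alpha> turns one summand into the other; the
  interval from -\<alpha> to 0 becomes the one from 0 to \<alpha>, which the other sum traverses
  from \<alpha> to 0.\<close>

lemma kp_form_antisym:
  assumes "a \<in> C" "b \<in> C"
  shows "kp_form a b = - kp_form b a"
  using assms
proof (induction a rule: C_induct_poly)
  case (op_of_poly \<alpha> f)
  from \<open>b \<in> C\<close> show ?case
  proof (induction b rule: C_induct_poly)
    case (op_of_poly \<beta> g)
    show ?case
    proof (cases "\<alpha> + \<beta> = 0")
      case True
      then have \<beta>: "\<beta> = - \<alpha>" by (simp add: add_eq_0_iff)
      have "psum (g * shift (- \<alpha> 1) f) (\<alpha> 1) 0 = psum (shift (- \<alpha> 1) (f * shift (\<alpha> 1) g)) (\<alpha> 1) 0"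
        by (simp add: shift_mult shift_shift mult.commute)
      also have "\<dots> = - psum (f * shift (\<alpha> 1) g) (- \<alpha> 1) 0"
        unfolding psum_shift by (simp add: psum_swap[of _ 0])
      finally show ?thesis
        by (simp add: kp_form_op_of_poly \<beta>)
    next
      case False
      moreover from this have "\<beta> + \<alpha> \<noteq> 0" by (simp add: add.commute)
      ultimately show ?thesis by (simp add: kp_form_op_of_poly)
    qed
  qed (simp add: kp_form_add_left kp_form_add_right)
qed (simp add: kp_form_add_left kp_form_add_right)

text \<open>The three terms are sums of one polynomial over three intervals that form a closed circuit.\<close>

lemma kp_form_cyclic_op_of_poly:
  assumes "\<alpha> \<in> \<Gamma>" "\<beta> \<in> \<Gamma>" "\<gamma> \<in> \<Gamma>"
  shows "kp_form (op_mult l (op_of_poly \<alpha> f) (op_of_poly \<beta> g)) (op_of_poly \<gamma> h) +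
    kp_form (op_mult l (op_of_poly \<beta> g) (op_of_poly \<gamma> h)) (op_of_poly \<alpha> f) +
    kp_form (op_mult l (op_of_poly \<gamma> h) (op_of_poly \<alpha> f)) (op_of_poly \<beta> g) = 0"
proof (cases "\<alpha> + \<beta> + \<gamma> = 0")
  case False
  then have "\<beta> + \<gamma> + \<alpha> \<noteq> 0" "\<gamma> + \<alpha> + \<beta> \<noteq> 0" by (metis add.commute add.left_commute)+
  with False show ?thesis
    using assms by (simp only: mul_op_of_poly kp_form_op_of_poly if_False) simp
next
  case True
  then have True': "\<beta> + \<gamma> + \<alpha> = 0" "\<gamma> + \<alpha> + \<beta> = 0" by (metis add.commute add.left_commute)+
  define a b c where "a = \<alpha> 1" and "b = \<beta> 1" and "c = \<gamma> 1"
  have "(\<alpha> + \<beta> + \<gamma>) 1 = 0" by (simp only: True zero_fun_apply)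
  then have abc: "a = - b - c"
    by (simp add: a_def b_def c_def plus_fun_apply algebra_simps eq_neg_iff_add_eq_0)
  \<comment> \<open>F is the first summand; as \<alpha> + \<beta> + \<gamma> = 0, the others are its
    translates by c and -b. Undoing the translations gives the intervals from c to 0, from -b to c
    and from 0 to -b.\<close>
  define F where "F = shift b f * g * shift (- c) h"
  have 1: "shift b f * g * shift (a + b) h = F" by (simp add: F_def abc)
  have 2: "shift c g * h * shift (b + c) f = shift c F"
    by (simp add: F_def shift_mult shift_shift mult_ac add.commute)
  have 3: "shift a h * f * shift (c + a) g = shift (- b) F"
    by (simp add: F_def shift_mult shift_shift mult_ac abc)
  have "psum F (- (a + b)) 0 + psum (shift c F) (- (b + c)) 0 + psum (shift (- b) F) (- (c + a)) 0 =
      psum F c 0 + psum F (- b) c + psum F 0 (- b)"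
    by (simp add: psum_shift abc)
  also have "\<dots> = 0" by (simp add: psum_def)
  finally show ?thesis
    using assms True True'
    by (simp only: mul_op_of_poly \<Gamma>_add kp_form_op_of_poly simp_thms if_True plus_fun_apply
        a_def[symmetric] b_def[symmetric] c_def[symmetric] 1 2 3)
qed

lemma kp_form_cyclic:
  assumes "a \<in> C" "b \<in> C" "c \<in> C"
  shows "kp_form (op_mult l a b) c + kp_form (op_mult l b c) a +
    kp_form (op_mult l c a) b = 0"
proof -
  define Z where "Z a b c = kp_form (op_mult l a b) c + kp_form (op_mult l b c) a +
    kp_form (op_mult l c a) b" for a b c :: "'a gen_op"
  have Z_rotate: "Z a b c = Z b c a" for a b c by (simp add: Z_def)
  have Z_add: "Z (a + a') b c = Z a b c + Z a' b c" if "a \<in> C" "a' \<in> C" "b \<in> C" "c \<in> C" for a a' b c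
    using that by (simp add: Z_def mul_add_left mul_add_right kp_form_add_left kp_form_add_right)
  have 1: "Z (op_of_poly \<alpha> f) (op_of_poly \<beta> g) c = 0" if ab: "\<alpha> \<in> \<Gamma>" "\<beta> \<in> \<Gamma>" and "c \<in> C" for \<alpha> \<beta> f g c
    using \<open>c \<in> C\<close>
  proof (induction c rule: C_induct_poly)
    case (op_of_poly \<gamma> h)
    show ?case unfolding Z_def by (rule kp_form_cyclic_op_of_poly[OF ab op_of_poly])
  next
    case (add c c')
    then have "Z (c + c') (op_of_poly \<alpha> f) (op_of_poly \<beta> g) = 0"
      using Z_rotate Z_add op_of_poly_C ab by (metis add_0)
    then show ?case using Z_rotate by metis
  qed
  have 2: "Z (op_of_poly \<alpha> f) b c = 0" if a: "\<alpha> \<in> \<Gamma>" and "b \<in> C" and c: "c \<in> C" for \<alpha> f b c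
    using \<open>b \<in> C\<close>
  proof (induction b rule: C_induct_poly)
    case (op_of_poly \<beta> g)
    show ?case by (rule 1[OF a op_of_poly c])
  next
    case (add b b')
    then have "Z (b + b') c (op_of_poly \<alpha> f) = 0"
      using Z_rotate Z_add op_of_poly_C a c by (metis add_0)
    then show ?case using Z_rotate by metis
  qed
  have "Z a b c = 0"
    using assms(1)
  proof (induction a rule: C_induct_poly)
    case (op_of_poly \<alpha> f)
    then show ?case by (rule 2[OF _ assms(2,3)])
  next
    case (add a a')
    then show ?case using Z_add assms by simp
  qed
  then show ?thesis by (simp add: Z_def)
qed

definition kac_peterson :: "'a gen_op \<Rightarrow> 'a gen_op \<Rightarrow> 'a" where
  "kac_peterson a b = (if a \<in> C \<and> b \<in> C then kp_form a b else 0)"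

lemma kac_peterson_cocycles2: "kac_peterson \<in> cocycles2 L"
  unfolding kac_peterson_def[abs_def]
  by (rule cyclic_imp_cocycle)
    (auto simp: kp_form_add_left kp_form_scale
      intro: kp_form_antisym kp_form_cyclic)

lemma kac_peterson_op_of_poly:
  assumes "\<alpha> \<in> \<Gamma>" "\<beta> \<in> \<Gamma>"
  shows "kac_peterson (op_of_poly \<alpha> p) (op_of_poly \<beta> q) =
    (if \<alpha> + \<beta> = 0 then psum (p * shift (\<alpha> 1) q) (- \<alpha> 1) 0 else 0)"
  using assms by (simp add: kac_peterson_def op_of_poly_C kp_form_op_of_poly)

lemma xd_eq_op_of_poly: "xd \<alpha> 0 (0(1 := m)) = op_of_poly \<alpha> (monom 1 m)"
  by (simp only: xd_def op_of_poly_monom)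

lemma xd_zero_eq_op_of_poly: "xd \<alpha> 0 0 = op_of_poly \<alpha> 1"
proof -
  have "(0 :: nat \<Rightarrow> nat)(1 := 0) = 0" by (auto simp: fun_ext_simps)
  then show ?thesis using xd_eq_op_of_poly[of \<alpha> 0] by (simp only: monom_eq_1)
qed

lemma op_scale_op_of_poly: "op_scale r (op_of_poly \<alpha> p) = op_of_poly \<alpha> (smult r p)"
proof (induction p rule: poly_induct_monom)
  case (monom s m)
  show ?case
    by (simp only: smult_monom op_of_poly_monom op_scale_eq_mult mult_single add_0)
qed (simp add: op_of_poly_add smult_add_right op_scale_eq_mult distrib_left)

lemma falling_d_eq: "falling_d m = (op_of_poly 0 (falling_poly m) :: 'a gen_op)"
proof (induction m)
  case 0
  then show ?case by (simp add: xd_zero_eq_op_of_poly)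
next
  case (Suc m)
  have "xd 0 0 (0(1 := 1)) - op_scale (of_nat m) (xd 0 0 0) =
      op_of_poly 0 (monom 1 1) - op_of_poly 0 (smult (of_nat m) 1)"
    by (simp only: xd_eq_op_of_poly xd_zero_eq_op_of_poly op_scale_op_of_poly)
  also have "\<dots> = op_of_poly 0 (monom 1 1 - smult (of_nat m) 1)"
    by (simp only: additive_diff[of "op_of_poly 0", OF op_of_poly_add])
  also have "monom 1 1 - smult (of_nat m) 1 = [:- of_nat m, 1 :: 'a:]"
    by (simp add: monom_altdef one_pCons)
  finally have "falling_d (Suc m) = op_mult l (op_of_poly 0 (falling_poly m)) (op_of_poly 0 [:- of_nat m, 1 :: 'a:])"
    using Suc.IH by (simp only: falling_d.simps l_eq)
  then show ?case
    by (simp only: mul_op_of_poly[OF \<Gamma>_zero \<Gamma>_zero] zero_fun_apply[of 1] shift_zero add_0 falling_poly.simps)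
qed

lemma x_falling_d_eq: "\<alpha> \<in> \<Gamma> \<Longrightarrow> x_falling_d \<alpha> m = op_of_poly \<alpha> (falling_poly m)"
  using mul_op_of_poly[of \<alpha> 0 1 "falling_poly m"]
  by (simp only: x_falling_d_def xd_zero_eq_op_of_poly falling_d_eq l_eq \<Gamma>_zero shift_one mult_1_left add_0_right)

lemma kac_peterson_x_falling_d:
  assumes "\<alpha> \<in> \<Gamma>" "\<beta> \<in> \<Gamma>"
  shows "kac_peterson (x_falling_d \<alpha> \<mu>) (x_falling_d \<beta> \<nu>) =
    (if \<alpha> + \<beta> = 0
     then (- 1) ^ \<mu> * fact \<mu> * fact \<nu> * ((\<alpha> 1 + of_nat \<mu>) gchoose (\<mu> + \<nu> + 1)) else 0)"
  by (simp only: x_falling_d_eq assms kac_peterson_op_of_poly psum_falling_poly)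

lemma exp_eq_op_of_poly: "single 0 (single (\<alpha>, 0) 1) = op_of_poly \<alpha> 1"
  using xd_zero_eq_op_of_poly[of \<alpha>] by (simp only: xd_def)

lemma kac_peterson_exp:
  assumes "\<alpha> \<in> \<Gamma>" "\<beta> \<in> \<Gamma>"
  shows "kac_peterson (op_of_poly \<alpha> 1) (op_of_poly \<beta> 1) = (if \<alpha> + \<beta> = 0 then \<alpha> 1 else 0)"
  using kac_peterson_op_of_poly[OF assms, of 1 1] psum_falling_poly[of 0 "\<alpha> 1" 0] by simp

lemma exists_nonzero_weight: "\<exists>\<alpha>\<in>\<Gamma>. \<alpha> 1 \<noteq> 0"
  using \<Gamma>_separates[of 1 1 2 0] l_eq l4_eq by auto

text \<open>x^\<alpha> and x^(-\<alpha>) commute, so a coboundary vanishes on them, while this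
  cocycle has the value \<alpha>_1.\<close>

lemma kac_peterson_not_coboundary: "kac_peterson \<notin> coboundaries2 L"
proof
  assume "kac_peterson \<in> coboundaries2 L"
  then obtain f where f: "linear_on L f" "kac_peterson = coboundary2 L f"
    by (auto simp: coboundaries2_def)
  obtain \<alpha> where \<alpha>: "\<alpha> \<in> \<Gamma>" "\<alpha> 1 \<noteq> 0" using exists_nonzero_weight by blast
  have "f 0 = 0"
    using f(1)[unfolded linear_on_def] zero_C scl_zero[of 0] by (metis L_simps(1,2) mult_zero_left)
  moreover have "br (op_of_poly \<alpha> 1) (op_of_poly (- \<alpha>) 1) = 0"
    unfolding exp_eq_op_of_poly[symmetric] using \<alpha> by (intro br_fun_fun A_single) simp_all
  ultimately have "kac_peterson (op_of_poly \<alpha> 1) (op_of_poly (- \<alpha>) 1) = 0"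
    using \<alpha> by (simp add: f(2) coboundary2_def)
  then show False using kac_peterson_exp[of \<alpha> "- \<alpha>"] \<alpha> by simp
qed

lemma cocycle_eq_kac_peterson:
  assumes "\<psi> \<in> cocycles2 L"
  shows "\<exists>c. \<psi> - (\<lambda>u v. c * kac_peterson u v) \<in> coboundaries2 L"
proof -
  obtain \<alpha> where \<alpha>: "\<alpha> \<in> \<Gamma>" "\<alpha> 1 \<noteq> 0" using exists_nonzero_weight by blast
  define x where "x = op_of_poly \<alpha> 1"
  have x: "x = single 0 (single (\<alpha>, 0) 1)" by (simp add: x_def exp_eq_op_of_poly)
  have one: "1 \<in> {1..l}" using l_eq by simp
  note wp = weyl_pair_exponential[OF \<alpha>(1) one \<alpha>(2), folded x]
  \<comment> \<open>\<open>kac_peterson\<close> has the value \<alpha>_1 at (x, x^(-\<alpha>)), so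
    this c makes \<chi> vanish there, at the one exponential that brackets with d do not
    reach.\<close>
  define c where "c = \<psi> x (op_of_poly (- \<alpha>) 1) / \<alpha> 1"
  define \<chi> where "\<chi> = \<psi> - (\<lambda>u v. c * kac_peterson u v)"
  have "\<chi> \<in> cocycles2 L"
    unfolding \<chi>_def by (intro cocycles2_diff assms cocycles2_scale kac_peterson_cocycles2)
  then interpret psi: alg_cocycle C "op_mult l" op_scale "xd 0 0 0" \<psi> +
      chi: alg_cocycle C "op_mult l" op_scale "xd 0 0 0" \<chi>
    using assms by unfold_locales
  have x_C: "x \<in> C" using op_of_poly_C[OF \<alpha>(1)] by (simp add: x_def)
  have mono: "\<chi> x (op_of_poly \<gamma> 1) = 0" if \<gamma>: "\<gamma> \<in> \<Gamma>" for \<gamma>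
  proof (cases "\<gamma> = - \<alpha>")
    case True
    then show ?thesis
      using \<alpha> by (simp add: \<chi>_def c_def x_def kac_peterson_exp)
  next
    case False
    \<comment> \<open>With d = x^(-\<alpha>) \<partial> / \<alpha>_1, the bracket
      [d, x^(\<gamma>+\<alpha>)] is x^\<gamma> times (\<gamma> + \<alpha>)_1 / \<alpha>_1, and this
      factor is nonzero unless \<gamma> = -\<alpha>.\<close>
    define \<beta> where "\<beta> = \<gamma> + \<alpha>"
    have \<beta>: "\<beta> \<in> \<Gamma>" "\<beta> \<noteq> 0" using False \<gamma> \<alpha> by (auto simp: \<beta>_def add_eq_0_iff2)
    have "\<beta> 1 \<noteq> 0"
    proof
      assume "\<beta> 1 = 0"
      then have "\<beta> p = 0" for p using \<Gamma>_supp[OF \<beta>(1), of p] l_eq by (cases "p = 1") auto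
      then show False using \<beta>(2) by (auto simp: fun_ext_simps)
    qed
    let ?d = "single (0(1 := 1)) (single (- \<alpha>, 0) (1 / \<alpha> 1))"
    have A: "single (\<beta>, 0) 1 \<in> A" "single (\<alpha>, 0) 1 \<in> A" "single (- \<alpha>, 0) (1 / \<alpha> 1) \<in> A"
      using \<alpha> \<beta> by (auto intro!: A_single)
    have "br ?d (single 0 (single (\<beta>, 0) 1)) =
        single 0 (single (- \<alpha>, 0) (1 / \<alpha> 1) * partial 1 (single (\<beta>, 0) 1))"
      by (rule br_d_fun[OF one A(3,1)])
    also have "\<dots> = op_scale (\<beta> 1 / \<alpha> 1) (op_of_poly \<gamma> 1)"
      unfolding exp_eq_op_of_poly[symmetric] op_scale_eq_mult partial_exponential mult_single
      by (simp add: \<beta>_def)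
    finally have "\<chi> x (op_scale (\<beta> 1 / \<alpha> 1) (op_of_poly \<gamma> 1)) = 0"
      using chi.psi_bracket_pair[OF wp, of "single 0 (single (\<beta>, 0) 1)"] br_fun_fun[OF A(1,2)] A
      by (simp add: x)
    then have "\<beta> 1 / \<alpha> 1 * \<chi> x (op_of_poly \<gamma> 1) = 0"
      using chi.psi_scl_right[OF x_C op_of_poly_C[OF \<gamma>]] by simp
    then show ?thesis using \<open>\<beta> 1 \<noteq> 0\<close> \<alpha> by simp
  qed
  have zero: "\<chi> x (single 0 k) = 0" if "k \<in> A" for k
    using that
  proof (induction k rule: A_induct)
    case (single \<gamma> i r)
    have "single 0 (single (\<gamma>, i) r) = op_scale r (op_of_poly \<gamma> 1)"
      unfolding exp_eq_op_of_poly[symmetric] op_scale_eq_mult using single by (simp add: mult_single J_eq)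
    then show ?case
      using chi.psi_scl_right[OF x_C op_of_poly_C[OF single(1)]] mono[OF single(1)] by simp
  qed (simp add: single_add chi.psi_add_right x_C)
  have "\<chi> \<in> coboundaries2 L"
  proof (rule chi.coboundary_criterion[OF wp])
    fix k assume k: "k \<in> C" "br k x = 0"
    have "partial 1 (single (\<alpha>, 0) 1) * single (- \<alpha>, 0) (1 / \<alpha> 1) = 1"
      using \<alpha>(2) by (simp add: partial_exponential mult_single zero_prod_def[symmetric])
    then have "k = single 0 (lookup k 0)"
      using k \<alpha> by (intro centralizer_fun[of "single (\<alpha>, 0) 1"]) (auto simp: x A_single)
    then show "\<chi> x k = 0" using zero[OF C_lookup[OF k(1), of 0]] by simp
  qed
  then show ?thesis by (auto simp: \<chi>_def)
qed

lemma H2_eq_kac_peterson_line: "H2 L = H2_line L (coh_class L kac_peterson)"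
proof
  show "H2 L \<subseteq> H2_line L (coh_class L kac_peterson)"
  proof
    fix X assume "X \<in> H2 L"
    then obtain \<psi> where \<psi>: "\<psi> \<in> cocycles2 L" "X = coh_class L \<psi>" by (auto simp: H2_def)
    obtain c where "\<psi> - (\<lambda>u v. c * kac_peterson u v) \<in> coboundaries2 L"
      using cocycle_eq_kac_peterson[OF \<psi>(1)] by blast
    then have "X = H2_scale L c (coh_class L kac_peterson)"
      by (simp add: \<psi>(2) H2_scale_coh_class coh_class_eq_iff)
    then show "X \<in> H2_line L (coh_class L kac_peterson)" by (simp add: H2_line_def)
  qed
  show "H2_line L (coh_class L kac_peterson) \<subseteq> H2 L"
    by (auto simp: H2_line_def H2_def H2_scale_coh_class intro!: imageI cocycles2_scale kac_peterson_cocycles2)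
qed

end

text \<open>Cocycle values are prescribed on spanning families, x^\<alpha> [\<partial>]_m in the
  second clause and the monomials in the third, so bilinearity leaves no freedom. The finiteness
  clause makes the sum over the \<gamma> with nonzero value a genuine finite sum, and \<Phi> renders
  the direct product as a linear isomorphism pinned down on all families of scalars.\<close>

theorem theorem3p1:
  fixes l1 l2 l3 l4 l :: nat
    and \<Gamma> :: "(nat \<Rightarrow> 'a::field_char_0) set"
    and W :: "('a, 'a gen_op) lie_algebra"
  assumes l_def: "l = l1 + l2 + l3 + l4"
    and l_pos: "l > 0"
    and \<Gamma>: "nondegenerate_subgroup l1 l \<Gamma>"
    and W_def: "W = W_algebra l1 l2 l3 l4 \<Gamma>"
  shows "(l1 + l2 \<noteq> 0 \<or> l \<ge> 2 \<longrightarrow> H2 W = {coh_class W 0}) \<and>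
    (l = 1 \<and> l4 = 1 \<longrightarrow>
      (\<exists>\<phi>\<^sub>0 \<in> cocycles2 W.
        (\<forall>\<alpha>\<in>\<Gamma>. \<forall>\<beta>\<in>\<Gamma>. \<forall>\<mu> \<nu> :: nat.
          \<phi>\<^sub>0 (x_falling_d \<alpha> \<mu>) (x_falling_d \<beta> \<nu>) =
            (if \<alpha> + \<beta> = 0
             then (-1) ^ \<mu> * fact \<mu> * fact \<nu> * ((\<alpha> 1 + of_nat \<mu>) gchoose (\<mu> + \<nu> + 1))
             else 0)) \<and>
        coh_class W \<phi>\<^sub>0 \<noteq> coh_class W 0 \<and>
        H2 W = H2_line W (coh_class W \<phi>\<^sub>0))) \<and>
    (l = 1 \<and> l3 = 1 \<longrightarrow>
      (\<exists>\<phi> :: (nat \<Rightarrow> 'a) \<Rightarrow> 'a gen_op \<Rightarrow> 'a gen_op \<Rightarrow> 'a.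
        (\<forall>\<gamma>\<in>\<Gamma>. \<phi> \<gamma> \<in> cocycles2 W \<and>
          (\<forall>\<alpha>\<in>\<Gamma>. \<forall>\<beta>\<in>\<Gamma>. \<forall>i j :: int. \<forall>\<mu> \<nu> :: nat.
            \<phi> \<gamma> (xd \<alpha> (0(1 := i)) (0(1 := \<mu>))) (xd \<beta> (0(1 := j)) (0(1 := \<nu>))) =
              (if \<alpha> + \<beta> = \<gamma>
               then (-1) ^ \<mu> * fact \<mu> * fact \<nu> *
                 (\<Sum>s = 0..\<mu> + \<nu> + 1. (of_int i gchoose s) *
                    (\<alpha> 1 ^ (\<mu> + \<nu> + 1 - s) / fact (\<mu> + \<nu> + 1 - s)) *
                    divided_power (\<gamma> 1) (int s - i - j - 1))
               else 0)) \<and>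
          coh_class W (\<phi> \<gamma>) \<noteq> coh_class W 0) \<and>
        (\<forall>u v. finite {\<gamma>\<in>\<Gamma>. \<phi> \<gamma> u v \<noteq> 0}) \<and>
        (\<exists>\<Phi>. bij_betw \<Phi> (\<Pi>\<^sub>E \<gamma>\<in>\<Gamma>. H2_line W (coh_class W (\<phi> \<gamma>))) (H2 W) \<and>
          (\<forall>h \<in> (\<Pi>\<^sub>E \<gamma>\<in>\<Gamma>. H2_line W (coh_class W (\<phi> \<gamma>))).
            \<forall>h' \<in> (\<Pi>\<^sub>E \<gamma>\<in>\<Gamma>. H2_line W (coh_class W (\<phi> \<gamma>))).
              \<Phi> (\<lambda>\<gamma>\<in>\<Gamma>. h \<gamma> + h' \<gamma>) = \<Phi> h + \<Phi> h') \<and>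
          (\<forall>c. \<forall>h \<in> (\<Pi>\<^sub>E \<gamma>\<in>\<Gamma>. H2_line W (coh_class W (\<phi> \<gamma>))).
              \<Phi> (\<lambda>\<gamma>\<in>\<Gamma>. H2_scale W c (h \<gamma>)) = H2_scale W c (\<Phi> h)) \<and>
          (\<forall>b :: (nat \<Rightarrow> 'a) \<Rightarrow> 'a.
            (\<lambda>u v. \<Sum>\<gamma> | \<gamma> \<in> \<Gamma> \<and> \<phi> \<gamma> u v \<noteq> 0. b \<gamma> * \<phi> \<gamma> u v) \<in> cocycles2 W \<and>
            \<Phi> (\<lambda>\<gamma>\<in>\<Gamma>. H2_scale W (b \<gamma>) (coh_class W (\<phi> \<gamma>))) =
              coh_class W (\<lambda>u v. \<Sum>\<gamma> | \<gamma> \<in> \<Gamma> \<and> \<phi> \<gamma> u v \<noteq> 0. b \<gamma> * \<phi> \<gamma> u v)))))"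
proof -
  interpret gen_weyl l1 l2 l3 l4 \<Gamma>
    using \<Gamma> by unfold_locales (simp add: l_def)
  have W: "W = L"
    by (simp add: W_def W_algebra_eq_L)
  show ?thesis
    unfolding W
  proof (intro conjI impI, goal_cases)
    case 1
    have "cocycles2 L \<subseteq> coboundaries2 L"
    proof (cases "l \<ge> 2")
      case True
      then show ?thesis using coboundary_if_two_directions l_def by blast
    next
      case False
      interpret gen_weyl_1 l1 l2 l3 l4 \<Gamma>
        by unfold_locales (use False l_pos l_def in linarith)
      have "l1 + l2 = 1" using 1 False l_def by auto
      then show ?thesis using coboundary_if_polynomial_direction by blast
    qed
    then show ?case by (rule H2_trivial)
  next
    case 2
    interpret gen_weyl_4 l1 l2 l3 l4 \<Gamma>
      using 2 l_def by unfold_locales simp_all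
    have "coh_class L kac_peterson \<noteq> coh_class L 0"
      using kac_peterson_not_coboundary by (simp add: coh_class_eq_iff)
    then show ?case
      using kac_peterson_x_falling_d H2_eq_kac_peterson_line kac_peterson_cocycles2
      by (intro bexI[of _ kac_peterson] conjI ballI allI) blast+
  next
    case 3
    interpret gen_weyl_3 l1 l2 l3 l4 \<Gamma>
      using 3 l_def by unfold_locales simp_all
    have values_xd:
      "residue_cocycle (delta \<gamma>) (xd \<alpha> (0(1 := i)) (0(1 := \<mu>))) (xd \<beta> (0(1 := j)) (0(1 := \<nu>))) =
        (if \<alpha> + \<beta> = \<gamma>
         then (-1) ^ \<mu> * fact \<mu> * fact \<nu> *
           (\<Sum>s = 0..\<mu> + \<nu> + 1. (of_int i gchoose s) *
              (\<alpha> 1 ^ (\<mu> + \<nu> + 1 - s) / fact (\<mu> + \<nu> + 1 - s)) *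
              divided_power (\<gamma> 1) (int s - i - j - 1))
         else 0)" if "\<alpha> \<in> \<Gamma>" "\<beta> \<in> \<Gamma>" for \<alpha> \<beta> \<gamma> i j \<mu> \<nu>
    proof -
      have "xd \<alpha> (0(1 := i)) (0(1 := \<mu>)) \<in> op_carrier l1 l2 l3 l4 \<Gamma>"
        "xd \<beta> (0(1 := j)) (0(1 := \<nu>)) \<in> op_carrier l1 l2 l3 l4 \<Gamma>"
        unfolding xd_def using that by (auto intro!: C_single_1 A_single J_all)
      then show ?thesis
        by (simp only: residue_cocycle_def pairing_xd delta_def) simp
    qed
    show ?case
      by (rule exI[of _ "\<lambda>\<gamma>. residue_cocycle (delta \<gamma>)"], unfold sum_residue_cocycle_delta,
          intro conjI ballI allI)
        (rule H2_product residue_cocycle_cocycles2 finite_residue_cocycle_delta |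
          rule values_xd residue_class_nonzero; assumption)+
  qed
qed

end
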